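(* Two unimodal transitive maps are conjugate if and only if their dimension triples are isomorphic.
   Context: Let $I=[0,1]$. A unimodal map $\tau:I\to I$ is a continuous map for which there is $c\in(0,1)$ such that $\tau$ is strictly increasing on $[0,c]$ and strictly decreasing on $[c,1]$; its associated partition is $\{0,c,1\}$. $\tau$ is transitive if for all non-empty open $U,V\subset I$ there is $n\ge0$ with $\tau^n(U)\cap V\neq\emptyset$. Maps $\tau_1,\tau_2$ are conjugate if $h\circ\tau_1=\tau_2\circ h$ for some homeomorphism $h:I\to I$. The generalized orbit of $x\in I$ is the smallest subset of $I$ containing $x$ that is forward and backward invariant under $\tau$. $I_1$ is the union of the generalized orbits of $0,c,1$, and $I_0=I\setminus I_1$. $X$ is the totally ordered set obtained from $I$ by replacing each $x\in I_1\setminus\{0,1\}$ by two points $x^-<x^+$, with the order topology (homeomorphic to a compact subset of $\mathbb R$); $\pi:X\to I$ is the collapse map ($\pi(x^\pm)=x$), and $X_0=\pi^{-1}(I_0)$. The local homeomorphism associated with $\tau$ is the unique continuous map $\sigma:X\to X$ with $\pi\circ\sigma=\tau\circ\pi$ on $X_0$. Let $(\mathcal L f)(x)=\sum_{\sigma y=x}f(y)$ for $f\in C(X,\mathbb Z)$. $DG(\tau)$ is $C(X,\mathbb Z)$ modulo $f\sim g$ iff $\mathcal L^nf=\mathcal L^ng$ for some $n\ge0$, ordered by $[f]\ge0$ iff $\mathcal L^nf\ge0$ for some $n$, and $\mathcal L_*[f]=[\mathcal Lf]$. The dimension triple of $\tau$ is $(DG(\tau),DG(\tau)^+,\mathcal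 L_* )$; an isomorphism of dimension triples is a group isomorphism carrying positive cone onto positive cone and intertwining the maps $\mathcal L_*$. *)

theory Defs
  imports "HOL-Analysis.Analysis" "HOL-Algebra.Group"
begin

section \<open>Unimodal maps of the unit interval\<close>

text \<open>A map of the unit interval into itself is represented by a function on the reals of which
  only the values on \<open>{0..1}\<close> matter.\<close>

definition unimodal_at :: "(real \<Rightarrow> real) \<Rightarrow> real \<Rightarrow> bool" where
  "unimodal_at \<tau> c \<longleftrightarrow> \<tau> ` {0..1} \<subseteq> {0..1} \<and> continuous_on {0..1} \<tau> \<and> c \<in> {0<..<1} \<and>
     strict_mono_on {0..c} \<tau> \<and> strict_antimono_on {c..1} \<tau>"

definition unimodal :: "(real \<Rightarrow> real) \<Rightarrow> bool" where
  "unimodal \<tau> \<longleftrightarrow> (\<exists>c. unimodal_at \<tau> c)"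

definition turning_point :: "(real \<Rightarrow> real) \<Rightarrow> real" where
  "turning_point \<tau> = (THE c. unimodal_at \<tau> c)"

definition transitive_map :: "(real \<Rightarrow> real) \<Rightarrow> bool" where
  "transitive_map \<tau> \<longleftrightarrow> (\<forall>U V. openin (top_of_set {0..1}) U \<and> openin (top_of_set {0..1}) V \<and>
     U \<noteq> {} \<and> V \<noteq> {} \<longrightarrow> (\<exists>n::nat. (\<tau> ^^ n) ` U \<inter> V \<noteq> {}))"

definition conjugate_maps :: "(real \<Rightarrow> real) \<Rightarrow> (real \<Rightarrow> real) \<Rightarrow> bool" where
  "conjugate_maps \<tau>\<^sub>1 \<tau>\<^sub>2 \<longleftrightarrow>
     (\<exists>h k. homeomorphism {0..1} {0..1} h k \<and> (\<forall>x\<in>{0..1}. h (\<tau>\<^sub>1 x) = \<tau>\<^sub>2 (h x)))"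


section \<open>The disconnected space and its local homeomorphism\<close>

definition generalized_orbit :: "(real \<Rightarrow> real) \<Rightarrow> real \<Rightarrow> real set" where
  "generalized_orbit \<tau> x =
     \<Inter> {A. A \<subseteq> {0..1} \<and> x \<in> A \<and> \<tau> ` A \<subseteq> A \<and> \<tau> -` A \<inter> {0..1} \<subseteq> A}"

definition I\<^sub>1 :: "(real \<Rightarrow> real) \<Rightarrow> real set" where
  "I\<^sub>1 \<tau> = (\<Union>a\<in>{0, turning_point \<tau>, 1}. generalized_orbit \<tau> a)"

definition I\<^sub>0 :: "(real \<Rightarrow> real) \<Rightarrow> real set" where
  "I\<^sub>0 \<tau> = {0..1} - I\<^sub>1 \<tau>"

text \<open>A split point \<open>x\<close> is represented by \<open>(x, False)\<close> (that is, \<open>x\<^sup>-\<close>) and \<open>(x, True)\<close> (that is,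
  \<open>x\<^sup>+\<close>); a point that is not split is represented by \<open>(x, False)\<close> alone.  The collapse map is
  then the first projection.\<close>

definition split_space :: "(real \<Rightarrow> real) \<Rightarrow> (real \<times> bool) set" where
  "split_space \<tau> = {0..1} \<times> {False} \<union> (I\<^sub>1 \<tau> - {0, 1}) \<times> {True}"

abbreviation collapse :: "real \<times> bool \<Rightarrow> real" where
  "collapse \<equiv> fst"

definition split_space\<^sub>0 :: "(real \<Rightarrow> real) \<Rightarrow> (real \<times> bool) set" where
  "split_space\<^sub>0 \<tau> = {p \<in> split_space \<tau>. collapse p \<in> I\<^sub>0 \<tau>}"

text \<open>The lexicographic order; the library's \<open>Product_Lexorder\<close> cannot be loaded together with
  the componentwise order on products used by \<open>HOL-Analysis\<close>.\<close>

definition split_less :: "real \<times> bool \<Rightarrow> real \<times> bool \<Rightarrow> bool" where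
  "split_less p q \<longleftrightarrow> fst p < fst q \<or> (fst p = fst q \<and> snd p < snd q)"

text \<open>The order topology, generated by the open rays with endpoint in the space; it is not the
  topology induced from the product topology on \<open>real \<times> bool\<close>.\<close>

definition split_topology :: "(real \<Rightarrow> real) \<Rightarrow> (real \<times> bool) topology" where
  "split_topology \<tau> = topology_generated_by
     ({split_space \<tau>} \<union> (\<lambda>a. {p \<in> split_space \<tau>. split_less p a}) ` split_space \<tau> \<union> (\<lambda>a. {p \<in> split_space \<tau>. split_less a p}) ` split_space \<tau>)"

text \<open>Values outside \<open>split_space \<tau>\<close> are normalised by extensionality, so that the map is unique.\<close>

definition local_homeo :: "(real \<Rightarrow> real) \<Rightarrow> real \<times> bool \<Rightarrow> real \<times> bool" where
  "local_homeo \<tau> = (THE \<sigma>. \<sigma> \<in> extensional (split_space \<tau>) \<and>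
     continuous_map (split_topology \<tau>) (split_topology \<tau>) \<sigma> \<and>
     (\<forall>p\<in>split_space\<^sub>0 \<tau>. collapse (\<sigma> p) = \<tau> (collapse p)))"


section \<open>The dimension triple\<close>

definition CXZ :: "(real \<Rightarrow> real) \<Rightarrow> (real \<times> bool \<Rightarrow> int) set" where
  "CXZ \<tau> = {f \<in> extensional (split_space \<tau>). continuous_map (split_topology \<tau>) (discrete_topology UNIV) f}"

definition transfer_op ::
    "(real \<Rightarrow> real) \<Rightarrow> (real \<times> bool \<Rightarrow> int) \<Rightarrow> real \<times> bool \<Rightarrow> int" where
  "transfer_op \<tau> f = (\<lambda>x\<in>split_space \<tau>. \<Sum>y | y \<in> split_space \<tau> \<and> local_homeo \<tau> y = x. f y)"

definition DG_rel :: "(real \<Rightarrow> real) \<Rightarrow> ((real \<times> bool \<Rightarrow> int) \<times> (real \<times> bool \<Rightarrow> int)) set" where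
  "DG_rel \<tau> = {(f, g). f \<in> CXZ \<tau> \<and> g \<in> CXZ \<tau> \<and>
     (\<exists>n::nat. (transfer_op \<tau> ^^ n) f = (transfer_op \<tau> ^^ n) g)}"

text \<open>In the operations below the union is over representatives; as the result does not depend
  on the representatives, it is a union of copies of a single class.  The group is additive, but
  the record type of \<open>HOL-Algebra\<close> writes it multiplicatively.\<close>

definition DG :: "(real \<Rightarrow> real) \<Rightarrow> (real \<times> bool \<Rightarrow> int) set monoid" where
  "DG \<tau> = \<lparr> carrier = CXZ \<tau> // DG_rel \<tau>,
            mult = (\<lambda>A B. \<Union>f\<in>A. \<Union>g\<in>B. DG_rel \<tau> `` {\<lambda>x\<in>split_space \<tau>. f x + g x}),
            one = DG_rel \<tau> `` {\<lambda>x\<in>split_space \<tau>. 0} \<rparr>"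

definition DG_pos :: "(real \<Rightarrow> real) \<Rightarrow> (real \<times> bool \<Rightarrow> int) set set" where
  "DG_pos \<tau> = {DG_rel \<tau> `` {f} |f. f \<in> CXZ \<tau> \<and>
     (\<exists>n::nat. \<forall>x\<in>split_space \<tau>. (transfer_op \<tau> ^^ n) f x \<ge> 0)}"

definition L_star :: "(real \<Rightarrow> real) \<Rightarrow> (real \<times> bool \<Rightarrow> int) set \<Rightarrow> (real \<times> bool \<Rightarrow> int) set" where
  "L_star \<tau> A = (\<Union>f\<in>A. DG_rel \<tau> `` {transfer_op \<tau> f})"

type_synonym 'a triple = "'a monoid \<times> 'a set \<times> ('a \<Rightarrow> 'a)"

definition dimension_triple :: "(real \<Rightarrow> real) \<Rightarrow> (real \<times> bool \<Rightarrow> int) set triple" where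
  "dimension_triple \<tau> = (DG \<tau>, DG_pos \<tau>, L_star \<tau>)"

fun triple_isomorphic :: "'a triple \<Rightarrow> 'b triple \<Rightarrow> bool" where
  "triple_isomorphic (G, P, L) (H, Q, M) \<longleftrightarrow>
     (\<exists>\<phi>\<in>iso G H. \<phi> ` P = Q \<and> (\<forall>a\<in>carrier G. \<phi> (L a) = M (\<phi> a)))"

end

theory Submission
  imports Defs
begin

text \<open>
  The proof compares both maps with the tent map of slope \<open>r\<close>. Call a positive functional \<open>\<omega>\<close> on
  \<open>C(X, \<int>)\<close> a scaled state if \<open>\<omega> \<circ> \<L> = r \<omega>\<close> for some \<open>r > 0\<close> and \<open>\<omega> 1 = 1\<close>. Scaled states
  factor through the dimension group, hence are transported, with the same \<open>r\<close>, by isomorphisms of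
  dimension triples. One exists for every transitive unimodal map: evaluate the resolvent
  \<open>\<Sum>n. t\<^sup>n \<L>\<^sup>n\<close> at a point where it is large, normalise, and let \<open>t\<close> tend to the radius of
  convergence.

  Conversely, a scaled state determines the map up to conjugacy. It assigns to each split point \<open>q\<close>
  the measure \<open>g q\<close> of the part of the space to the left of \<open>q\<close>, and the eigenvalue equation says
  \<open>g (\<tau> q) = tent r (g q)\<close>. Transitivity forces \<open>r > 1\<close>, so that points have no mass and \<open>g\<close>
  extends to a continuous map, which by transitivity again is strictly increasing.
\<close>

section \<open>Transitive unimodal maps\<close>

text \<open>An isomorphism of dimension triples may move the class of the constant 1, so it
  transports a scaled state only up to a positive factor. The scale \<open>r\<close> survives
  because \<open>L_star\<close> is intertwined, which is why both maps are compared with a model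
  depending on \<open>r\<close> alone. The formula of \<open>tent\<close> is forced by two
  consequences of transitivity, \<open>\<tau> c = 1\<close> and \<open>\<tau> 1 = 0\<close>: slopes
  \<open>r\<close> and \<open>-r\<close>, maximum 1 and value 0 at 1 leave no other freedom. The
  limit of the normalised resolvents is a common point of closed sets in a compact product of
  intervals. The resolvents do become large because the set of \<open>t\<close> with bounded
  resolvent is open, so it cannot contain its supremum. The delicate point is \<open>r > 1\<close>:
  the eigenvalue equation gives only \<open>r >= 1\<close>, and \<open>r = 1\<close> is excluded by
  looking at the orbit of 0 (\<open>tau_tau_0\<close>). In the direction from conjugacy to
  isomorphism, the conjugacy is automatically increasing, so it lifts to the split spaces with left
  and right copies preserved.\<close>

locale transitive_unimodal =
  fixes \<tau> :: "real \<Rightarrow> real" and c :: real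
  assumes unimodal_at: "unimodal_at \<tau> c" and transitive: "transitive_map \<tau>"
begin

lemma maps_into: "x \<in> {0..1} \<Longrightarrow> \<tau> x \<in> {0..1}"
  using unimodal_at unfolding unimodal_at_def by blast

lemma continuous: "continuous_on {0..1} \<tau>"
  using unimodal_at unfolding unimodal_at_def by blast

lemma c_bounds: "0 < c" "c < 1"
  using unimodal_at unfolding unimodal_at_def by auto

lemma increasing: "\<lbrakk>0 \<le> x; x < y; y \<le> c\<rbrakk> \<Longrightarrow> \<tau> x < \<tau> y"
  using unimodal_at unfolding unimodal_at_def by (auto simp: strict_mono_on_def)

lemma decreasing: "\<lbrakk>c \<le> x; x < y; y \<le> 1\<rbrakk> \<Longrightarrow> \<tau> y < \<tau> x"
  using unimodal_at unfolding unimodal_at_def by (auto simp: monotone_on_def)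

lemma increasing_iff: "\<lbrakk>0 \<le> x; x \<le> c; 0 \<le> y; y \<le> c\<rbrakk> \<Longrightarrow> \<tau> x < \<tau> y \<longleftrightarrow> x < y"
  by (metis increasing less_asym less_linear)

lemma decreasing_iff: "\<lbrakk>c \<le> x; x \<le> 1; c \<le> y; y \<le> 1\<rbrakk> \<Longrightarrow> \<tau> x < \<tau> y \<longleftrightarrow> y < x"
  by (metis decreasing less_asym less_linear)

lemma increasing_inj: "\<lbrakk>0 \<le> x; x \<le> c; 0 \<le> y; y \<le> c\<rbrakk> \<Longrightarrow> \<tau> x = \<tau> y \<longleftrightarrow> x = y"
  by (metis increasing less_irrefl less_linear)

lemma decreasing_inj: "\<lbrakk>c \<le> x; x \<le> 1; c \<le> y; y \<le> 1\<rbrakk> \<Longrightarrow> \<tau> x = \<tau> y \<longleftrightarrow> x = y"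
  by (metis decreasing less_irrefl less_linear)

section \<open>Consequences of transitivity\<close>

text \<open>Some iterate of the interval from \<open>a\<close> to \<open>b\<close> meets the
  interval from \<open>u\<close> to \<open>v\<close>, and all its iterates stay inside
  \<open>K\<close>. Later arguments exploit transitivity in this form: they exhibit an invariant set
  that contains one interval and misses another.\<close>

lemma invariant_meets:
  assumes "0 \<le> a" "a < b" "b \<le> 1" "\<And>x. \<lbrakk>a < x; x < b\<rbrakk> \<Longrightarrow> x \<in> K" "\<And>x. x \<in> K \<Longrightarrow> \<tau> x \<in> K"
    and "0 \<le> u" "u < v" "v \<le> 1"
  shows "\<exists>x\<in>K. u < x \<and> x < v"
proof -
  have op: "openin (top_of_set {0..1}) {s<..<t}" if "0 \<le> s" "t \<le> 1" for s t :: real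
    using that by (intro open_subset) auto
  have "{a<..<b} \<noteq> {}" "{u<..<v} \<noteq> {}"
    using assms by auto
  then obtain n where n: "(\<tau> ^^ n) ` {a<..<b} \<inter> {u<..<v} \<noteq> {}"
    using transitive op assms unfolding transitive_map_def by meson
  have "(\<tau> ^^ n) ` K \<subseteq> K" for n
    by (induction n) (use assms(5) in auto)
  then show ?thesis
    using n assms(4) by fastforce
qed

text \<open>The image is a closed interval that is mapped into itself, so a gap at either end would
  be an interval missed by an invariant set.\<close>

lemma surjective: "\<tau> ` {0..1} = {0..1}"
proof -
  obtain a b where ab: "\<tau> ` {0..1} = {a..b}"
    using continuous_image_closed_interval[OF _ continuous] by (metis zero_le_one)
  have sub: "{a..b} \<subseteq> {0..1}"
    unfolding ab[symmetric] using maps_into by (rule image_subsetI)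
  have "\<tau> 0 \<in> {a..b}" "\<tau> c \<in> {a..b}" "\<tau> 0 < \<tau> c"
    using c_bounds by (auto simp flip: ab intro: increasing)
  then have "a < b" by auto
  have a0: "0 \<le> a" and b1: "b \<le> 1"
    using sub \<open>a < b\<close> by auto
  have inv: "\<tau> x \<in> {a..b}" if "x \<in> {a..b}" for x
    using that sub unfolding ab[symmetric] by (meson imageI subsetD)
  have "\<not> 0 < a"
    using invariant_meets[OF a0 \<open>a < b\<close> b1 _ inv,  of 0 a] \<open>a < b\<close> b1 by auto
  moreover have "\<not> b < 1"
    using invariant_meets[OF a0 \<open>a < b\<close> b1 _ inv,  of b 1] \<open>a < b\<close> a0 by auto
  ultimately show ?thesis
    using ab a0 b1 by auto
qed

lemma tau_c: "\<tau> c = 1"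
proof -
  obtain x where x: "x \<in> {0..1}" "\<tau> x = 1"
    using surjective by (metis atLeastAtMost_iff imageE order_refl zero_le_one)
  have "\<tau> x \<le> \<tau> c"
    using increasing[of x c] decreasing[of c x] x by (cases x c rule: linorder_cases) auto
  moreover have "\<tau> c \<le> 1"
    using maps_into[of c] c_bounds by auto
  ultimately show ?thesis
    using x by auto
qed

lemma tau_bounds: "0 \<le> x \<Longrightarrow> x \<le> 1 \<Longrightarrow> 0 \<le> \<tau> x" "0 \<le> x \<Longrightarrow> x \<le> 1 \<Longrightarrow> \<tau> x \<le> 1"
  using maps_into[of x] by auto

text \<open>If \<open>\<tau> 1 > 0\<close>, the value 0 is attained only at 0, so 0 is fixed. Then
  every point of \<open>(0, c]\<close> moves up, since otherwise some \<open>[0, y]\<close> would be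
  invariant; hence \<open>[\<tau> 1, 1]\<close> is invariant and misses
  \<open>(0, \<tau> 1)\<close>.\<close>

lemma tau_1: "\<tau> 1 = 0"
proof (rule ccontr)
  assume pos: "\<tau> 1 \<noteq> 0"
  obtain x where x: "x \<in> {0..1}" "\<tau> x = 0"
    using surjective by (metis atLeastAtMost_iff imageE order_refl zero_le_one)
  have "x = 0"
    using increasing[of 0 x] decreasing[of x 1] x pos tau_bounds[of 1] tau_bounds[of 0]
    by (cases "x \<le> c") (auto simp: not_le order.strict_iff_order)
  with x have t0: "\<tau> 0 = 0" by simp
  have above: "y < \<tau> y" if y: "0 < y" "y \<le> c" for y
  proof (rule ccontr)
    assume "\<not> y < \<tau> y"
    have "\<tau> z \<in> {0..y}" if "z \<in> {0..y}" for z
      using tau_bounds[of z] increasing[of z y] that y c_bounds \<open>\<not> y < \<tau> y\<close>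
      by (cases "z = y") auto
    then show False
      using invariant_meets[of 0 y "{0..y}" y 1] y c_bounds by auto
  qed
  define a where "a = \<tau> 1"
  have a: "0 < a" "a < 1"
    using pos tau_bounds[of 1] decreasing[of c 1] c_bounds tau_c by (auto simp: a_def)
  have "\<tau> y \<in> {a..1}" if y: "y \<in> {a..1}" for y
  proof (cases "y \<le> c")
    case True
    then show ?thesis
      using above[of y] y a tau_bounds[of y] by auto
  next
    case False
    then show ?thesis
      using decreasing[of y 1] y a tau_bounds[of y] by (cases "y = 1") (auto simp: a_def)
  qed
  then show False
    using invariant_meets[of a 1 "{a..1}" 0 a] a by auto
qed

text \<open>Uniqueness behind \<open>THE\<close>: two candidates would both be mapped to 1, while
  \<open>\<tau>\<close> increases strictly up to the larger one.\<close>

lemma turning_point: "turning_point \<tau> = c"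
  unfolding turning_point_def
proof (rule the_equality)
  show "unimodal_at \<tau> c" by (fact unimodal_at)
next
  fix d assume "unimodal_at \<tau> d"
  then interpret d: transitive_unimodal \<tau> d
    by unfold_locales (use transitive in auto)
  show "d = c"
    using increasing[of d c] d.increasing[of c d] tau_c d.tau_c c_bounds d.c_bounds
    by (cases c d rule: linorder_cases) auto
qed

lemma tau_lt_1: "\<lbrakk>0 \<le> x; x \<le> 1; x \<noteq> c\<rbrakk> \<Longrightarrow> \<tau> x < 1"
  using increasing[of x c] decreasing[of c x] tau_c by (cases x c rule: linorder_cases) auto

lemma tau_pos: "\<lbrakk>0 < x; x < 1\<rbrakk> \<Longrightarrow> 0 < \<tau> x"
  using increasing[of 0 x] decreasing[of x 1] tau_1 tau_bounds[of 0] c_bounds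
  by (cases "x \<le> c") auto

lemma tau_eq_1_iff: "\<lbrakk>0 \<le> x; x \<le> 1\<rbrakk> \<Longrightarrow> \<tau> x = 1 \<longleftrightarrow> x = c"
  by (metis less_irrefl tau_c tau_lt_1)

lemma tau_eq_0_iff: "\<lbrakk>0 < x; x \<le> 1\<rbrakk> \<Longrightarrow> \<tau> x = 0 \<longleftrightarrow> x = 1"
  using tau_pos[of x] tau_1 by force

lemma left_preimage:
  assumes "\<tau> 0 \<le> y" "y \<le> 1" shows "\<exists>x. 0 \<le> x \<and> x \<le> c \<and> \<tau> x = y"
  using IVT'[of \<tau> 0 y c] assms tau_c c_bounds continuous_on_subset[OF continuous, of "{0..c}"]
  by auto

lemma right_preimage:
  assumes "0 \<le> y" "y \<le> 1" shows "\<exists>x. c \<le> x \<and> x \<le> 1 \<and> \<tau> x = y"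
  using IVT2'[of \<tau> 1 y c] assms tau_c tau_1 c_bounds continuous_on_subset[OF continuous, of "{c..1}"]
  by auto

text \<open>If \<open>\<tau> (\<tau> 0) < \<tau> 0\<close> then \<open>\<tau>\<close> has a fixed point \<open>p\<close> strictly between \<open>c\<close> and \<open>\<tau> 0\<close>. For
  \<open>z < p\<close> close to \<open>p\<close>, one of the interval from \<open>z\<close> to \<open>\<tau> z\<close> and its complement is invariant.\<close>

lemma tau_tau_0:
  assumes "c < \<tau> 0"
  shows "\<tau> 0 \<le> \<tau> (\<tau> 0)"
proof (rule ccontr)
  define a where "a = \<tau> 0"
  assume "\<not> \<tau> 0 \<le> \<tau> (\<tau> 0)"
  then have ta: "\<tau> a < a" by (simp add: a_def)
  have ca: "c < a" and a1: "a < 1"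
    using assms c_bounds by (auto simp: a_def intro: tau_lt_1)
  have "\<exists>p. c \<le> p \<and> p \<le> a \<and> \<tau> p - p = 0"
  proof (rule IVT2')
    show "continuous_on {c..a} (\<lambda>p. \<tau> p - p)"
      using c_bounds a1 by (intro continuous_intros continuous_on_subset[OF continuous]) auto
  qed (use ta ca tau_c c_bounds in auto)
  then obtain p where p: "c \<le> p" "p \<le> a" "\<tau> p = p" by auto
  have cp: "c < p" and pa: "p < a"
    using p ta tau_c c_bounds by (auto simp: order.strict_iff_order)
  have "isCont \<tau> p"
    using continuous cp pa a1 c_bounds by (auto intro: continuous_on_interior)
  then have "\<forall>\<^sub>F z in at p. \<tau> z < a"
    using p pa by (auto simp: isCont_def dest: order_tendstoD)
  then have "\<forall>\<^sub>F z in at_left p. \<tau> z < a"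
    by (auto simp: eventually_at_split)
  moreover have "\<forall>\<^sub>F z in at_left p. z \<in> {c<..<p}"
    using eventually_at_left_real[OF cp] .
  ultimately have "\<forall>\<^sub>F z in at_left p. \<tau> z < a \<and> z \<in> {c<..<p}"
    by eventually_elim auto
  then obtain z where z: "\<tau> z < a" "c < z" "z < p"
    by (auto dest!: eventually_happens)
  have gz: "p < \<tau> z"
    using decreasing[of z p] z p pa a1 by auto
  show False
  proof (cases "z < \<tau> (\<tau> z)")
    case True
    have "\<tau> x \<in> {z<..<\<tau> z}" if "x \<in> {z<..<\<tau> z}" for x
      using decreasing[of z x] decreasing[of x "\<tau> z"] that z a1 True by auto
    then show False
      using invariant_meets[of z "\<tau> z" "{z<..<\<tau> z}" 0 z] z gz a1 c_bounds by auto
  next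
    case False
    \<comment> \<open>\<open>[0, c]\<close> goes to points \<open>>= a > \<tau> z\<close>, which is
      why \<open>z\<close> was chosen with \<open>\<tau> z < a\<close>; \<open>(c, z)\<close> goes
      above \<open>\<tau> z\<close>; \<open>(\<tau> z, 1]\<close> goes below
      \<open>\<tau> (\<tau> z) <= z\<close>.\<close>
    define D where "D = {0..<z} \<union> {\<tau> z<..1}"
    have "\<tau> x \<in> D" if x: "x \<in> D" for x
    proof -
      consider "0 \<le> x" "x \<le> c" | "c < x" "x < z" | "\<tau> z < x" "x \<le> 1"
        using x unfolding D_def by (cases "x \<le> c") auto
      then show ?thesis
      proof cases
        case 1
        then show ?thesis
          using increasing[of 0 x] z c_bounds tau_bounds[of x] by (cases "x = 0") (auto simp: D_def a_def)
      next
        case 2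
        then show ?thesis
          using decreasing[of x z] z c_bounds tau_bounds[of x] cp pa a1 by (auto simp: D_def)
      next
        case 3
        then show ?thesis
          using decreasing[of "\<tau> z" x] z gz c_bounds tau_bounds[of x] cp False by (auto simp: D_def)
      qed
    qed
    then show False
      using invariant_meets[of 0 z D z "\<tau> z"] z gz a1 c_bounds by (auto simp: D_def)
  qed
qed

section \<open>Generalized orbits and the set of split points\<close>

lemma generalized_orbit_props:
  assumes "a \<in> {0..1}"
  shows "generalized_orbit \<tau> a \<subseteq> {0..1}" "a \<in> generalized_orbit \<tau> a"
    "x \<in> {0..1} \<Longrightarrow> \<tau> x \<in> generalized_orbit \<tau> a \<longleftrightarrow> x \<in> generalized_orbit \<tau> a"
proof -
  have "{0..1} \<in> {A. A \<subseteq> {0..1} \<and> a \<in> A \<and> \<tau> ` A \<subseteq> A \<and> \<tau> -` A \<inter> {0..1} \<subseteq> A}"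
    using assms by (auto simp: tau_bounds)
  then show "generalized_orbit \<tau> a \<subseteq> {0..1}"
    unfolding generalized_orbit_def by (rule Inter_lower)
  show "a \<in> generalized_orbit \<tau> a"
    unfolding generalized_orbit_def by auto
  assume x: "x \<in> {0..1}"
  show "\<tau> x \<in> generalized_orbit \<tau> a \<longleftrightarrow> x \<in> generalized_orbit \<tau> a"
  proof
    assume *: "\<tau> x \<in> generalized_orbit \<tau> a"
    show "x \<in> generalized_orbit \<tau> a"
      unfolding generalized_orbit_def
    proof (rule InterI, clarify)
      fix A assume A: "A \<subseteq> {0..1}" "a \<in> A" "\<tau> ` A \<subseteq> A" "\<tau> -` A \<inter> {0..1} \<subseteq> A"
      then have "\<tau> x \<in> A"
        using * by (auto simp: generalized_orbit_def)
      with A(4) x show "x \<in> A" by auto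
    qed
  next
    assume *: "x \<in> generalized_orbit \<tau> a"
    show "\<tau> x \<in> generalized_orbit \<tau> a"
      unfolding generalized_orbit_def
    proof (rule InterI, clarify)
      fix A assume A: "A \<subseteq> {0..1}" "a \<in> A" "\<tau> ` A \<subseteq> A" "\<tau> -` A \<inter> {0..1} \<subseteq> A"
      then have "x \<in> A"
        using * by (auto simp: generalized_orbit_def)
      with A(3) show "\<tau> x \<in> A" by auto
    qed
  qed
qed

lemma I1_subset: "I\<^sub>1 \<tau> \<subseteq> {0..1}"
  unfolding I\<^sub>1_def turning_point using c_bounds generalized_orbit_props(1) by auto

lemma I1_bounds: "q \<in> I\<^sub>1 \<tau> \<Longrightarrow> 0 \<le> q" "q \<in> I\<^sub>1 \<tau> \<Longrightarrow> q \<le> 1"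
  using I1_subset by auto

lemma I1_special: "0 \<in> I\<^sub>1 \<tau>" "c \<in> I\<^sub>1 \<tau>" "1 \<in> I\<^sub>1 \<tau>"
  unfolding I\<^sub>1_def turning_point using c_bounds generalized_orbit_props(2) by auto

lemma I1_invariant: "0 \<le> x \<Longrightarrow> x \<le> 1 \<Longrightarrow> \<tau> x \<in> I\<^sub>1 \<tau> \<longleftrightarrow> x \<in> I\<^sub>1 \<tau>"
  unfolding I\<^sub>1_def turning_point using c_bounds generalized_orbit_props(3) by auto

lemma finite_preimage: "finite {x\<in>{0..1}. (\<tau> ^^ n) x = b}"
proof (induction n)
  case 0
  have "{x\<in>{0..1}. (\<tau> ^^ 0) x = b} \<subseteq> {b}" by auto
  then show ?case by (rule finite_subset) auto
next
  case (Suc n)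
  have one: "finite {x\<in>{0..1}. \<tau> x = y}" for y
  proof -
    have "{x\<in>{0..1}. \<tau> x = y} = {x\<in>{0..c}. \<tau> x = y} \<union> {x\<in>{c..1}. \<tau> x = y}"
      using c_bounds by auto
    moreover have "finite {x\<in>{0..c}. \<tau> x = y}"
      by (rule finite_vimage_IntI[of "{y}" \<tau> "{0..c}", THEN finite_subset[rotated]])
        (auto simp: inj_on_def increasing_inj)
    moreover have "finite {x\<in>{c..1}. \<tau> x = y}"
      by (rule finite_vimage_IntI[of "{y}" \<tau> "{c..1}", THEN finite_subset[rotated]])
        (auto simp: inj_on_def decreasing_inj)
    ultimately show ?thesis by simp
  qed
  have "{x\<in>{0..1}. (\<tau> ^^ Suc n) x = b} \<subseteq>
      (\<Union>y\<in>{y\<in>{0..1}. (\<tau> ^^ n) y = b}. {x\<in>{0..1}. \<tau> x = y})"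
    by (auto simp: tau_bounds funpow_swap1)
  then show ?case
    by (rule finite_subset) (use Suc one in auto)
qed

text \<open>The points whose forward orbit meets that of \<open>a\<close> form a fully invariant
  set, which is countable because the iterates have finite fibres.\<close>

lemma countable_I1: "countable (I\<^sub>1 \<tau>)"
proof -
  have *: "countable (generalized_orbit \<tau> a)" if "a \<in> {0..1}" for a
  proof -
    define A where "A = (\<Union>m n. {x\<in>{0..1}. (\<tau> ^^ m) x = (\<tau> ^^ n) a})"
    have "A \<subseteq> {0..1}" "a \<in> A"
      using that by (auto simp: A_def)
    moreover have "\<tau> ` A \<subseteq> A"
    proof clarify
      fix x assume "x \<in> A"
      then obtain m n where x: "x \<in> {0..1}" "(\<tau> ^^ m) x = (\<tau> ^^ n) a"
        by (auto simp: A_def)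
      then have "(\<tau> ^^ m) (\<tau> x) = (\<tau> ^^ Suc n) a"
        by (simp flip: funpow_swap1)
      then show "\<tau> x \<in> A"
        using maps_into[OF x(1)] unfolding A_def by blast
    qed
    moreover have "\<tau> -` A \<inter> {0..1} \<subseteq> A"
    proof clarify
      fix x assume "\<tau> x \<in> A" and x: "x \<in> {0..1}"
      then obtain m n where "(\<tau> ^^ m) (\<tau> x) = (\<tau> ^^ n) a"
        by (auto simp: A_def)
      then have "(\<tau> ^^ Suc m) x = (\<tau> ^^ n) a"
        by (simp add: funpow_swap1)
      then show "x \<in> A"
        using x unfolding A_def by blast
    qed
    ultimately have "generalized_orbit \<tau> a \<subseteq> A"
      unfolding generalized_orbit_def by blast
    moreover have "countable A"
      unfolding A_def by (intro countable_UN countableI_type countable_finite[OF finite_preimage])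
    ultimately show ?thesis
      by (rule countable_subset)
  qed
  then show ?thesis
    unfolding I\<^sub>1_def turning_point using *[of 0] *[of c] *[of 1] c_bounds by simp
qed

text \<open>The split points are countable, an interval is not. This density is what makes
  \<open>local_homeo\<close> unique.\<close>

lemma I0_dense:
  assumes "0 \<le> u" "u < v" "v \<le> 1"
  shows "\<exists>x\<in>I\<^sub>0 \<tau>. u < x \<and> x < v"
proof (rule ccontr)
  assume "\<not> ?thesis"
  then have "{u<..<v} \<subseteq> I\<^sub>1 \<tau>"
    using assms by (auto simp: I\<^sub>0_def)
  then have "countable {u<..<v}"
    using countable_I1 countable_subset by blast
  then show False
    using uncountable_open_interval[of u v] assms by simp
qed

end

section \<open>The split space and its local homeomorphism\<close>

lemma split_less_linear: "split_less p q \<or> p = q \<or> split_less q p"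
  by (cases p; cases q) (auto simp: split_less_def)

lemma split_less_irrefl [simp]: "\<not> split_less p p"
  by (auto simp: split_less_def)

lemma split_less_trans: "split_less p q \<Longrightarrow> split_less q r \<Longrightarrow> split_less p r"
  by (auto simp: split_less_def)

lemma split_less_asym: "split_less p q \<Longrightarrow> \<not> split_less q p"
  by (auto simp: split_less_def)

lemma topspace_split_topology [simp]: "topspace (split_topology \<tau>) = split_space \<tau>"
  unfolding split_topology_def topology_generated_by_topspace by auto

lemma openin_less_ray: "a \<in> split_space \<tau> \<Longrightarrow> openin (split_topology \<tau>) {p \<in> split_space \<tau>. split_less p a}"
  unfolding split_topology_def by (rule topology_generated_by_Basis) auto

lemma openin_greater_ray: "a \<in> split_space \<tau> \<Longrightarrow> openin (split_topology \<tau>) {p \<in> split_space \<tau>. split_less a p}"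
  unfolding split_topology_def by (rule topology_generated_by_Basis) auto

lemma continuous_map_into_split_topology:
  assumes "f \<in> topspace T \<rightarrow> split_space \<tau>"
    and less: "\<And>a. a \<in> split_space \<tau> \<Longrightarrow> openin T {p \<in> topspace T. split_less (f p) a}"
    and greater: "\<And>a. a \<in> split_space \<tau> \<Longrightarrow> openin T {p \<in> topspace T. split_less a (f p)}"
  shows "continuous_map T (split_topology \<tau>) f"
proof -
  have eq: "f -` {p \<in> split_space \<tau>. split_less p a} \<inter> topspace T = {p \<in> topspace T. split_less (f p) a}"
    "f -` {p \<in> split_space \<tau>. split_less a p} \<inter> topspace T = {p \<in> topspace T. split_less a (f p)}"
    "f -` split_space \<tau> \<inter> topspace T = topspace T" for a
    using assms(1) by auto
  show ?thesis
    unfolding split_topology_def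
  proof (rule continuous_on_generated_topo)
    fix U assume "U \<in> {split_space \<tau>} \<union> (\<lambda>a. {p \<in> split_space \<tau>. split_less p a}) ` split_space \<tau>
      \<union> (\<lambda>a. {p \<in> split_space \<tau>. split_less a p}) ` split_space \<tau>"
    then show "openin T (f -` U \<inter> topspace T)"
      by (elim UnE imageE) (simp_all only: eq less greater singleton_iff openin_topspace)
  qed (use assms(1) in auto)
qed

text \<open>Alexander's subbase theorem speaks of the left-hand description, while
  \<open>split_topology\<close> is defined by the right-hand one.\<close>

lemma topology_subbase_eq_generated:
  "topology (arbitrary union_of (finite intersection_of (\<lambda>x. x \<in> B) relative_to \<Union>B)) = topology_generated_by B"
    (is "topology ?P = _")
proof (rule topology_eq[THEN iffD2], intro allI iffI)
  fix S assume "openin (topology ?P) S"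
  then show "openin (topology_generated_by B) S"
    by (rule minimal_topology_subbase[rotated 2])
       (auto intro: topology_generated_by_Basis openin_Union)
next
  fix S assume "openin (topology_generated_by B) S"
  then have "generate_topology_on B S"
    by (rule openin_topology_generated_by)
  then have "?P S"
    by (rule generate_topology_on_coarsest[OF istopology_subbase, rotated])
       (auto intro!: arbitrary_union_of_inc relative_to_subset_inc finite_intersection_of_inc)
  then show "openin (topology ?P) S"
    by (simp add: openin_subbase)
qed

lemma mem_split_space:
  "(x, b) \<in> split_space \<tau> \<longleftrightarrow> 0 \<le> x \<and> x \<le> 1 \<and> (b \<longrightarrow> x \<in> I\<^sub>1 \<tau> \<and> x \<noteq> 0 \<and> x \<noteq> 1)"
  if "I\<^sub>1 \<tau> \<subseteq> {0..1}"
  using that by (cases b) (auto simp: split_space_def)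

lemma continuous_map_discrete_combine:
  assumes "continuous_map T (discrete_topology UNIV) f" "continuous_map T (discrete_topology UNIV) g"
  shows "continuous_map T (discrete_topology UNIV) (\<lambda>x. F (f x) (g x))"
proof -
  have "continuous_map T (discrete_topology UNIV) ((\<lambda>(a, b). F a b) \<circ> (\<lambda>x. (f x, g x)))"
  proof (rule continuous_map_compose)
    show "continuous_map T (discrete_topology UNIV) (\<lambda>x. (f x, g x))"
      using continuous_map_paired[of T "discrete_topology UNIV" "discrete_topology UNIV" f g] assms
      by (simp flip: prod_topology_discrete_topology)
  qed simp
  then show ?thesis by (simp add: o_def)
qed

lemma continuous_map_indicator:
  assumes "openin T S" "openin T (topspace T - S)"
  shows "continuous_map T (discrete_topology UNIV) (\<lambda>x. if x \<in> S then a else b)"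
proof -
  have "{x \<in> topspace T. (if x \<in> S then a else b) \<in> U} =
      (if a \<in> U then S else {}) \<union> (if b \<in> U then topspace T - S else {})" for U
    using openin_subset[OF assms(1)] by auto
  then show ?thesis
    using assms by (auto simp: continuous_map_def)
qed

lemma restrict_mem_CXZ:
  assumes "continuous_map (split_topology \<tau>) (discrete_topology UNIV) f"
  shows "restrict f (split_space \<tau>) \<in> CXZ \<tau>"
  unfolding CXZ_def using continuous_map_eq[OF assms, of "restrict f (split_space \<tau>)"] by simp

lemma CXZ_continuous: "f \<in> CXZ \<tau> \<Longrightarrow> continuous_map (split_topology \<tau>) (discrete_topology UNIV) f"
  by (simp add: CXZ_def)

lemma CXZ_const: "(\<lambda>x\<in>split_space \<tau>. k) \<in> CXZ \<tau>"
  by (rule restrict_mem_CXZ) simp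

lemma CXZ_combine:
  assumes "f \<in> CXZ \<tau>" "g \<in> CXZ \<tau>"
  shows "(\<lambda>x\<in>split_space \<tau>. F (f x) (g x)) \<in> CXZ \<tau>"
  by (rule restrict_mem_CXZ[OF continuous_map_discrete_combine[OF assms[THEN CXZ_continuous]]])

context transitive_unimodal
begin

abbreviation "X \<equiv> split_space \<tau>"

section \<open>Compactness and separation\<close>

lemma mem_X: "(x, b) \<in> X \<longleftrightarrow> 0 \<le> x \<and> x \<le> 1 \<and> (b \<longrightarrow> x \<in> I\<^sub>1 \<tau> \<and> x \<noteq> 0 \<and> x \<noteq> 1)"
  by (rule mem_split_space[OF I1_subset])

text \<open>By Alexander's theorem it is enough to treat covers by rays. If the endpoint of a lower
  ray exceeds that of an upper ray, these two cover \<open>X\<close>; otherwise the supremum of the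
  endpoints of the lower rays is not covered.\<close>

lemma compact_space_X: "compact_space (split_topology \<tau>)"
proof -
  let ?B = "{X} \<union> (\<lambda>a. {p \<in> X. split_less p a}) ` X \<union> (\<lambda>a. {p \<in> X. split_less a p}) ` X"
  have U: "\<Union>?B = X" by auto
  have "topology (arbitrary union_of (finite intersection_of (\<lambda>x. x \<in> ?B) relative_to \<Union>?B)) = split_topology \<tau>"
    unfolding split_topology_def by (rule topology_subbase_eq_generated)
  then show ?thesis
  proof (rule Alexander_subbase)
    fix C assume C: "C \<subseteq> ?B" "\<Union>C = topspace (split_topology \<tau>)"
    then have cover: "\<Union>C = X" by simp
    show "\<exists>C'. finite C' \<and> C' \<subseteq> C \<and> \<Union>C' = topspace (split_topology \<tau>)"
    proof (cases "X \<in> C")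
      case True
      then show ?thesis by (intro exI[of _ "{X}"]) auto
    next
      case False
      define L where "L = {a \<in> X. {p \<in> X. split_less p a} \<in> C}"
      define R where "R = {a \<in> X. {p \<in> X. split_less a p} \<in> C}"
      have mem: "(\<exists>a\<in>L. split_less p a) \<or> (\<exists>a\<in>R. split_less a p)" if p: "p \<in> X" for p
      proof -
        obtain W where W: "W \<in> C" "p \<in> W"
          using p cover by auto
        then have "W \<in> ?B" "W \<noteq> X"
          using C(1) False by auto
        then obtain a where "a \<in> X" "W = {p \<in> X. split_less p a} \<or> W = {p \<in> X. split_less a p}"
          by auto
        with W show ?thesis
          unfolding L_def R_def by blast
      qed
      show ?thesis
      proof (cases "\<exists>a\<in>L. \<exists>b\<in>R. split_less b a")
        case True
        then obtain a b where ab: "a \<in> L" "b \<in> R" "split_less b a" by auto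
        then have "p \<in> {p \<in> X. split_less p a} \<union> {p \<in> X. split_less b p}" if "p \<in> X" for p
          using that split_less_linear[of p a] split_less_trans[of b a p] by auto
        then have "\<Union>{{p \<in> X. split_less p a}, {p \<in> X. split_less b p}} = X" by auto
        then show ?thesis
          using ab by (intro exI[of _ "{{p \<in> X. split_less p a}, {p \<in> X. split_less b p}}"])
            (auto simp: L_def R_def)
      next
        case False
        define s where "s = Sup (insert 0 (fst ` L))"
        have LX: "0 \<le> fst a" "fst a \<le> 1" if "a \<in> L" for a
          using that mem_X[of "fst a" "snd a"] by (auto simp: L_def)
        have bdd: "bdd_above (insert 0 (fst ` L))"
          using LX by (auto intro!: bdd_aboveI[of _ 1])
        have s_ub: "fst a \<le> s" if "a \<in> L" for a
          unfolding s_def using that bdd by (intro cSup_upper) auto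
        have s0: "0 \<le> s"
          unfolding s_def using bdd by (intro cSup_upper) auto
        have s1: "s \<le> 1"
          unfolding s_def using LX by (intro cSup_least) auto
        \<comment> \<open>The least upper bound of \<open>L\<close> in \<open>X\<close>: the right
          copy of \<open>s\<close> only if it belongs to \<open>L\<close>. For empty
          \<open>L\<close> it is the minimum of \<open>X\<close>, thanks to the inserted 0.\<close>
        define m where "m = (s, (s, True) \<in> L)"
        have "m \<in> X"
          using s0 s1 by (auto simp: m_def L_def mem_X)
        have "\<not> split_less m a" if "a \<in> L" for a
          using s_ub[OF that] that by (cases a) (auto simp: m_def split_less_def)
        moreover have "\<not> split_less b m" if b: "b \<in> R" for b
        proof
          assume bm: "split_less b m"
          have bX: "0 \<le> fst b" "snd b \<longrightarrow> fst b \<noteq> 0"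
            using b mem_X[of "fst b" "snd b"] by (auto simp: R_def)
          show False
          proof (cases "(s, True) \<in> L")
            case True
            then have "m \<in> L" by (simp add: m_def)
            then show False using False bm b by auto
          next
            case nL: False
            then have "fst b < s"
              using bm by (auto simp: m_def split_less_def)
            then obtain y where "y \<in> insert 0 (fst ` L)" "fst b < y"
              using less_cSup_iff[OF _ bdd] unfolding s_def by auto
            then obtain a where "a \<in> L" "fst b < fst a"
              using bX by auto
            then show False
              using False b by (auto simp: split_less_def)
          qed
        qed
        ultimately have False
          using mem[OF \<open>m \<in> X\<close>] by metis
        then show ?thesis ..
      qed
    qed
  qed
qed

text \<open>A point strictly between \<open>p\<close> and \<open>q\<close> separates them by its two
  rays. If there is none, as between the two copies of a split point, the rays at \<open>q\<close>
  and at \<open>p\<close> themselves are disjoint.\<close>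

lemma Hausdorff_space_X: "Hausdorff_space (split_topology \<tau>)"
proof -
  have sep: "\<exists>U V. openin (split_topology \<tau>) U \<and> openin (split_topology \<tau>) V \<and> p \<in> U \<and> q \<in> V \<and> disjnt U V"
    if pq: "p \<in> X" "q \<in> X" "split_less p q" for p q
  proof (cases "\<exists>r\<in>X. split_less p r \<and> split_less r q")
    case True
    then obtain r where r: "r \<in> X" "split_less p r" "split_less r q" by auto
    show ?thesis
      using r pq
      by (intro exI[of _ "{p \<in> X. split_less p r}"] exI[of _ "{p \<in> X. split_less r p}"])
        (auto simp: openin_less_ray openin_greater_ray disjnt_def dest: split_less_asym)
  next
    case False
    then show ?thesis
      using pq
      by (intro exI[of _ "{r \<in> X. split_less r q}"] exI[of _ "{r \<in> X. split_less p r}"])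
        (auto simp: openin_less_ray openin_greater_ray disjnt_def)
  qed
  show ?thesis
    unfolding Hausdorff_space_def
  proof (intro allI impI)
    fix p q assume *: "p \<in> topspace (split_topology \<tau>) \<and> q \<in> topspace (split_topology \<tau>) \<and> p \<noteq> q"
    then consider "split_less p q" | "split_less q p"
      using split_less_linear by blast
    then show "\<exists>U V. openin (split_topology \<tau>) U \<and> openin (split_topology \<tau>) V \<and> p \<in> U \<and> q \<in> V \<and> disjnt U V"
    proof cases
      case 1
      show ?thesis by (rule sep[OF _ _ 1]) (use * in auto)
    next
      case 2
      have "\<exists>U V. openin (split_topology \<tau>) U \<and> openin (split_topology \<tau>) V \<and> q \<in> U \<and> p \<in> V \<and> disjnt U V"
        by (rule sep[OF _ _ 2]) (use * in auto)
      then show ?thesis using disjnt_sym by meson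
    qed
  qed
qed

section \<open>Cuts, branches and the explicit form of the local homeomorphism\<close>

text \<open>The part of \<open>X\<close> left of the cut at \<open>q\<close>, up to and including
  \<open>(q, False)\<close>; it is clopen when \<open>q\<close> is in
  \<open>I\<^sub>1 \<tau>\<close>. The endpoints are not split and follow the conventions
  \<open>E 0 = {}\<close>, hence the clause \<open>q \<noteq> 0\<close>, and
  \<open>E 1 = X\<close>.\<close>

definition E :: "real \<Rightarrow> (real \<times> bool) set" where
  "E q = {p \<in> X. q \<noteq> 0 \<and> split_less p (q, True)}"

text \<open>Domains of the two branches. As \<open>c\<close> is itself split, it supplies both the
  last point of \<open>A\<close> and the first point of \<open>B\<close>.\<close>

definition A :: "(real \<times> bool) set" where
  "A = {p \<in> X. split_less p (c, True)}"

definition B :: "(real \<times> bool) set" where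
  "B = {p \<in> X. \<not> split_less p (c, True)}"

text \<open>The point of the split space over \<open>y\<close> seen from the right (\<open>s\<close> true) or from the left.\<close>

definition side :: "real \<Rightarrow> bool \<Rightarrow> real \<times> bool" where
  "side y s = (y, s \<and> y \<in> I\<^sub>1 \<tau> \<and> y \<noteq> 0 \<and> y \<noteq> 1)"

text \<open>The left branch preserves sides, the right branch exchanges them; the endpoint \<open>0\<close> can only
  be approached from the right although it is represented by \<open>(0, False)\<close>.\<close>

definition sigma :: "real \<times> bool \<Rightarrow> real \<times> bool" where
  "sigma p = side (\<tau> (fst p)) (if split_less p (c, True) then snd p \<or> fst p = 0 else \<not> snd p)"

lemma mem_E: "(x, b) \<in> E q \<longleftrightarrow> (x, b) \<in> X \<and> q \<noteq> 0 \<and> (x < q \<or> (x = q \<and> \<not> b))"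
  by (auto simp: E_def split_less_def)

lemma mem_A: "(x, b) \<in> A \<longleftrightarrow> (x, b) \<in> X \<and> (x < c \<or> (x = c \<and> \<not> b))"
  by (auto simp: A_def split_less_def)

lemma mem_B: "(x, b) \<in> B \<longleftrightarrow> (x, b) \<in> X \<and> (c < x \<or> (x = c \<and> b))"
  by (auto simp: B_def split_less_def)

lemma A_Un_B: "A \<union> B = X" and A_Int_B: "A \<inter> B = {}"
  by (auto simp: A_def B_def)

lemma E_c: "E c = A"
  using c_bounds by (auto simp: E_def A_def)

lemma E_0 [simp]: "E 0 = {}" and E_1 [simp]: "E 1 = X"
  by (auto simp: E_def mem_X split_less_def)

lemma E_subset_X: "E q \<subseteq> X"
  by (auto simp: E_def)

lemma E_mono: "\<lbrakk>0 \<le> q; q \<le> r\<rbrakk> \<Longrightarrow> E q \<subseteq> E r"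
  by (auto simp: mem_E)

lemma side_in_X: "\<lbrakk>0 \<le> y; y \<le> 1\<rbrakk> \<Longrightarrow> side y s \<in> X"
  by (auto simp: side_def mem_X)

lemma sigma_in_X: "p \<in> X \<Longrightarrow> sigma p \<in> X"
  by (cases p) (auto simp: sigma_def mem_X intro!: side_in_X tau_bounds)

lemma openin_E:
  assumes "q \<in> I\<^sub>1 \<tau>"
  shows "openin (split_topology \<tau>) (E q)" "openin (split_topology \<tau>) (X - E q)"
proof -
  consider "q = 0" | "q = 1" | "0 < q" "q < 1"
    using I1_bounds[OF assms] by force
  then have "openin (split_topology \<tau>) (E q) \<and> openin (split_topology \<tau>) (X - E q)"
  proof cases
    case 1
    then show ?thesis
      using openin_topspace[of "split_topology \<tau>"] by simp
  next
    case 2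
    then show ?thesis
      using openin_topspace[of "split_topology \<tau>"] by simp
  next
    case 3
    have "(q, True) \<in> X" "(q, False) \<in> X"
      using 3 assms by (auto simp: mem_X)
    moreover have "E q = {p \<in> X. split_less p (q, True)}" "X - E q = {p \<in> X. split_less (q, False) p}"
      using 3 by (auto simp: E_def split_less_def)
    ultimately show ?thesis
      using openin_less_ray openin_greater_ray by metis
  qed
  then show "openin (split_topology \<tau>) (E q)" "openin (split_topology \<tau>) (X - E q)" by auto
qed

lemma openin_A: "openin (split_topology \<tau>) A" and openin_B: "openin (split_topology \<tau>) B"
proof -
  have "B = X - E c"
    using A_Un_B A_Int_B E_c by auto
  then show "openin (split_topology \<tau>) A" "openin (split_topology \<tau>) B"
    using openin_E[OF I1_special(2)] E_c by auto
qed

text \<open>The left branch preserves order and sides, so it carries the cut at \<open>q\<close> to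
  the cut at \<open>\<tau> q\<close>. Together with \<open>B_E_iff\<close> this translates
  \<open>\<tau>\<close> into an action on indicators of cuts.\<close>

lemma A_E_iff:
  assumes "p \<in> A" "q \<in> I\<^sub>1 \<tau>" "q \<le> c"
  shows "sigma p \<in> E (\<tau> q) \<longleftrightarrow> p \<in> E q"
proof -
  obtain x b where p: "p = (x, b)" by (cases p)
  have x: "0 \<le> x" "x \<le> 1" "x < c \<or> (x = c \<and> \<not> b)" "b \<longrightarrow> x \<in> I\<^sub>1 \<tau> \<and> x \<noteq> 0 \<and> x \<noteq> 1" "p \<in> X"
    using assms(1) by (auto simp: p mem_A mem_X)
  have q: "0 \<le> q" "q \<le> 1"
    using I1_bounds assms by auto
  have s: "sigma p = side (\<tau> x) (b \<or> x = 0)"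
    using x by (auto simp: p sigma_def split_less_def)
  have sX: "side (\<tau> x) (b \<or> x = 0) \<in> X"
    using sigma_in_X[OF x(5)] by (simp add: s)
  have lt: "\<tau> x < \<tau> q \<longleftrightarrow> x < q" and eq: "\<tau> x = \<tau> q \<longleftrightarrow> x = q"
    using increasing_iff[of x q] increasing_inj[of x q] x q assms by auto
  have tq: "\<tau> q \<in> I\<^sub>1 \<tau>" "q \<noteq> 0 \<Longrightarrow> \<tau> q \<noteq> 0" "\<tau> q = 1 \<longleftrightarrow> q = c"
    using I1_invariant q assms tau_pos[of q] tau_lt_1[of q] tau_c c_bounds by force+
  show ?thesis
  \<comment> \<open>Away from the cut the first coordinates decide; over it, the sides do.\<close>
  proof (cases "x = q")
    case True
    show ?thesis
      using sX x tq c_bounds unfolding s unfolding p True side_def mem_E by (cases "q = 0") auto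
  next
    case False
    then have "\<tau> x \<noteq> \<tau> q" using eq by simp
    moreover have "\<tau> q \<noteq> 0" if "\<tau> x < \<tau> q"
      using that tau_bounds[of x] x by auto
    moreover have "q \<noteq> 0" if "x < q"
      using that x by auto
    ultimately show ?thesis
      using sX x False lt unfolding s unfolding p side_def mem_E by auto
  qed
qed

text \<open>The right branch reverses the order, so what lies right of the cut at \<open>q\<close>
  lands left of the cut at \<open>\<tau> q\<close>.\<close>

lemma B_E_iff:
  assumes "p \<in> B" "q \<in> I\<^sub>1 \<tau>" "c \<le> q"
  shows "sigma p \<in> E (\<tau> q) \<longleftrightarrow> p \<notin> E q"
proof -
  obtain x b where p: "p = (x, b)" by (cases p)
  have x: "0 \<le> x" "x \<le> 1" "c < x \<or> (x = c \<and> b)" "b \<longrightarrow> x \<in> I\<^sub>1 \<tau> \<and> x \<noteq> 0 \<and> x \<noteq> 1" "p \<in> X"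
    using assms(1) by (auto simp: p mem_B mem_X)
  have q: "0 \<le> q" "q \<le> 1" "q \<noteq> 0"
    using I1_bounds assms c_bounds by auto
  have s: "sigma p = side (\<tau> x) (\<not> b)"
    using x by (auto simp: p sigma_def split_less_def)
  have sX: "side (\<tau> x) (\<not> b) \<in> X"
    using sigma_in_X[OF x(5)] by (simp add: s)
  have lt: "\<tau> x < \<tau> q \<longleftrightarrow> q < x" and eq: "\<tau> x = \<tau> q \<longleftrightarrow> x = q"
    using decreasing_iff[of x q] decreasing_inj[of x q] x q assms by auto
  have tq: "\<tau> q \<in> I\<^sub>1 \<tau>" "\<tau> q = 0 \<longleftrightarrow> q = 1" "\<tau> q = 1 \<longleftrightarrow> q = c"
    using I1_invariant q assms tau_pos[of q] tau_lt_1[of q] tau_c tau_1 c_bounds by force+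
  show ?thesis
  proof (cases "x = q")
    case True
    show ?thesis
      using sX x tq q c_bounds unfolding s unfolding p True side_def mem_E by auto
  next
    case False
    then have "\<tau> x \<noteq> \<tau> q" using eq by simp
    moreover have "\<tau> q \<noteq> 0" if "\<tau> x < \<tau> q"
      using that tau_bounds[of x] x by auto
    ultimately show ?thesis
      using sX x q False lt unfolding s unfolding p side_def mem_E by auto
  qed
qed

lemma sigma_strict_mono:
  assumes "p \<in> A" "p' \<in> A" "split_less p p'"
  shows "split_less (sigma p) (sigma p')"
proof -
  obtain x b y d where p: "p = (x, b)" "p' = (y, d)" by (cases p; cases p')
  have x: "0 \<le> x" "x \<le> c" "y \<le> c" "0 \<le> y" and s: "x < c \<or> (x = c \<and> \<not> b)" "y < c \<or> (y = c \<and> \<not> d)"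
    and X: "p \<in> X" "p' \<in> X"
    using assms by (auto simp: p mem_A mem_X)
  have sg: "sigma p = side (\<tau> x) (b \<or> x = 0)" "sigma p' = side (\<tau> y) (d \<or> y = 0)"
    using s by (auto simp: p sigma_def split_less_def)
  show ?thesis
  proof (cases "x < y")
    case True
    then show ?thesis
      using increasing[of x y] x by (simp add: sg side_def split_less_def)
  next
    case False
    then have "y = x" "\<not> b" "d"
      using assms(3) by (auto simp: p split_less_def)
    moreover then have "x \<in> I\<^sub>1 \<tau>" "0 < x" "x < c"
      using X x s by (auto simp: p mem_X)
    ultimately show ?thesis
      using I1_invariant[of x] tau_pos[of x] tau_lt_1[of x] c_bounds
      by (auto simp: sg side_def split_less_def)
  qed
qed

lemma sigma_strict_anti:
  assumes "p \<in> B" "p' \<in> B" "split_less p p'"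
  shows "split_less (sigma p') (sigma p)"
proof -
  obtain x b y d where p: "p = (x, b)" "p' = (y, d)" by (cases p; cases p')
  have x: "c \<le> x" "x \<le> 1" "c \<le> y" "y \<le> 1" and s: "c < x \<or> (x = c \<and> b)" "c < y \<or> (y = c \<and> d)"
    and X: "p \<in> X" "p' \<in> X"
    using assms by (auto simp: p mem_B mem_X)
  have sg: "sigma p = side (\<tau> x) (\<not> b)" "sigma p' = side (\<tau> y) (\<not> d)"
    using s by (auto simp: p sigma_def split_less_def)
  show ?thesis
  proof (cases "x < y")
    case True
    then show ?thesis
      using decreasing[of x y] x by (simp add: sg side_def split_less_def)
  next
    case False
    then have "y = x" "\<not> b" "d"
      using assms(3) by (auto simp: p split_less_def)
    moreover then have "x \<in> I\<^sub>1 \<tau>" "x < 1" "c < x"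
      using X x s by (auto simp: p mem_X)
    ultimately show ?thesis
      using I1_invariant[of x] tau_pos[of x] tau_lt_1[of x] c_bounds
      by (auto simp: sg side_def split_less_def)
  qed
qed

text \<open>The left branch increases and starts at 0, which is approached from the right, so its
  image starts immediately to the right of the cut at \<open>\<tau> 0\<close>. If
  \<open>\<tau> 0 = 0\<close> this is all of \<open>X\<close>.\<close>

lemma sigma_image_A: "sigma ` A = X - E (\<tau> 0)"
proof
  show "sigma ` A \<subseteq> X - E (\<tau> 0)"
    using A_E_iff[OF _ I1_special(1)] sigma_in_X c_bounds by (auto simp: A_def)
  show "X - E (\<tau> 0) \<subseteq> sigma ` A"
  proof clarify
    fix y d assume yX: "(y, d) \<in> X" and yE: "(y, d) \<notin> E (\<tau> 0)"
    then have y: "0 \<le> y" "y \<le> 1" "d \<longrightarrow> y \<in> I\<^sub>1 \<tau> \<and> y \<noteq> 0 \<and> y \<noteq> 1" and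
      ty: "\<tau> 0 \<le> y" "y = \<tau> 0 \<longrightarrow> y = 0 \<or> d"
      using tau_bounds[of 0] by (auto simp: mem_X mem_E not_less)
    obtain x where x: "0 \<le> x" "x \<le> c" "\<tau> x = y"
      using left_preimage[OF ty(1) y(2)] by auto
    have x1: "x < 1" "y \<in> I\<^sub>1 \<tau> \<longleftrightarrow> x \<in> I\<^sub>1 \<tau>" "y = 1 \<longleftrightarrow> x = c"
      using x c_bounds I1_invariant[of x] tau_eq_1_iff[of x] by auto
    \<comment> \<open>\<open>(0, False)\<close> plays the part of the right side of 0.\<close>
    define b where "b \<longleftrightarrow> d \<and> x \<noteq> 0"
    have A: "(x, b) \<in> A"
      using x x1 y c_bounds by (auto simp: mem_A mem_X b_def)
    moreover have "sigma (x, b) = (y, d)"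
      using A x y ty by (auto simp: sigma_def side_def mem_A split_less_def b_def)
    ultimately show "(y, d) \<in> sigma ` A" by force
  qed
qed

lemma sigma_image_B: "sigma ` B = X"
proof
  show "sigma ` B \<subseteq> X"
    using sigma_in_X by (auto simp: B_def)
  show "X \<subseteq> sigma ` B"
  proof clarify
    fix y d assume yX: "(y, d) \<in> X"
    then have y: "0 \<le> y" "y \<le> 1" "d \<longrightarrow> y \<in> I\<^sub>1 \<tau> \<and> y \<noteq> 0 \<and> y \<noteq> 1"
      by (auto simp: mem_X)
    obtain x where x: "c \<le> x" "x \<le> 1" "\<tau> x = y"
      using right_preimage[OF y(1,2)] by auto
    have x1: "0 < x" "y \<in> I\<^sub>1 \<tau> \<longleftrightarrow> x \<in> I\<^sub>1 \<tau>" "y = 1 \<longleftrightarrow> x = c" "y = 0 \<longleftrightarrow> x = 1"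
      using x c_bounds I1_invariant[of x] tau_eq_1_iff[of x] tau_eq_0_iff[of x] by auto
    \<comment> \<open>Sides are exchanged, so a left side comes from a right one whenever
      \<open>x\<close> has a right copy.\<close>
    define b where "b \<longleftrightarrow> \<not> d \<and> x \<in> I\<^sub>1 \<tau> \<and> x \<noteq> 1"
    have B: "(x, b) \<in> B"
      using x x1 y I1_special by (auto simp: mem_B mem_X b_def)
    moreover have "sigma (x, b) = (y, d)"
      using B x y x1 by (auto simp: sigma_def side_def mem_B split_less_def b_def)
    ultimately show "(y, d) \<in> sigma ` B" by force
  qed
qed

lemma sigma_less_A: "\<lbrakk>p \<in> A; p' \<in> A\<rbrakk> \<Longrightarrow> split_less (sigma p) (sigma p') \<longleftrightarrow> split_less p p'"
  by (metis sigma_strict_mono split_less_asym split_less_linear split_less_irrefl)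

lemma sigma_less_B: "\<lbrakk>p \<in> B; p' \<in> B\<rbrakk> \<Longrightarrow> split_less (sigma p) (sigma p') \<longleftrightarrow> split_less p' p"
  by (metis sigma_strict_anti split_less_asym split_less_linear split_less_irrefl)

lemma inj_on_sigma_A: "inj_on sigma A" and inj_on_sigma_B: "inj_on sigma B"
  unfolding inj_on_def
  by (metis sigma_strict_mono split_less_linear split_less_irrefl)
    (metis sigma_strict_anti split_less_linear split_less_irrefl)

lemma A_subset_X: "p \<in> A \<Longrightarrow> p \<in> X" and B_subset_X: "p \<in> B \<Longrightarrow> p \<in> X"
  by (auto simp: A_def B_def)

lemma A_less_B: "p \<in> A \<Longrightarrow> p' \<in> B \<Longrightarrow> split_less p p'"
  by (cases p; cases p') (auto simp: mem_A mem_B split_less_def)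

lemma E_downward: "p \<in> E q \<Longrightarrow> p' \<in> X - E q \<Longrightarrow> split_less p p'"
  by (cases p; cases p') (auto simp: mem_E split_less_def)

lemma openin_subset_ray:
  assumes "openin (split_topology \<tau>) S"
  shows "a \<in> X \<Longrightarrow> openin (split_topology \<tau>) {p \<in> S. split_less p a}"
    "a \<in> X \<Longrightarrow> openin (split_topology \<tau>) {p \<in> S. split_less a p}"
proof -
  have "{p \<in> S. split_less p a} = S \<inter> {p \<in> X. split_less p a}"
    "{p \<in> S. split_less a p} = S \<inter> {p \<in> X. split_less a p}"
    using openin_subset[OF assms] by auto
  then show "a \<in> X \<Longrightarrow> openin (split_topology \<tau>) {p \<in> S. split_less p a}"
    "a \<in> X \<Longrightarrow> openin (split_topology \<tau>) {p \<in> S. split_less a p}"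
    using assms by (auto intro: openin_Int openin_less_ray openin_greater_ray)
qed

text \<open>Both branches are monotone on clopen pieces. Since \<open>B\<close> maps onto
  \<open>X\<close>, the preimage of a ray in \<open>B\<close> is cut out by one point; for
  \<open>A\<close>, the endpoint \<open>a\<close> is either a value or below all values.\<close>

lemma continuous_sigma: "continuous_map (split_topology \<tau>) (split_topology \<tau>) sigma"
proof (rule continuous_map_into_split_topology)
  show "sigma \<in> topspace (split_topology \<tau>) \<rightarrow> X"
    using sigma_in_X by simp
next
  fix a assume a: "a \<in> X"
  obtain b where b: "b \<in> B" "a = sigma b"
    using a unfolding sigma_image_B[symmetric] by auto
  have split: "{p \<in> topspace (split_topology \<tau>). R p} = {p \<in> A. R p} \<union> {p \<in> B. R p}" for R
    using A_Un_B by auto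
  have lessB: "{p \<in> B. split_less (sigma p) a} = {p \<in> B. split_less b p}"
    "{p \<in> B. split_less a (sigma p)} = {p \<in> B. split_less p b}"
    using b by (auto simp: sigma_less_B)
  have lessA: "openin (split_topology \<tau>) {p \<in> A. split_less (sigma p) a} \<and>
      openin (split_topology \<tau>) {p \<in> A. split_less a (sigma p)}"
  proof (cases "a \<in> E (\<tau> 0)")
    case True
    then have "split_less a (sigma p)" if "p \<in> A" for p
      using that sigma_image_A by (intro E_downward[of a "\<tau> 0"]) auto
    then have "{p \<in> A. split_less (sigma p) a} = {}" "{p \<in> A. split_less a (sigma p)} = A"
      using split_less_asym by auto
    then show ?thesis
      using openin_A by (simp only: openin_empty simp_thms)
  next
    case False
    then obtain d where d: "d \<in> A" "a = sigma d"
      using a sigma_image_A by blast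
    then have "{p \<in> A. split_less (sigma p) a} = {p \<in> A. split_less p d}"
      "{p \<in> A. split_less a (sigma p)} = {p \<in> A. split_less d p}"
      by (auto simp: sigma_less_A)
    then show ?thesis
      using d A_subset_X openin_subset_ray[OF openin_A] by simp
  qed
  show "openin (split_topology \<tau>) {p \<in> topspace (split_topology \<tau>). split_less (sigma p) a}"
    unfolding split lessB using lessA b B_subset_X openin_subset_ray[OF openin_B] by (intro openin_Un) auto
  show "openin (split_topology \<tau>) {p \<in> topspace (split_topology \<tau>). split_less a (sigma p)}"
    unfolding split lessB using lessA b B_subset_X openin_subset_ray[OF openin_B] by (intro openin_Un) auto
qed

lemma sigma_I0: "x \<in> I\<^sub>0 \<tau> \<Longrightarrow> sigma (x, b) = (\<tau> x, False)"
  using I1_invariant[of x] by (auto simp: sigma_def side_def I\<^sub>0_def)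

text \<open>For each point of an open set there is a one-sided interval at it whose points over
  \<open>I\<^sub>0 \<tau>\<close> all lie in the set. This follows by induction on the generation of
  open sets, and \<open>I0_dense\<close> then provides a point.\<close>

lemma split_space0_dense: "(split_topology \<tau>) closure_of (split_space\<^sub>0 \<tau>) = X"
proof -
  have X0: "(x, False) \<in> split_space\<^sub>0 \<tau>" if "x \<in> I\<^sub>0 \<tau>" for x
    using that by (auto simp: split_space\<^sub>0_def I\<^sub>0_def mem_X)
  have *: "\<exists>y\<in>S. y \<in> split_space\<^sub>0 \<tau>" if p: "p \<in> S" and S: "openin (split_topology \<tau>) S" for p S
  proof -
    let ?B = "{X} \<union> (\<lambda>a. {p \<in> X. split_less p a}) ` X \<union> (\<lambda>a. {p \<in> X. split_less a p}) ` X"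
    \<comment> \<open>The side is the right one for right copies and for 0, and the left one for all
      other points, including those that are not split.\<close>
    define near where "near p S \<longleftrightarrow> (if snd p \<or> fst p = 0
        then \<exists>t. fst p < t \<and> t \<le> 1 \<and> (\<forall>y\<in>I\<^sub>0 \<tau>. fst p < y \<and> y < t \<longrightarrow> (y, False) \<in> S)
        else \<exists>t. t < fst p \<and> 0 \<le> t \<and> (\<forall>y\<in>I\<^sub>0 \<tau>. t < y \<and> y < fst p \<longrightarrow> (y, False) \<in> S))"
      for p :: "real \<times> bool" and S
    have "generate_topology_on ?B S"
      using S unfolding split_topology_def by (rule openin_topology_generated_by)
    then have "\<forall>p\<in>S. near p S"
    proof induction
      case Empty
      then show ?case by simp
    next
      case (Int S T)
      show ?case
      proof
        fix p assume p: "p \<in> S \<inter> T"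
        show "near p (S \<inter> T)"
        proof (cases "snd p \<or> fst p = 0")
          case True
          moreover have "near p S" "near p T"
            using Int p by auto
          ultimately obtain s t where "fst p < s" "s \<le> 1" "\<forall>y\<in>I\<^sub>0 \<tau>. fst p < y \<and> y < s \<longrightarrow> (y, False) \<in> S"
            "fst p < t" "t \<le> 1" "\<forall>y\<in>I\<^sub>0 \<tau>. fst p < y \<and> y < t \<longrightarrow> (y, False) \<in> T"
            unfolding near_def by (simp only: if_True) (elim exE conjE, rule that)
          then show ?thesis
            using True unfolding near_def by (auto intro!: exI[of _ "min s t"])
        next
          case False
          moreover have "near p S" "near p T"
            using Int p by auto
          ultimately obtain s t where "s < fst p" "0 \<le> s" "\<forall>y\<in>I\<^sub>0 \<tau>. s < y \<and> y < fst p \<longrightarrow> (y, False) \<in> S"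
            "t < fst p" "0 \<le> t" "\<forall>y\<in>I\<^sub>0 \<tau>. t < y \<and> y < fst p \<longrightarrow> (y, False) \<in> T"
            unfolding near_def by (simp only: if_False) (elim exE conjE, rule that)
          then show ?thesis
            using False unfolding near_def by (auto intro!: exI[of _ "max s t"])
        qed
      qed
    next
      case (UN K)
      have "near p S \<Longrightarrow> S \<subseteq> T \<Longrightarrow> near p T" for p S T
        unfolding near_def by (auto split: if_splits; blast)
      then show ?case
        using UN by (metis Union_iff Union_upper)
    next
      case (Basis S)
      show ?case
      proof
        fix p assume pS: "p \<in> S"
        obtain x b where p: "p = (x, b)" by (cases p)
        consider "S = X" | a where "a \<in> X" "S = {p \<in> X. split_less p a}"
          | a where "a \<in> X" "S = {p \<in> X. split_less a p}"
          using Basis by auto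
        then show "near p S"
        proof cases
          case 1
          then show ?thesis
            using pS unfolding near_def p
            by (cases "b \<or> x = 0") (auto simp: mem_X I\<^sub>0_def intro: exI[of _ 1] exI[of _ 0])
        next
          case (2 a)
          obtain y d where a: "a = (y, d)" by (cases a)
          show ?thesis
          proof (cases "b \<or> x = 0")
            case True
            then show ?thesis
              using pS 2(1) unfolding near_def p 2(2) a
              by (auto simp: mem_X I\<^sub>0_def split_less_def intro!: exI[of _ y])
          next
            case False
            then show ?thesis
              using pS 2(1) unfolding near_def p 2(2) a
              by (auto simp: mem_X I\<^sub>0_def split_less_def intro!: exI[of _ 0])
          qed
        next
          case (3 a)
          obtain y d where a: "a = (y, d)" by (cases a)
          show ?thesis
          proof (cases "b \<or> x = 0")
            case True
            then show ?thesis
              using pS 3(1) unfolding near_def p 3(2) a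
              by (auto simp: mem_X I\<^sub>0_def split_less_def intro!: exI[of _ 1])
          next
            case False
            then show ?thesis
              using pS 3(1) unfolding near_def p 3(2) a
              by (auto simp: mem_X I\<^sub>0_def split_less_def intro!: exI[of _ y])
          qed
        qed
      qed
    qed
    then have np: "near p S" using p by simp
    have "0 \<le> fst p" "fst p \<le> 1"
      using openin_subset[OF S] p by (cases p; auto simp: mem_X)+
    then obtain u v where "0 \<le> u" "u < v" "v \<le> 1" "\<forall>y\<in>I\<^sub>0 \<tau>. u < y \<and> y < v \<longrightarrow> (y, False) \<in> S"
      using np that[of "fst p"] that[of _ "fst p"] unfolding near_def by (auto split: if_splits)
    then show ?thesis
      using I0_dense[of u v] X0 by metis
  qed
  show ?thesis
  proof (rule subset_antisym)
    show "split_topology \<tau> closure_of split_space\<^sub>0 \<tau> \<subseteq> X"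
      using closure_of_subset_topspace[of "split_topology \<tau>"] by simp
    show "X \<subseteq> split_topology \<tau> closure_of split_space\<^sub>0 \<tau>"
    proof
      fix p assume "p \<in> X"
      moreover have "\<exists>y. y \<in> split_space\<^sub>0 \<tau> \<and> y \<in> T" if "p \<in> T \<and> openin (split_topology \<tau>) T" for T
        using *[of p T] that unfolding Bex_def by metis
      ultimately show "p \<in> split_topology \<tau> closure_of split_space\<^sub>0 \<tau>"
        unfolding in_closure_of topspace_split_topology by (intro conjI allI impI)
    qed
  qed
qed

text \<open>Continuous maps into a Hausdorff space that agree on a dense set are equal, so
  \<open>THE\<close> selects \<open>sigma\<close> in extensional form.\<close>

lemma local_homeo: "local_homeo \<tau> = restrict sigma X"
  unfolding local_homeo_def
proof (rule the_equality, intro conjI ballI)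
  show "restrict sigma X \<in> extensional X" by simp
  show cs: "continuous_map (split_topology \<tau>) (split_topology \<tau>) (restrict sigma X)"
    by (rule continuous_map_eq[OF continuous_sigma]) simp
  show "fst (restrict sigma X p) = \<tau> (fst p)" if "p \<in> split_space\<^sub>0 \<tau>" for p
    using that by (simp add: split_space\<^sub>0_def sigma_def side_def)
  fix s assume s: "s \<in> extensional X \<and> continuous_map (split_topology \<tau>) (split_topology \<tau>) s
    \<and> (\<forall>p\<in>split_space\<^sub>0 \<tau>. fst (s p) = \<tau> (fst p))"
  \<comment> \<open>\<open>\<tau>\<close> preserves \<open>I\<^sub>0 \<tau>\<close>, whose points
    have a single copy, so here the first coordinate determines the value.\<close>
  have eq0: "s p = restrict sigma X p" if p: "p \<in> split_space\<^sub>0 \<tau>" for p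
  proof -
    have pX: "p \<in> X" and p0: "fst p \<in> I\<^sub>0 \<tau>"
      using p by (auto simp: split_space\<^sub>0_def)
    have "s p \<in> X"
      using s pX continuous_map_funspace[of "split_topology \<tau>" "split_topology \<tau>" s] by auto
    moreover have "fst (s p) = \<tau> (fst p)" "\<tau> (fst p) \<notin> I\<^sub>1 \<tau>"
      using s p p0 I1_invariant[of "fst p"] by (auto simp: I\<^sub>0_def)
    ultimately show ?thesis
      using sigma_I0[OF p0, of "snd p"] pX by (cases "s p") (auto simp: mem_X)
  qed
  have "s p = restrict sigma X p" if "p \<in> X" for p
    using forall_in_closure_of_eq[OF _ Hausdorff_space_X _ cs eq0, of p "split_space\<^sub>0 \<tau>"]
      s that split_space0_dense by blast
  then show "s = restrict sigma X"
    using s by (auto intro: extensionalityI)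
qed

section \<open>Inverse branches and the transfer operator\<close>

text \<open>Inverse of the left branch. Left of the cut at \<open>\<tau> 0\<close> there is no
  preimage; the constant is a placeholder that keeps the map continuous because
  \<open>E (\<tau> 0)\<close> is clopen.\<close>

definition rA :: "real \<times> bool \<Rightarrow> real \<times> bool" where
  "rA x = (if x \<in> E (\<tau> 0) then (0, False) else inv_into A sigma x)"

definition rB :: "real \<times> bool \<Rightarrow> real \<times> bool" where
  "rB = inv_into B sigma"

lemma rA:
  assumes "x \<in> X - E (\<tau> 0)" shows "rA x \<in> A" "sigma (rA x) = x"
  using assms inv_into_into[of x sigma A] f_inv_into_f[of x sigma A]
  by (simp_all add: rA_def sigma_image_A)

lemma rB:
  assumes "x \<in> X" shows "rB x \<in> B" "sigma (rB x) = x"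
  using assms inv_into_into[of x sigma B] f_inv_into_f[of x sigma B]
  by (simp_all add: rB_def sigma_image_B)

lemma rA_sigma: "p \<in> A \<Longrightarrow> rA (sigma p) = p"
  using inv_into_f_f[OF inj_on_sigma_A, of p] sigma_image_A by (auto simp: rA_def)

lemma rB_sigma: "p \<in> B \<Longrightarrow> rB (sigma p) = p"
  using inv_into_f_f[OF inj_on_sigma_B, of p] by (auto simp: rB_def)

lemma rA_less:
  assumes "x \<in> X - E (\<tau> 0)" "a \<in> A"
  shows "split_less (rA x) a \<longleftrightarrow> split_less x (sigma a)" "split_less a (rA x) \<longleftrightarrow> split_less (sigma a) x"
  using sigma_less_A[OF rA(1)[OF assms(1)] assms(2)] sigma_less_A[OF assms(2) rA(1)[OF assms(1)]]
    rA(2)[OF assms(1)] by simp_all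

lemma rB_less:
  assumes "x \<in> X" "a \<in> B"
  shows "split_less (rB x) a \<longleftrightarrow> split_less (sigma a) x" "split_less a (rB x) \<longleftrightarrow> split_less x (sigma a)"
  using sigma_less_B[OF rB(1)[OF assms(1)] assms(2)] sigma_less_B[OF assms(2) rB(1)[OF assms(1)]]
    rB(2)[OF assms(1)] by simp_all

lemma rA_less_B: "\<lbrakk>x \<in> X - E (\<tau> 0); a \<in> B\<rbrakk> \<Longrightarrow> split_less (rA x) a"
  by (simp add: A_less_B rA)

lemma A_less_rB: "\<lbrakk>x \<in> X; a \<in> A\<rbrakk> \<Longrightarrow> split_less a (rB x)"
  by (simp add: A_less_B rB)

lemma zero_in_A: "(0, False) \<in> A"
  using c_bounds by (simp add: mem_A mem_X)

text \<open>\<open>rB\<close> reverses the order, and an endpoint outside \<open>B\<close> lies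
  below all its values; so the preimage of a ray is a ray, empty or everything.\<close>

lemma continuous_rB: "continuous_map (split_topology \<tau>) (split_topology \<tau>) rB"
proof (rule continuous_map_into_split_topology)
  show "rB \<in> topspace (split_topology \<tau>) \<rightarrow> X"
    using rB B_subset_X by auto
next
  fix a assume a: "a \<in> X"
  show "openin (split_topology \<tau>) {p \<in> topspace (split_topology \<tau>). split_less (rB p) a}"
  proof (cases "a \<in> B")
    case True
    then have "{p \<in> topspace (split_topology \<tau>). split_less (rB p) a} = {p \<in> X. split_less (sigma a) p}"
      by (auto simp: rB_less)
    then show ?thesis
      using openin_greater_ray[OF sigma_in_X[OF a]] by simp
  next
    case False
    then have "a \<in> A" using a A_Un_B by auto
    then have "{p \<in> topspace (split_topology \<tau>). split_less (rB p) a} = {}"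
      by (auto simp: split_less_asym[OF A_less_rB])
    then show ?thesis by (simp only: openin_empty)
  qed
  show "openin (split_topology \<tau>) {p \<in> topspace (split_topology \<tau>). split_less a (rB p)}"
  proof (cases "a \<in> B")
    case True
    then have "{p \<in> topspace (split_topology \<tau>). split_less a (rB p)} = {p \<in> X. split_less p (sigma a)}"
      by (auto simp: rB_less)
    then show ?thesis
      using openin_less_ray[OF sigma_in_X[OF a]] by simp
  next
    case False
    then have "a \<in> A" using a A_Un_B by auto
    then have "{p \<in> topspace (split_topology \<tau>). split_less a (rB p)} = topspace (split_topology \<tau>)"
      by (auto simp: A_less_rB)
    then show ?thesis by (simp only: openin_topspace)
  qed
qed

lemma continuous_rA: "continuous_map (split_topology \<tau>) (split_topology \<tau>) rA"
proof (rule continuous_map_into_split_topology)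
  have rA_E: "rA x = (0, False)" if "x \<in> E (\<tau> 0)" for x
    using that by (simp add: rA_def)
  show "rA \<in> topspace (split_topology \<tau>) \<rightarrow> X"
  proof (rule Pi_I)
    fix x assume "x \<in> topspace (split_topology \<tau>)"
    then show "rA x \<in> X"
      using rA(1)[of x] rA_E[of x] A_subset_X[OF zero_in_A] A_subset_X[of "rA x"]
      by (cases "x \<in> E (\<tau> 0)") auto
  qed
  have E: "E (\<tau> 0) \<subseteq> X" "openin (split_topology \<tau>) (E (\<tau> 0))" "openin (split_topology \<tau>) (X - E (\<tau> 0))"
    using E_subset_X openin_E I1_invariant[of 0] I1_special by auto
  have split: "{p \<in> topspace (split_topology \<tau>). R (rA p)} =
      (if R (0, False) then E (\<tau> 0) else {}) \<union> {p \<in> X - E (\<tau> 0). R (rA p)}" for R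
    using rA_E E(1) by auto
  fix a assume a: "a \<in> X"
  have "openin (split_topology \<tau>) {p \<in> X - E (\<tau> 0). split_less (rA p) a} \<and>
      openin (split_topology \<tau>) {p \<in> X - E (\<tau> 0). split_less a (rA p)}"
  proof (cases "a \<in> A")
    case True
    then have "{p \<in> X - E (\<tau> 0). split_less (rA p) a} = {p \<in> X - E (\<tau> 0). split_less p (sigma a)}"
      "{p \<in> X - E (\<tau> 0). split_less a (rA p)} = {p \<in> X - E (\<tau> 0). split_less (sigma a) p}"
      by (auto simp: rA_less)
    then show ?thesis
      using openin_subset_ray[OF E(3) sigma_in_X[OF a]] by simp
  next
    case False
    then have "a \<in> B" using a A_Un_B by auto
    then have "{p \<in> X - E (\<tau> 0). split_less (rA p) a} = X - E (\<tau> 0)"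
      "{p \<in> X - E (\<tau> 0). split_less a (rA p)} = {}"
      by (auto simp: rA_less_B split_less_asym[OF rA_less_B])
    then show ?thesis using E by (simp only: openin_empty simp_thms)
  qed
  then show "openin (split_topology \<tau>) {p \<in> topspace (split_topology \<tau>). split_less (rA p) a}"
    "openin (split_topology \<tau>) {p \<in> topspace (split_topology \<tau>). split_less a (rA p)}"
    using E unfolding split[of "\<lambda>x. split_less x a"] split[of "split_less a"] by auto
qed

definition preimages :: "real \<times> bool \<Rightarrow> (real \<times> bool) set" where
  "preimages x = {y \<in> X. sigma y = x}"

lemma preimages:
  assumes "x \<in> X"
  shows "preimages x = (if x \<in> E (\<tau> 0) then {rB x} else {rA x, rB x})"
    and "x \<notin> E (\<tau> 0) \<Longrightarrow> rA x \<noteq> rB x"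
proof -
  have B: "{y \<in> B. sigma y = x} = {rB x}"
    using rB[OF assms] rB_sigma by auto
  have A: "{y \<in> A. sigma y = x} = (if x \<in> E (\<tau> 0) then {} else {rA x})"
    using rA[of x] assms rA_sigma sigma_image_A by auto
  have "preimages x = {y \<in> A. sigma y = x} \<union> {y \<in> B. sigma y = x}"
    unfolding preimages_def using A_Un_B by auto
  then show "preimages x = (if x \<in> E (\<tau> 0) then {rB x} else {rA x, rB x})"
    unfolding A B by auto
  show "x \<notin> E (\<tau> 0) \<Longrightarrow> rA x \<noteq> rB x"
    using rA[of x] rB[OF assms] assms A_Int_B by auto
qed

lemma transfer_op_sum: "transfer_op \<tau> f = (\<lambda>x\<in>X. \<Sum>y\<in>preimages x. f y)"
proof -
  have "{y. y \<in> X \<and> local_homeo \<tau> y = x} = preimages x" for x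
    by (auto simp: preimages_def local_homeo)
  then show ?thesis
    by (simp add: transfer_op_def)
qed

lemma transfer_op: "transfer_op \<tau> f = (\<lambda>x\<in>X. (if x \<in> E (\<tau> 0) then 0 else f (rA x)) + f (rB x))"
  unfolding transfer_op_sum using preimages by (auto simp: restrict_def fun_eq_iff)

text \<open>The inverse branches are continuous, and the missing left preimage is accounted for by a
  clopen indicator as a factor.\<close>

lemma transfer_op_CXZ:
  assumes "f \<in> CXZ \<tau>" shows "transfer_op \<tau> f \<in> CXZ \<tau>"
proof -
  let ?D = "discrete_topology UNIV :: int topology"
  have A: "continuous_map (split_topology \<tau>) ?D (f \<circ> rA)"
    by (rule continuous_map_compose[OF continuous_rA CXZ_continuous[OF assms]])
  have B: "continuous_map (split_topology \<tau>) ?D (f \<circ> rB)"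
    by (rule continuous_map_compose[OF continuous_rB CXZ_continuous[OF assms]])
  have "\<tau> 0 \<in> I\<^sub>1 \<tau>"
    using I1_invariant[of 0] I1_special by auto
  then have "continuous_map (split_topology \<tau>) ?D (\<lambda>x. if x \<in> E (\<tau> 0) then 0 else 1)"
    by (intro continuous_map_indicator) (auto simp: openin_E)
  from continuous_map_discrete_combine[OF this A, of "(*)"]
  have "continuous_map (split_topology \<tau>) ?D (\<lambda>x. (if x \<in> E (\<tau> 0) then 0 else 1) * (f \<circ> rA) x)" .
  from continuous_map_discrete_combine[OF this B, of "(+)"]
  have "continuous_map (split_topology \<tau>) ?D (\<lambda>x. (if x \<in> E (\<tau> 0) then 0 else 1) * (f \<circ> rA) x + (f \<circ> rB) x)" .
  moreover have "transfer_op \<tau> f = restrict (\<lambda>x. (if x \<in> E (\<tau> 0) then 0 else 1) * (f \<circ> rA) x + (f \<circ> rB) x) X"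
    unfolding transfer_op by (auto simp: restrict_def)
  ultimately show ?thesis
    by (simp only: restrict_mem_CXZ)
qed

text \<open>A compact subset of a discrete space is finite; the sum of the absolute values of the
  finitely many values is a crude bound.\<close>

lemma CXZ_bounded:
  assumes "f \<in> CXZ \<tau>"
  shows "\<exists>C::nat. \<forall>x\<in>X. \<bar>f x\<bar> \<le> int C"
proof -
  have "compactin (discrete_topology UNIV) (f ` X)"
    using image_compactin[OF _ CXZ_continuous[OF assms]] compact_space_X
    by (simp add: compact_space_def)
  then have fin: "finite (f ` X)"
    by (simp add: compactin_discrete_topology)
  have "\<bar>f x\<bar> \<le> int (nat (\<Sum>k\<in>f ` X. \<bar>k\<bar>))" if "x \<in> X" for x
    using member_le_sum[OF _ _ fin, of "f x" abs] that by auto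
  then show ?thesis by blast
qed

end

section \<open>Eigenstates of finite-to-one transfer operators\<close>

text \<open>Order and topology are left behind here: for bounded real functions, non-empty fibres of
  bounded size already keep \<open>s n\<close> between 1 and \<open>K ^ n\<close>.\<close>

locale finite_to_one =
  fixes X :: "'a set" and P :: "'a \<Rightarrow> 'a set" and K :: nat
  assumes X_nonempty: "X \<noteq> {}"
    and P_subset: "x \<in> X \<Longrightarrow> P x \<subseteq> X" and P_finite: "x \<in> X \<Longrightarrow> finite (P x)"
    and P_nonempty: "x \<in> X \<Longrightarrow> P x \<noteq> {}" and P_card: "x \<in> X \<Longrightarrow> card (P x) \<le> K"
begin

section \<open>Growth of the iterates and the radius of convergence\<close>

definition M :: "('a \<Rightarrow> real) \<Rightarrow> 'a \<Rightarrow> real" where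
  "M u = (\<lambda>x. \<Sum>y\<in>P x. u y)"

text \<open>\<open>s n x\<close> counts the chains of \<open>n\<close> steps from \<open>x\<close>
  through the fibres; in the application, the points that \<open>sigma\<close> takes to
  \<open>x\<close> in \<open>n\<close> steps.\<close>

definition s :: "nat \<Rightarrow> 'a \<Rightarrow> real" where
  "s n = (M ^^ n) (\<lambda>_. 1)"

definition bounded_by :: "real \<Rightarrow> ('a \<Rightarrow> real) \<Rightarrow> bool" where
  "bounded_by C u \<longleftrightarrow> (\<forall>x\<in>X. \<bar>u x\<bar> \<le> C)"

text \<open>Boundedness of the resolvent at \<open>t\<close>, uniformly over \<open>X\<close>; by
  \<open>M_bound\<close>, the constant 1 controls all bounded functions.\<close>

definition summable_at :: "real \<Rightarrow> bool" where
  "summable_at t \<longleftrightarrow> (\<exists>C. \<forall>N. \<forall>x\<in>X. (\<Sum>n<N. t ^ n * s n x) \<le> C)"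

text \<open>Its reciprocal is the eigenvalue found in \<open>exists_eigenstate\<close>.\<close>

definition radius :: real where
  "radius = Sup {t. 0 \<le> t \<and> summable_at t}"

lemma M_mono: "\<lbrakk>\<And>x. x \<in> X \<Longrightarrow> u x \<le> v x; x \<in> X\<rbrakk> \<Longrightarrow> (M ^^ n) u x \<le> (M ^^ n) v x"
proof (induction n arbitrary: x)
  case (Suc n)
  then show ?case
    using P_subset[of x] by (auto simp: M_def intro!: sum_mono)
qed simp

lemma M_scale: "(M ^^ n) (\<lambda>x. a * u x) = (\<lambda>x. a * (M ^^ n) u x)"
  by (induction n) (auto simp: M_def sum_distrib_left)

lemma M_add: "(M ^^ n) (\<lambda>x. u x + v x) = (\<lambda>x. (M ^^ n) u x + (M ^^ n) v x)"
  by (induction n) (auto simp: M_def sum.distrib)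

lemma K_pos: "1 \<le> K"
proof -
  obtain x where "x \<in> X" using X_nonempty by auto
  then have "card (P x) \<noteq> 0"
    using P_finite P_nonempty by simp
  then show ?thesis
    using P_card[OF \<open>x \<in> X\<close>] by linarith
qed

lemma s_0 [simp]: "s 0 x = 1"
  by (simp add: s_def)

lemma s_add: "s (n + m) = (M ^^ n) (s m)"
  by (simp add: s_def funpow_add)

lemma s_ge_1: "x \<in> X \<Longrightarrow> 1 \<le> s n x"
proof (induction n arbitrary: x)
  case (Suc n)
  have "1 \<le> (\<Sum>y\<in>P x. 1::real)"
    using P_finite[OF Suc.prems] P_nonempty[OF Suc.prems] by (simp add: Suc_le_eq card_gt_0_iff)
  also have "\<dots> \<le> (\<Sum>y\<in>P x. s n y)"
    using Suc P_subset[OF Suc.prems] by (intro sum_mono) auto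
  finally show ?case
    by (simp add: s_def M_def)
qed simp

lemma s_le: "x \<in> X \<Longrightarrow> s n x \<le> real K ^ n"
proof (induction n arbitrary: x)
  case (Suc n)
  have "s (Suc n) x = (\<Sum>y\<in>P x. s n y)"
    by (simp add: s_def M_def)
  also have "\<dots> \<le> (\<Sum>y\<in>P x. real K ^ n)"
    using Suc P_subset[OF Suc.prems] by (intro sum_mono) auto
  also have "\<dots> \<le> real K * real K ^ n"
    using P_card[OF Suc.prems] by (auto intro: mult_right_mono)
  finally show ?case by simp
qed simp

lemma M_bound:
  assumes "bounded_by C u" "x \<in> X"
  shows "\<bar>(M ^^ n) u x\<bar> \<le> C * s n x"
proof -
  have "(M ^^ n) u x \<le> (M ^^ n) (\<lambda>x. C * 1) x" "(M ^^ n) (\<lambda>x. -C * 1) x \<le> (M ^^ n) u x"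
    using assms by (auto simp: bounded_by_def abs_le_iff intro!: M_mono)
  then show ?thesis
    unfolding M_scale by (simp add: abs_le_iff s_def)
qed

lemma summable_at_mono:
  assumes "summable_at t" "0 \<le> t'" "t' \<le> t" shows "summable_at t'"
proof -
  obtain C where C: "\<And>N x. x \<in> X \<Longrightarrow> (\<Sum>n<N. t ^ n * s n x) \<le> C"
    using assms by (auto simp: summable_at_def)
  have "(\<Sum>n<N. t' ^ n * s n x) \<le> (\<Sum>n<N. t ^ n * s n x)" if "x \<in> X" for N x
    using assms order_trans[OF zero_le_one s_ge_1[OF that]]
    by (intro sum_mono mult_right_mono power_mono) auto
  then show ?thesis
    using C unfolding summable_at_def by (meson order_trans)
qed

lemma summable_at_small: "summable_at (1 / (2 * K))"
proof -
  have "(\<Sum>n<N. (1 / (2 * K)) ^ n * s n x) \<le> 2" if "x \<in> X" for N x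
  proof -
    have "(\<Sum>n<N. (1 / (2 * K)) ^ n * s n x) \<le> (\<Sum>n<N. (1 / (2 * K)) ^ n * real K ^ n)"
      using s_le[OF that] by (intro sum_mono mult_left_mono) auto
    also have "\<dots> = (\<Sum>n<N. (1/2) ^ n)"
      using K_pos by (intro sum.cong) (auto simp: power_divide power_mult_distrib)
    also have "\<dots> \<le> 2"
      by (simp add: geometric_sum)
    finally show ?thesis .
  qed
  then show ?thesis by (auto simp: summable_at_def)
qed

lemma summable_at_lt_1: "summable_at t \<Longrightarrow> t < 1"
proof (rule ccontr)
  assume t: "summable_at t" "\<not> t < 1"
  then have "summable_at 1"
    by (intro summable_at_mono[OF t(1)]) auto
  then obtain C where C: "\<And>N x. x \<in> X \<Longrightarrow> (\<Sum>n<N. 1 ^ n * s n x) \<le> C"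
    by (auto simp: summable_at_def)
  obtain x where x: "x \<in> X" using X_nonempty by auto
  obtain N where N: "C < real N"
    using reals_Archimedean2 by auto
  have "real N = (\<Sum>n<N. 1)" by simp
  also have "\<dots> \<le> (\<Sum>n<N. 1 ^ n * s n x)"
    using s_ge_1[OF x] by (intro sum_mono) auto
  finally show False
    using C[OF x, of N] N by simp
qed

text \<open>Suppose the \<open>n\<close>-th term exceeds 1/2 at some \<open>x\<close>. Since
  \<open>s n x\<close> is at most \<open>s k x\<close> times the supremum of
  \<open>s (n - k)\<close>, each of the \<open>n\<close> earlier terms at \<open>x\<close> is at
  least \<open>1 / (2 * C)\<close>, which is too much for large \<open>n\<close>.\<close>

lemma summable_at_decay:
  assumes "summable_at t" "0 < t"
  shows "\<exists>n\<ge>1. \<forall>x\<in>X. t ^ n * s n x \<le> 1/2"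
proof (rule ccontr)
  assume neg: "\<not> ?thesis"
  obtain C where C: "\<And>N x. x \<in> X \<Longrightarrow> (\<Sum>n<N. t ^ n * s n x) \<le> C"
    using assms by (auto simp: summable_at_def)
  have nonneg: "0 \<le> t ^ n * s n x" if "x \<in> X" for n x
    using assms s_ge_1[OF that, of n] by auto
  have term_le: "t ^ n * s n x \<le> C" if "x \<in> X" for n x
  proof -
    have "t ^ n * s n x \<le> (\<Sum>k<Suc n. t ^ k * s k x)"
      using nonneg[OF that] by (intro member_le_sum) auto
    then show ?thesis using C[OF that, of "Suc n"] by linarith
  qed
  have C1: "1 \<le> C"
    using X_nonempty term_le[of _ 0] by auto
  \<comment> \<open>Chosen so that \<open>n\<close> terms of size \<open>1 / (2 * C)\<close> add up
    to more than \<open>C\<close>.\<close>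
  obtain n :: nat where n: "2 * C * C < real n"
    using reals_Archimedean2 by auto
  have "1 \<le> n"
    using n C1 by (cases n) (auto simp: mult_less_0_iff)
  then obtain x where x: "x \<in> X" "1/2 < t ^ n * s n x"
    using neg by (metis not_le)
  have "1 / (2 * C) \<le> t ^ k * s k x" if k: "k < n" for k
  proof -
    have "t ^ (n - k) * s (n - k) y \<le> C" if "y \<in> X" for y
      using term_le[OF that] .
    then have "s (n - k) y \<le> C / t ^ (n - k) * 1" if "y \<in> X" for y
      using that assms by (simp add: field_simps)
    then have "(M ^^ k) (s (n - k)) x \<le> (M ^^ k) (\<lambda>y. C / t ^ (n - k) * 1) x"
      using x by (intro M_mono) auto
    then have "s n x \<le> C / t ^ (n - k) * s k x"
      using s_add[of k "n - k"] k unfolding M_scale by (simp add: s_def)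
    then have "t ^ n * s n x \<le> t ^ n * (C / t ^ (n - k) * s k x)"
      using assms by (intro mult_left_mono) auto
    also have "\<dots> = C * (t ^ k * s k x)"
      using assms k by (simp add: power_diff)
    finally show ?thesis
      using x C1 by (simp add: field_simps)
  qed
  then have "(\<Sum>k<n. 1 / (2 * C)) \<le> (\<Sum>k<n. t ^ k * s k x)"
    by (intro sum_mono) auto
  then have "real n / (2 * C) \<le> C"
    using C[OF x(1), of n] by simp
  then show False
    using n C1 by (simp add: field_simps)
qed

text \<open>A term below 1/2 leaves room to enlarge \<open>t\<close>: with the larger
  \<open>t'\<close>, moving \<open>n\<close> places along the series still contracts the terms by
  3/4. A partial sum \<open>S\<close> then satisfies \<open>S <= D + 3/4 * S\<close>, where
  \<open>D\<close> bounds the first \<open>n\<close> terms.\<close>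

lemma summable_at_open:
  assumes "summable_at t" "0 < t"
  shows "\<exists>t'>t. summable_at t'"
proof -
  obtain n where n: "1 \<le> n" "\<And>x. x \<in> X \<Longrightarrow> t ^ n * s n x \<le> 1/2"
    using summable_at_decay[OF assms] by auto
  \<comment> \<open>The root raises the bound 1/2 on the \<open>n\<close>-th term to
    \<open>1/2 * 3/2 = 3/4\<close>, still below 1.\<close>
  define t' where "t' = t * root n (3/2)"
  have "1 < root n (3/2)"
    using n by simp
  then have tt': "t < t'"
    using assms by (simp add: t'_def)
  have t'n: "t' ^ n = t ^ n * (3/2)"
    using n by (simp add: t'_def power_mult_distrib real_root_pow_pos2)
  have dec: "t' ^ n * s n x \<le> 3/4" if "x \<in> X" for x
    using n(2)[OF that] by (simp add: t'n)
  define D where "D = (\<Sum>k<n. (t' * K) ^ k)"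
  have nonneg: "0 \<le> t' ^ k * s k x" if "x \<in> X" for k x
    using assms tt' s_ge_1[OF that, of k] by auto
  have "(\<Sum>k<N. t' ^ k * s k x) \<le> 4 * D" if x: "x \<in> X" for N x
  proof -
    have first: "(\<Sum>k<n. t' ^ k * s k x) \<le> D"
      unfolding D_def power_mult_distrib using s_le[OF x] assms tt'
      by (intro sum_mono mult_left_mono) auto
    have step: "t' ^ (n + k) * s (n + k) x \<le> 3/4 * (t' ^ k * s k x)" for k
    proof -
      have "s n y \<le> 3/4 / t' ^ n * 1" if "y \<in> X" for y
        using dec[OF that] assms tt' by (simp add: field_simps)
      then have "(M ^^ k) (s n) x \<le> (M ^^ k) (\<lambda>y. 3/4 / t' ^ n * 1) x"
        using x by (intro M_mono) auto
      then have "s (n + k) x \<le> 3/4 / t' ^ n * s k x"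
        using s_add[of k n] unfolding M_scale by (simp add: s_def add.commute)
      then have "t' ^ (n + k) * s (n + k) x \<le> t' ^ (n + k) * (3/4 / t' ^ n * s k x)"
        using assms tt' by (intro mult_left_mono) auto
      then show ?thesis
        using assms tt' by (simp add: power_add)
    qed
    have "(\<Sum>k<N. t' ^ k * s k x) \<le> (\<Sum>k<n + N. t' ^ k * s k x)"
      using nonneg[OF x] by (intro sum_mono2) auto
    also have "\<dots> = (\<Sum>k<n. t' ^ k * s k x) + (\<Sum>k<N. t' ^ (n + k) * s (n + k) x)"
      by (induction N) auto
    also have "\<dots> \<le> D + (\<Sum>k<N. 3/4 * (t' ^ k * s k x))"
      using first step by (intro add_mono sum_mono) auto
    also have "\<dots> = D + 3/4 * (\<Sum>k<N. t' ^ k * s k x)"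
      by (simp only: sum_distrib_left)
    finally show ?thesis by linarith
  qed
  then have "summable_at t'"
    unfolding summable_at_def by blast
  then show ?thesis using tt' by blast
qed

lemma radius_bdd: "bdd_above {t. 0 \<le> t \<and> summable_at t}"
  using summable_at_lt_1 by (auto intro!: bdd_aboveI[of _ 1] less_imp_le)

lemma radius_pos: "0 < radius"
proof -
  have "1 / (2 * K) \<le> radius"
    unfolding radius_def using summable_at_small by (intro cSup_upper radius_bdd) auto
  moreover have "0 < 1 / (2 * real K)"
    using K_pos by simp
  ultimately show ?thesis by linarith
qed

lemma summable_at_below_radius: "0 \<le> t \<Longrightarrow> t < radius \<Longrightarrow> summable_at t"
proof -
  assume t: "0 \<le> t" "t < radius"
  moreover have "{t. 0 \<le> t \<and> summable_at t} \<noteq> {}"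
    using summable_at_small by (auto intro!: exI[of _ "1 / (2 * K)"])
  ultimately obtain t' where "summable_at t'" "t < t'"
    unfolding radius_def using less_cSup_iff[OF _ radius_bdd] by auto
  then show "summable_at t"
    using t by (auto intro: summable_at_mono)
qed

lemma not_summable_at_radius: "\<not> summable_at radius"
proof
  assume "summable_at radius"
  then obtain t where "radius < t" "summable_at t"
    using summable_at_open radius_pos by blast
  moreover then have "t \<le> radius"
    unfolding radius_def using radius_pos by (intro cSup_upper radius_bdd) (auto simp: radius_def)
  ultimately show False by simp
qed

text \<open>Partial sums are polynomials in \<open>t\<close>, so a uniform bound for
  \<open>t\<close> slightly below \<open>radius\<close> would pass to \<open>radius\<close>
  itself.\<close>

lemma large_near_radius:
  assumes "t1 < radius"
  shows "\<exists>t. t1 < t \<and> t < radius \<and> (\<exists>x\<in>X. \<exists>N. C < (\<Sum>n<N. t ^ n * s n x))"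
proof (rule ccontr)
  assume neg: "\<not> ?thesis"
  have "(\<Sum>n<N. radius ^ n * s n x) \<le> C" if x: "x \<in> X" for N x
  proof (rule tendsto_upperbound)
    show "((\<lambda>t. \<Sum>n<N. t ^ n * s n x) \<longlongrightarrow> (\<Sum>n<N. radius ^ n * s n x)) (at_left radius)"
      by (intro tendsto_intros)
    show "\<forall>\<^sub>F t in at_left radius. (\<Sum>n<N. t ^ n * s n x) \<le> C"
      using eventually_at_left_real[OF assms]
    proof eventually_elim
      case (elim t)
      then show ?case
        using neg x by (meson greaterThanLessThan_iff not_less)
    qed
  qed simp
  then show False
    using not_summable_at_radius unfolding summable_at_def by blast
qed

section \<open>States and the limiting eigenstate\<close>

text \<open>Each instance of a clause is a closed condition on finitely many values of
  \<open>\<omega>\<close>, and the bound by \<open>C\<close> confines each value on a bounded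
  function to a compact interval: this is what the compactness argument uses.\<close>

definition state :: "(('a \<Rightarrow> real) \<Rightarrow> real) \<Rightarrow> bool" where
  "state \<omega> \<longleftrightarrow> (\<forall>u v C D. bounded_by C u \<longrightarrow> bounded_by D v \<longrightarrow> \<omega> (\<lambda>x. u x + v x) = \<omega> u + \<omega> v) \<and>
     (\<forall>u C. bounded_by C u \<longrightarrow> (\<forall>x\<in>X. 0 \<le> u x) \<longrightarrow> 0 \<le> \<omega> u) \<and>
     (\<forall>u C. bounded_by C u \<longrightarrow> \<bar>\<omega> u\<bar> \<le> C) \<and> \<omega> (\<lambda>_. 1) = 1"

text \<open>Splitting off the first term of the resolvent gives
  \<open>\<omega> u = u x / Z + t * \<omega> (M u)\<close>, where \<open>Z\<close> is the
  normalising sum. So \<open>\<omega> (M u)\<close> differs from \<open>\<omega> u / t\<close> by a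
  term that is small for large \<open>Z\<close>, and \<open>1 / t\<close> is close to
  \<open>1 / radius\<close>.\<close>

lemma approximate_eigenstate:
  assumes "0 < \<epsilon>"
  shows "\<exists>\<omega>. state \<omega> \<and> (\<forall>u C. bounded_by C u \<longrightarrow> \<bar>\<omega> (M u) - \<omega> u / radius\<bar> \<le> \<epsilon> * C)"
proof -
  let ?T = radius
  note T = radius_pos
  \<comment> \<open>With \<open>t > ?T / 2\<close>, the distance
    \<open>\<epsilon> * ?T ^ 2 / 4\<close> makes \<open>1 / t - 1 / ?T\<close> at most
    \<open>\<epsilon> / 2\<close>, and \<open>Z > 4 / (?T * \<epsilon>)\<close> below makes
    \<open>1 / (Z * t)\<close> at most \<open>\<epsilon> / 2\<close>.\<close>
  define t1 where "t1 = max (?T / 2) (?T - \<epsilon> * ?T ^ 2 / 4)"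
  have "t1 < ?T"
    using T assms by (simp add: t1_def)
  then obtain t x N where t: "t1 < t" "t < ?T" and x: "x \<in> X"
    and N: "4 / (?T * \<epsilon>) < (\<Sum>n<N. t ^ n * s n x)"
    using large_near_radius by blast
  have t2: "?T / 2 < t" and t3: "?T - t < \<epsilon> * ?T ^ 2 / 4"
    using t(1) by (auto simp: t1_def)
  have t0: "0 < t" using t2 T by linarith
  obtain C where C: "\<And>N. (\<Sum>n<N. t ^ n * s n x) \<le> C"
    using summable_at_below_radius[OF less_imp_le[OF t0] t(2)] x by (auto simp: summable_at_def)
  have nonneg: "0 \<le> t ^ n * s n x" for n
    using t0 s_ge_1[OF x, of n] by auto
  have summ: "summable (\<lambda>n. t ^ n * s n x)"
    using nonneg C by (intro summableI_nonneg_bounded[of _ C]) auto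
  define Z where "Z = (\<Sum>n. t ^ n * s n x)"
  have "4 / (?T * \<epsilon>) < Z"
    using N sum_le_suminf[OF summ, of "{..<N}"] nonneg by (auto simp: Z_def)
  moreover have "0 < 4 / (?T * \<epsilon>)"
    using T assms by simp
  ultimately have Z: "0 < Z" "4 / (?T * \<epsilon>) < Z" by linarith+
  define \<omega> where "\<omega> u = (\<Sum>n. t ^ n * (M ^^ n) u x) / Z" for u
  have bnd: "\<bar>t ^ n * (M ^^ n) u x\<bar> \<le> C * (t ^ n * s n x)" if "bounded_by C u" for u C n
    using M_bound[OF that x, of n] t0 by (simp add: abs_mult mult.left_commute)
  have summ_u: "summable (\<lambda>n. t ^ n * (M ^^ n) u x)" if "bounded_by C u" for u C
    by (rule summable_comparison_test'[OF summable_mult[OF summ, of C], of 0]) (use bnd[OF that] in auto)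
  have abs_le: "\<bar>\<omega> u\<bar> \<le> C" if u: "bounded_by C u" for u C
  proof -
    have "\<bar>\<Sum>n. t ^ n * (M ^^ n) u x\<bar> \<le> (\<Sum>n. C * (t ^ n * s n x))"
      using norm_suminf_le[of "\<lambda>n. t ^ n * (M ^^ n) u x" "\<lambda>n. C * (t ^ n * s n x)"]
        bnd[OF u] summable_mult[OF summ, of C] by simp
    also have "\<dots> = C * Z"
      unfolding Z_def by (rule suminf_mult[OF summ])
    finally show ?thesis
      using Z by (simp add: \<omega>_def field_simps)
  qed
  have "state \<omega>"
    unfolding state_def
  proof (intro conjI allI impI)
    fix u v C D assume uv: "bounded_by C u" "bounded_by D v"
    show "\<omega> (\<lambda>x. u x + v x) = \<omega> u + \<omega> v"
      using suminf_add[OF summ_u[OF uv(1)] summ_u[OF uv(2)], symmetric]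
      by (simp add: \<omega>_def M_add distrib_left add_divide_distrib)
  next
    fix u C assume u: "bounded_by C u" "\<forall>x\<in>X. 0 \<le> u x"
    have "0 \<le> (M ^^ n) u x" for n
      using M_mono[of "\<lambda>x. 0 * 1" u x n] u(2) x unfolding M_scale by simp
    then show "0 \<le> \<omega> u"
      using summ_u[OF u(1)] t0 Z by (auto simp: \<omega>_def intro!: divide_nonneg_pos suminf_nonneg)
  next
    show "\<omega> (\<lambda>_. 1) = 1"
      using Z by (simp add: \<omega>_def Z_def flip: s_def)
  qed (use abs_le in auto)
  moreover have "\<bar>\<omega> (M u) - \<omega> u / ?T\<bar> \<le> \<epsilon> * C" if u: "bounded_by C u" for u C
  proof -
    have "(\<Sum>n. t ^ n * (M ^^ n) u x) = u x + (\<Sum>n. t ^ Suc n * (M ^^ Suc n) u x)"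
      using suminf_split_head[OF summ_u[OF u]] by simp
    also have "(\<Sum>n. t ^ Suc n * (M ^^ Suc n) u x) = t * (\<Sum>n. t ^ n * (M ^^ n) (M u) x)"
    proof -
      have eq: "t ^ Suc n * (M ^^ Suc n) u x = t * (t ^ n * (M ^^ n) (M u) x)" for n
        by (simp add: funpow_swap1)
      have "summable (\<lambda>n. t ^ Suc n * (M ^^ Suc n) u x)"
        using summ_u[OF u] by (subst summable_Suc_iff)
      then have "summable (\<lambda>n. t ^ n * (M ^^ n) (M u) x)"
        unfolding eq using t0 by (simp add: summable_cmult_iff)
      then show ?thesis
        unfolding eq by (rule suminf_mult)
    qed
    finally have "\<omega> u = u x / Z + t * \<omega> (M u)"
      by (simp add: \<omega>_def add_divide_distrib)
    then have "\<omega> (M u) = \<omega> u / t - u x / (Z * t)"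
      using t0 Z by (simp add: field_simps)
    then have "\<omega> (M u) - \<omega> u / ?T = \<omega> u * (1 / t - 1 / ?T) - u x / (Z * t)"
      by (simp add: algebra_simps)
    also have "\<bar>\<dots>\<bar> \<le> \<bar>\<omega> u\<bar> * \<bar>1 / t - 1 / ?T\<bar> + \<bar>u x\<bar> / (Z * t)"
      using t0 Z abs_triangle_ineq4[of "\<omega> u * (1 / t - 1 / ?T)" "u x / (Z * t)"] by (simp add: abs_mult)
    also have "\<dots> \<le> C * (\<epsilon> / 2) + C * (\<epsilon> / 2)"
    proof (rule add_mono)
      have C0: "\<bar>u x\<bar> \<le> C" "0 \<le> C"
        using u x unfolding bounded_by_def by force+
      have "\<bar>1 / t - 1 / ?T\<bar> = (?T - t) / (t * ?T)"
        using t t0 T by (simp add: field_simps)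
      also have "\<dots> \<le> (\<epsilon> * ?T ^ 2 / 4) / (?T / 2 * ?T)"
        using t t0 T t2 t3 by (intro frac_le mult_right_mono) auto
      also have "\<dots> = \<epsilon> / 2"
        using T by (simp add: power2_eq_square)
      finally show "\<bar>\<omega> u\<bar> * \<bar>1 / t - 1 / ?T\<bar> \<le> C * (\<epsilon> / 2)"
        using abs_le[OF u] C0 by (intro mult_mono) auto
      have "2 / \<epsilon> = 4 / (?T * \<epsilon>) * (?T / 2)"
        using T by simp
      also have "\<dots> \<le> Z * t"
        using Z t2 T assms by (intro mult_mono) auto
      finally have "1 / (Z * t) \<le> \<epsilon> / 2"
        using Z t0 assms by (simp add: field_simps)
      then have "\<bar>u x\<bar> * (1 / (Z * t)) \<le> C * (\<epsilon> / 2)"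
        using C0 Z t0 by (intro mult_mono) auto
      then show "\<bar>u x\<bar> / (Z * t) \<le> C * (\<epsilon> / 2)" by simp
    qed
    finally show ?thesis by (simp add: mult.commute)
  qed
  ultimately show ?thesis by blast
qed

text \<open>The sets \<open>F n\<close> of approximate eigenstates are closed, decreasing, and meet
  a product of compact intervals, which is compact by Tychonoff. A common point satisfies the
  eigenvalue equation exactly.\<close>

theorem exists_eigenstate:
  "\<exists>\<omega> r. 0 < r \<and> state \<omega> \<and> (\<forall>u C. bounded_by C u \<longrightarrow> \<omega> (M u) = r * \<omega> u)"
proof -
  define bd where "bd u = (SOME C. bounded_by C u)" for u
  define box where "box u = (if \<exists>C. bounded_by C u then {- bd u..bd u} else {0})" for u
  define F where "F n = {\<omega>. state \<omega> \<and> (\<forall>u C. bounded_by C u \<longrightarrow> \<bar>\<omega> (M u) - \<omega> u / radius\<bar> \<le> 1 / real (Suc n) * C)}" for n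
  have "compactin (product_topology (\<lambda>_. euclidean) UNIV) (PiE UNIV box)"
    by (simp add: compactin_PiE box_def)
  then have compact: "compact (PiE UNIV box)"
    by (simp add: euclidean_product_topology)
  have closed: "closed (F n)" for n
    unfolding F_def state_def
    by (intro closed_Collect_conj closed_Collect_all closed_Collect_imp open_Collect_const
        closed_Collect_eq closed_Collect_le continuous_intros continuous_on_product_coordinates)
      (use radius_pos in auto)
  have nonempty: "PiE UNIV box \<inter> F n \<noteq> {}" for n
  proof -
    obtain \<omega> where \<omega>: "state \<omega>" "\<And>u C. bounded_by C u \<Longrightarrow> \<bar>\<omega> (M u) - \<omega> u / radius\<bar> \<le> 1 / real (Suc n) * C"
      using approximate_eigenstate[of "1 / real (Suc n)"] by auto
    \<comment> \<open>Values on unbounded functions are unconstrained; setting them to 0 puts the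
      functional into the box, whose factors there are \<open>{0}\<close>.\<close>
    define \<omega>' where "\<omega>' u = (if \<exists>C. bounded_by C u then \<omega> u else 0)" for u
    have eq: "\<omega>' u = \<omega> u" if "bounded_by C u" for u C
      using that by (auto simp: \<omega>'_def)
    have "bounded_by (C + D) (\<lambda>x. u x + v x)" if "bounded_by C u" "bounded_by D v" for u v C D
      using that unfolding bounded_by_def by (smt (verit))
    moreover have "bounded_by 1 (\<lambda>_. 1)"
      by (simp add: bounded_by_def)
    ultimately have "state \<omega>'"
      using \<omega>(1) eq unfolding state_def by (metis (no_types, lifting))
    moreover have "bounded_by (C * K) (M u)" if u: "bounded_by C u" for u C
      unfolding bounded_by_def
    proof
      fix x assume x: "x \<in> X"
      then have "0 \<le> C" "\<bar>u x\<bar> \<le> C"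
        using u unfolding bounded_by_def by force+
      then show "\<bar>M u x\<bar> \<le> C * K"
        using M_bound[OF u x, of 1] mult_left_mono[OF s_le[OF x, of 1], of C] by simp
    qed
    then have "\<bar>\<omega>' (M u) - \<omega>' u / radius\<bar> \<le> 1 / real (Suc n) * C" if "bounded_by C u" for u C
      using \<omega>(2)[OF that] eq that by metis
    ultimately have "\<omega>' \<in> F n"
      by (simp add: F_def)
    moreover have "\<omega>' u \<in> box u" for u
    proof (cases "\<exists>C. bounded_by C u")
      case True
      then have "bounded_by (bd u) u"
        unfolding bd_def by (rule someI_ex)
      then have "\<bar>\<omega>' u\<bar> \<le> bd u"
        using \<open>state \<omega>'\<close> by (simp add: state_def)
      then show ?thesis
        using True by (auto simp: box_def abs_le_iff)
    qed (simp add: box_def \<omega>'_def)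
    ultimately show ?thesis by auto
  qed
  have antimono: "F n \<subseteq> F m" if "m \<le> n" for m n
  proof -
    have "1 / real (Suc n) * C \<le> 1 / real (Suc m) * C" if "bounded_by C u" for u C
    proof -
      have "0 \<le> C"
        using that X_nonempty unfolding bounded_by_def by force
      then show ?thesis
        using \<open>m \<le> n\<close> by (intro mult_right_mono divide_left_mono) auto
    qed
    then show ?thesis
      unfolding F_def by (intro Collect_mono) (meson order_trans)
  qed
  have "PiE UNIV box \<inter> \<Inter>(range F) \<noteq> {}"
  proof (rule compact_imp_fip[OF compact])
    fix \<F> assume "finite \<F>" "\<F> \<subseteq> range F"
    then obtain I where I: "finite I" "\<F> = F ` I"
      by (meson finite_subset_image)
    have "F (Max (insert 0 I)) \<subseteq> \<Inter>\<F>"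
      unfolding I(2) using I(1) by (intro INT_greatest antimono Max_ge) auto
    then show "PiE UNIV box \<inter> \<Inter>\<F> \<noteq> {}"
      using nonempty by blast
  qed (use closed in auto)
  then obtain \<omega> where \<omega>: "\<And>n. \<omega> \<in> F n" by auto
  have "\<omega> (M u) = 1 / radius * \<omega> u" if u: "bounded_by C u" for u C
  proof -
    have "\<bar>\<omega> (M u) - \<omega> u / radius\<bar> \<le> 1 / real (Suc n) * C" for n
      using \<omega>[of n] u by (simp add: F_def)
    moreover have "(\<lambda>n. 1 / real (Suc n) * C) \<longlonglongrightarrow> 0 * C"
      by (intro tendsto_mult tendsto_const LIMSEQ_Suc lim_const_over_n)
    ultimately have "\<bar>\<omega> (M u) - \<omega> u / radius\<bar> \<le> 0"
      by (intro tendsto_lowerbound[of _ "0 * C", simplified]) auto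
    then show ?thesis by simp
  qed
  then show ?thesis
    using \<omega>[of 0] radius_pos by (intro exI[of _ \<omega>] exI[of _ "1 / radius"]) (auto simp: F_def)
qed

end

section \<open>From a scaled state to a conjugacy with a tent map\<close>

definition scaled_state :: "(real \<Rightarrow> real) \<Rightarrow> real \<Rightarrow> ((real \<times> bool \<Rightarrow> int) \<Rightarrow> real) \<Rightarrow> bool" where
  "scaled_state \<tau> r \<omega> \<longleftrightarrow> 0 < r \<and>
     (\<forall>f\<in>CXZ \<tau>. \<forall>g\<in>CXZ \<tau>. \<omega> (\<lambda>x\<in>split_space \<tau>. f x + g x) = \<omega> f + \<omega> g) \<and>
     (\<forall>f\<in>CXZ \<tau>. (\<forall>x\<in>split_space \<tau>. 0 \<le> f x) \<longrightarrow> 0 \<le> \<omega> f) \<and>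
     (\<forall>f\<in>CXZ \<tau>. \<omega> (transfer_op \<tau> f) = r * \<omega> f) \<and>
     \<omega> (\<lambda>x\<in>split_space \<tau>. 1) = 1"

text \<open>The two lines meet at \<open>1 - 1 / r\<close> with value 1, and the right one vanishes
  at 1; for \<open>r >= 1\<close> the value at 0 is \<open>2 - r\<close>.\<close>

definition tent :: "real \<Rightarrow> real \<Rightarrow> real" where
  "tent r y = min (r * y + 2 - r) (r - r * y)"

context transitive_unimodal
begin

sublocale finite_to_one X preimages 2
proof
  show "X \<noteq> {}" using zero_in_A A_subset_X by auto
  fix x assume x: "x \<in> X"
  show "preimages x \<subseteq> X" by (auto simp: preimages_def)
  show "finite (preimages x)" "preimages x \<noteq> {}" "card (preimages x) \<le> 2"
    using preimages[OF x] by (auto simp: card_insert_if)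
qed

lemma exists_scaled_state: "\<exists>r \<omega>. scaled_state \<tau> r \<omega>"
proof -
  obtain \<Omega> r where r: "0 < r" and st: "state \<Omega>"
    and eig: "\<And>u C. bounded_by C u \<Longrightarrow> \<Omega> (M u) = r * \<Omega> u"
    using exists_eigenstate by auto
  have add: "\<Omega> (\<lambda>x. u x + v x) = \<Omega> u + \<Omega> v" if "bounded_by C u" "bounded_by D v" for u v C D
    using st that unfolding state_def by blast
  have abs_le: "\<bar>\<Omega> u\<bar> \<le> C" if "bounded_by C u" for u C
    using st that unfolding state_def by blast
  \<comment> \<open>The difference is bounded by 0 on \<open>X\<close>, so \<open>\<Omega>\<close>
    sees only values on \<open>X\<close>. This bridges extensional functions and plain real
    ones.\<close>
  have cong: "\<Omega> v = \<Omega> u" if u: "bounded_by C u" and eq: "\<And>x. x \<in> X \<Longrightarrow> v x = u x" for u v C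
  proof -
    have w: "bounded_by 0 (\<lambda>x. v x - u x)"
      using eq by (simp add: bounded_by_def)
    have "\<Omega> (\<lambda>x. u x + (v x - u x)) = \<Omega> u + \<Omega> (\<lambda>x. v x - u x)"
      by (rule add[OF u w])
    then show ?thesis
      using abs_le[OF w] by simp
  qed
  define \<omega> where "\<omega> f = \<Omega> (\<lambda>x. real_of_int (f x))" for f :: "real \<times> bool \<Rightarrow> int"
  have bnd: "\<exists>C. bounded_by C (\<lambda>x. real_of_int (f x))" if f: "f \<in> CXZ \<tau>" for f
  proof -
    obtain C :: nat where C: "\<And>x. x \<in> X \<Longrightarrow> \<bar>f x\<bar> \<le> int C"
      using CXZ_bounded[OF f] by auto
    have "\<bar>real_of_int (f x)\<bar> \<le> real C" if "x \<in> X" for x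
      using C[OF that] by linarith
    then show ?thesis
      unfolding bounded_by_def by blast
  qed
  have "\<omega> (\<lambda>x\<in>X. f x + g x) = \<omega> f + \<omega> g" if f: "f \<in> CXZ \<tau>" and g: "g \<in> CXZ \<tau>" for f g
  proof -
    obtain C D where CD: "bounded_by C (\<lambda>x. real_of_int (f x))" "bounded_by D (\<lambda>x. real_of_int (g x))"
      using bnd f g by meson
    obtain D' where D': "bounded_by D' (\<lambda>x. real_of_int ((\<lambda>x\<in>X. f x + g x) x))"
      using bnd[OF CXZ_combine[OF f g, of "(+)"]] by auto
    have "\<Omega> (\<lambda>x. real_of_int (f x) + real_of_int (g x)) = \<omega> (\<lambda>x\<in>X. f x + g x)"
      unfolding \<omega>_def by (rule cong[OF D']) simp
    then show ?thesis
      using add[OF CD] by (simp add: \<omega>_def)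
  qed
  moreover have "0 \<le> \<omega> f" if f: "f \<in> CXZ \<tau>" and "\<forall>x\<in>X. 0 \<le> f x" for f
  proof -
    obtain C where "bounded_by C (\<lambda>x. real_of_int (f x))"
      using bnd f by meson
    moreover have "\<forall>x\<in>X. 0 \<le> real_of_int (f x)"
      using that by simp
    ultimately show ?thesis
      using st unfolding state_def \<omega>_def by blast
  qed
  moreover have "\<omega> (transfer_op \<tau> f) = r * \<omega> f" if f: "f \<in> CXZ \<tau>" for f
  proof -
    obtain C D where CD: "bounded_by C (\<lambda>x. real_of_int (f x))" "bounded_by D (\<lambda>x. real_of_int (transfer_op \<tau> f x))"
      using bnd f transfer_op_CXZ by meson
    have "\<Omega> (M (\<lambda>x. real_of_int (f x))) = \<omega> (transfer_op \<tau> f)"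
      unfolding \<omega>_def by (rule cong[OF CD(2)]) (simp add: M_def transfer_op_sum)
    then show ?thesis
      using eig[OF CD(1)] by (simp add: \<omega>_def)
  qed
  moreover have "\<omega> (\<lambda>x\<in>X. 1) = 1"
  proof -
    have "\<omega> (\<lambda>x\<in>X. 1) = \<Omega> (\<lambda>_. 1)"
      unfolding \<omega>_def by (rule cong[of 1]) (auto simp: bounded_by_def)
    then show ?thesis
      using st by (simp add: state_def)
  qed
  ultimately show ?thesis
    using r unfolding scaled_state_def by blast
qed

end

locale scaled_unimodal = transitive_unimodal +
  fixes r :: real and \<omega> :: "(real \<times> bool \<Rightarrow> int) \<Rightarrow> real"
  assumes scaled: "scaled_state \<tau> r \<omega>"
begin

lemma r_pos: "0 < r"
  and \<omega>_add: "\<lbrakk>f \<in> CXZ \<tau>; f' \<in> CXZ \<tau>\<rbrakk> \<Longrightarrow> \<omega> (\<lambda>x\<in>X. f x + f' x) = \<omega> f + \<omega> f'"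
  and \<omega>_nonneg: "\<lbrakk>f \<in> CXZ \<tau>; \<And>x. x \<in> X \<Longrightarrow> 0 \<le> f x\<rbrakk> \<Longrightarrow> 0 \<le> \<omega> f"
  and \<omega>_transfer: "f \<in> CXZ \<tau> \<Longrightarrow> \<omega> (transfer_op \<tau> f) = r * \<omega> f"
  and \<omega>_1: "\<omega> (\<lambda>x\<in>X. 1) = 1"
  using scaled unfolding scaled_state_def by blast+

section \<open>The distribution function on split points\<close>

definition ind :: "real \<Rightarrow> real \<times> bool \<Rightarrow> int" where
  "ind q = (\<lambda>p\<in>X. if p \<in> E q then 1 else 0)"

definition g :: "real \<Rightarrow> real" where
  "g q = \<omega> (ind q)"

lemma ind_CXZ: "q \<in> I\<^sub>1 \<tau> \<Longrightarrow> ind q \<in> CXZ \<tau>"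
  unfolding ind_def by (intro restrict_mem_CXZ continuous_map_indicator) (auto simp: openin_E)

lemma g_0: "g 0 = 0"
proof -
  have "(\<lambda>x\<in>X. ind 0 x + ind 0 x) = ind 0"
    by (auto simp: ind_def)
  then show ?thesis
    using \<omega>_add[OF ind_CXZ ind_CXZ, of 0 0] I1_special by (simp add: g_def)
qed

lemma g_1: "g 1 = 1"
proof -
  have "ind 1 = (\<lambda>x\<in>X. 1)"
    by (auto simp: ind_def)
  then show ?thesis
    by (simp add: g_def \<omega>_1)
qed

lemma g_mono:
  assumes "q \<in> I\<^sub>1 \<tau>" "q' \<in> I\<^sub>1 \<tau>" "q \<le> q'"
  shows "g q \<le> g q'"
proof -
  have sub: "E q \<subseteq> E q'"
    using assms I1_bounds by (intro E_mono) auto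
  have d: "(\<lambda>x\<in>X. ind q' x - ind q x) \<in> CXZ \<tau>"
    by (rule CXZ_combine[OF ind_CXZ ind_CXZ]) (use assms in auto)
  have "(\<lambda>x\<in>X. ind q x + (\<lambda>x\<in>X. ind q' x - ind q x) x) = ind q'"
    by (auto simp: ind_def)
  then have "g q' = g q + \<omega> (\<lambda>x\<in>X. ind q' x - ind q x)"
    using \<omega>_add[OF ind_CXZ[OF assms(1)] d] by (simp add: g_def)
  moreover have "0 \<le> \<omega> (\<lambda>x\<in>X. ind q' x - ind q x)"
    using sub by (intro \<omega>_nonneg[OF d]) (auto simp: ind_def)
  ultimately show ?thesis by simp
qed

lemma tau0_I1: "\<tau> 0 \<in> I\<^sub>1 \<tau>"
  using I1_invariant[of 0] I1_special by simp

lemma tau_I1: "q \<in> I\<^sub>1 \<tau> \<Longrightarrow> \<tau> q \<in> I\<^sub>1 \<tau>"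
  using I1_invariant I1_bounds by blast

text \<open>For \<open>x\<close> right of the cut at \<open>\<tau> 0\<close>, the left preimage lies
  in \<open>E q\<close> exactly when \<open>x\<close> is left of the cut at \<open>\<tau> q\<close>;
  the right preimage never does, as \<open>E q\<close> is inside \<open>A\<close>. So the transfer
  of \<open>ind q\<close> is \<open>ind (\<tau> q) - ind (\<tau> 0)\<close>.\<close>

lemma g_left:
  assumes q: "q \<in> I\<^sub>1 \<tau>" "q \<le> c"
  shows "g (\<tau> q) = r * g q + g (\<tau> 0)"
proof -
  have "\<tau> 0 \<le> \<tau> q"
    using increasing[of 0 q] q I1_bounds[OF q(1)] by (cases "q = 0") auto
  then have sub: "E (\<tau> 0) \<subseteq> E (\<tau> q)"
    using tau_bounds[of 0] by (intro E_mono) auto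
  have Eq: "E q \<subseteq> A"
    unfolding E_c[symmetric] using q I1_bounds by (intro E_mono) auto
  have "transfer_op \<tau> (ind q) x + ind (\<tau> 0) x = ind (\<tau> q) x" if x: "x \<in> X" for x
  proof -
    have "rB x \<notin> E q"
      using rB[OF x] Eq A_Int_B by blast
    moreover have "rB x \<in> X" "x \<notin> E (\<tau> 0) \<Longrightarrow> rA x \<in> X"
      using rB[OF x] rA[of x] x A_subset_X B_subset_X by auto
    moreover have "rA x \<in> E q \<longleftrightarrow> x \<in> E (\<tau> q)" if "x \<notin> E (\<tau> 0)"
      using A_E_iff[of "rA x" q] rA[of x] x q that by simp
    ultimately show ?thesis
      using x sub by (auto simp: transfer_op ind_def)
  qed
  then have "(\<lambda>x\<in>X. transfer_op \<tau> (ind q) x + ind (\<tau> 0) x) = ind (\<tau> q)"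
    by (auto simp: ind_def)
  then have "g (\<tau> q) = \<omega> (transfer_op \<tau> (ind q)) + g (\<tau> 0)"
    using \<omega>_add[OF transfer_op_CXZ[OF ind_CXZ[OF q(1)]] ind_CXZ[OF tau0_I1]] by (simp add: g_def)
  then show ?thesis
    using \<omega>_transfer[OF ind_CXZ[OF q(1)]] by (simp add: g_def)
qed

text \<open>Now every left preimage counts, contributing \<open>1 - ind (\<tau> 0)\<close>, and the
  right preimage counts unless \<open>x\<close> is in \<open>E (\<tau> q)\<close>, contributing
  \<open>1 - ind (\<tau> q)\<close>.\<close>

lemma g_right':
  assumes q: "q \<in> I\<^sub>1 \<tau>" "c \<le> q"
  shows "r * g q + g (\<tau> q) = 2 - g (\<tau> 0)"
proof -
  have Eq: "A \<subseteq> E q"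
    unfolding E_c[symmetric] using q c_bounds by (intro E_mono) auto
  have pt: "transfer_op \<tau> (ind q) x + ind (\<tau> q) x = 2 - ind (\<tau> 0) x" if x: "x \<in> X" for x
  proof -
    have "rB x \<in> X" "x \<notin> E (\<tau> 0) \<Longrightarrow> rA x \<in> X" "x \<notin> E (\<tau> 0) \<Longrightarrow> rA x \<in> E q"
      using rB[OF x] rA[of x] x A_subset_X B_subset_X Eq by auto
    moreover have "rB x \<notin> E q \<longleftrightarrow> x \<in> E (\<tau> q)"
      using B_E_iff[of "rB x" q] rB[OF x] q by simp
    ultimately show ?thesis
      using x by (auto simp: transfer_op ind_def)
  qed
  define f where "f = (\<lambda>x\<in>X. transfer_op \<tau> (ind q) x + ind (\<tau> q) x)"
  have f: "f \<in> CXZ \<tau>"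
    unfolding f_def by (rule CXZ_combine[OF transfer_op_CXZ[OF ind_CXZ] ind_CXZ]) (use q tau_I1 in auto)
  have "(\<lambda>x\<in>X. f x + ind (\<tau> 0) x) = (\<lambda>x\<in>X. (\<lambda>x\<in>X. 1) x + (\<lambda>x\<in>X. 1) x)"
    using pt by (auto simp: f_def)
  then have "\<omega> f + g (\<tau> 0) = 2"
    using \<omega>_add[OF f ind_CXZ[OF tau0_I1]] \<omega>_add[OF CXZ_const CXZ_const, of 1 1] \<omega>_1
    by (simp add: g_def)
  moreover have "\<omega> f = r * g q + g (\<tau> q)"
    unfolding f_def using \<omega>_add[OF transfer_op_CXZ[OF ind_CXZ[OF q(1)]] ind_CXZ[OF tau_I1[OF q(1)]]]
      \<omega>_transfer[OF ind_CXZ[OF q(1)]] by (simp add: g_def)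
  ultimately show ?thesis by simp
qed

lemma g_tau0: "g (\<tau> 0) = 2 - r"
  using g_right'[of 1] I1_special c_bounds by (simp add: tau_1 g_0 g_1)

lemma g_right: "\<lbrakk>q \<in> I\<^sub>1 \<tau>; c \<le> q\<rbrakk> \<Longrightarrow> g (\<tau> q) = r - r * g q"
  using g_right'[of q] by (simp add: g_tau0)

lemma g_c: "r * g c = r - 1"
  using g_right[of c] I1_special by (simp add: tau_c g_1)

text \<open>\<open>r * g c = r - 1\<close> and \<open>g c >= 0\<close> leave only
  \<open>r = 1\<close> to exclude. Then \<open>g c = 0\<close> and \<open>g (\<tau> 0) = 1\<close>,
  so \<open>c < \<tau> 0\<close>; \<open>tau_tau_0\<close> and monotonicity give
  \<open>g (\<tau> (\<tau> 0)) >= 1\<close>, but \<open>g_right\<close> gives 0.\<close>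

lemma r_gt_1: "1 < r"
proof (rule ccontr)
  assume "\<not> 1 < r"
  moreover have "0 \<le> g c"
    using g_mono[of 0 c] I1_special c_bounds g_0 by simp
  then have "0 \<le> r * g c"
    using r_pos by simp
  ultimately have r1: "r = 1" using g_c by simp
  then have gc: "g c = 0" and g0: "g (\<tau> 0) = 1"
    using g_c g_tau0 by auto
  have "\<not> \<tau> 0 \<le> c"
    using g_mono[OF tau0_I1 I1_special(2)] gc g0 by auto
  then have "c < \<tau> 0" by simp
  then have "g (\<tau> 0) \<le> g (\<tau> (\<tau> 0))" "g (\<tau> (\<tau> 0)) = 0"
    using g_mono[OF tau0_I1 tau_I1[OF tau0_I1] tau_tau_0] g_right[OF tau0_I1] r1 g0 by auto
  then show False using g0 by simp
qed

text \<open>Pulling an interval around \<open>\<sigma> p\<close> back along the branch through \<open>p\<close> divides its measure by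
  the slope, so iterating along the orbit of \<open>p\<close> shows that no point of the split space has mass.\<close>

lemma pull_back:
  assumes "p \<in> X"
  shows "\<exists>u\<in>I\<^sub>1 \<tau>. \<exists>v\<in>I\<^sub>1 \<tau>. p \<in> E v \<and> p \<notin> E u \<and> r ^ n * (g v - g u) \<le> 1"
  using assms
proof (induction n arbitrary: p)
  case 0
  then show ?case
    using I1_special g_0 g_1 by (intro bexI[of _ 0] bexI[of _ 1]) auto
next
  case (Suc n)
  obtain u v where uv: "u \<in> I\<^sub>1 \<tau>" "v \<in> I\<^sub>1 \<tau>" "sigma p \<in> E v" "sigma p \<notin> E u" "r ^ n * (g v - g u) \<le> 1"
    using Suc.IH[OF sigma_in_X[OF Suc.prems]] by auto
  note b = I1_bounds[OF uv(1)] I1_bounds[OF uv(2)]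
  show ?case
  proof (cases "p \<in> A")
    case True
    then have n0: "sigma p \<notin> E (\<tau> 0)"
      using sigma_image_A by auto
    \<comment> \<open>The left branch has no values left of the cut at \<open>\<tau> 0\<close>, so
      the lower cut is raised to it before pulling back; this can only decrease the measure.\<close>
    define u1 where "u1 = max u (\<tau> 0)"
    have u1: "u1 \<in> I\<^sub>1 \<tau>" "sigma p \<notin> E u1" "\<tau> 0 \<le> u1" "u1 \<le> 1"
      using uv n0 tau0_I1 b tau_bounds[of 0] by (auto simp: u1_def max_def)
    have v1: "\<tau> 0 \<le> v"
      using n0 uv(3) E_mono[of v "\<tau> 0"] b by (cases "\<tau> 0 \<le> v") auto
    have "g u \<le> g u1"
      using g_mono[OF uv(1) u1(1)] by (simp add: u1_def)
    obtain u' v' where u': "0 \<le> u'" "u' \<le> c" "\<tau> u' = u1" and v': "0 \<le> v'" "v' \<le> c" "\<tau> v' = v"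
      using left_preimage[of u1] left_preimage[of v] u1 v1 b by auto
    have I: "u' \<in> I\<^sub>1 \<tau>" "v' \<in> I\<^sub>1 \<tau>"
      using I1_invariant[of u'] I1_invariant[of v'] u' v' u1 uv c_bounds by auto
    have "p \<in> E v'" "p \<notin> E u'"
      using A_E_iff[OF True I(1) u'(2)] A_E_iff[OF True I(2) v'(2)] u' v' u1 uv by auto
    have "r * (g v' - g u') = g v - g u1"
      using g_left[OF I(1) u'(2)] g_left[OF I(2) v'(2)] u' v' by (simp add: algebra_simps)
    then have "r ^ Suc n * (g v' - g u') = r ^ n * (g v - g u1)"
      by (simp add: mult.assoc mult.left_commute)
    moreover have "r ^ n * (g v - g u1) \<le> r ^ n * (g v - g u)"
      using \<open>g u \<le> g u1\<close> r_pos by (intro mult_left_mono) auto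
    ultimately have "r ^ Suc n * (g v' - g u') \<le> 1"
      using uv(5) by linarith
    then show ?thesis
      using I \<open>p \<in> E v'\<close> \<open>p \<notin> E u'\<close> by blast
  next
    case False
    then have B: "p \<in> B" using Suc.prems A_Un_B by auto
    \<comment> \<open>The right branch reverses the order, so \<open>v\<close> supplies the lower
      cut and \<open>u\<close> the upper one.\<close>
    obtain u' v' where u': "c \<le> u'" "u' \<le> 1" "\<tau> u' = v" and v': "c \<le> v'" "v' \<le> 1" "\<tau> v' = u"
      using right_preimage[of u] right_preimage[of v] b by auto
    have I: "u' \<in> I\<^sub>1 \<tau>" "v' \<in> I\<^sub>1 \<tau>"
      using I1_invariant[of u'] I1_invariant[of v'] u' v' uv c_bounds by auto
    have "p \<in> E v'" "p \<notin> E u'"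
      using B_E_iff[OF B I(1) u'(1)] B_E_iff[OF B I(2) v'(1)] u' v' uv by auto
    moreover have "r * (g v' - g u') = g v - g u"
      using g_right[OF I(1) u'(1)] g_right[OF I(2) v'(1)] u' v' by (simp add: algebra_simps)
    then have "r ^ Suc n * (g v' - g u') = r ^ n * (g v - g u)"
      by (simp add: mult.assoc mult.left_commute)
    ultimately show ?thesis
      using I uv(5) by metis
  qed
qed

lemma small_interval:
  assumes "p \<in> X" "0 < \<epsilon>"
  shows "\<exists>u\<in>I\<^sub>1 \<tau>. \<exists>v\<in>I\<^sub>1 \<tau>. p \<in> E v \<and> p \<notin> E u \<and> g v - g u < \<epsilon>"
proof -
  obtain n where n: "1 / \<epsilon> < r ^ n"
    using real_arch_pow[OF r_gt_1] by auto
  obtain u v where uv: "u \<in> I\<^sub>1 \<tau>" "v \<in> I\<^sub>1 \<tau>" "p \<in> E v" "p \<notin> E u" "r ^ n * (g v - g u) \<le> 1"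
    using pull_back[OF assms(1), of n] by auto
  have "1 < r ^ n * \<epsilon>"
    using n assms by (simp add: field_simps)
  then have "r ^ n * (g v - g u) < r ^ n * \<epsilon>"
    using uv by linarith
  then have "g v - g u < \<epsilon>"
    using r_pos by simp
  then show ?thesis using uv by auto
qed

section \<open>The continuous extension and its functional equation\<close>

definition h :: "real \<Rightarrow> real" where
  "h x = Sup (g ` {q \<in> I\<^sub>1 \<tau>. q \<le> x})"

lemma h_bdd: "bdd_above (g ` {q \<in> I\<^sub>1 \<tau>. q \<le> x})"
  using g_mono[OF _ I1_special(3)] I1_bounds by (auto intro!: bdd_aboveI[of _ "g 1"])

lemma h_upper: "\<lbrakk>q \<in> I\<^sub>1 \<tau>; q \<le> x\<rbrakk> \<Longrightarrow> g q \<le> h x"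
  unfolding h_def by (intro cSup_upper h_bdd) auto

lemma h_least: "\<lbrakk>0 \<le> x; q \<in> I\<^sub>1 \<tau>; x \<le> q\<rbrakk> \<Longrightarrow> h x \<le> g q"
  unfolding h_def using I1_special g_mono by (intro cSup_least) auto

lemma h_eq: "q \<in> I\<^sub>1 \<tau> \<Longrightarrow> h q = g q"
  by (meson I1_bounds antisym h_least h_upper order_refl)

lemma h_mono: "0 \<le> x \<Longrightarrow> x \<le> y \<Longrightarrow> h x \<le> h y"
  unfolding h_def using I1_special by (intro cSup_subset_mono h_bdd) auto

lemma h_0: "h 0 = 0" and h_1: "h 1 = 1"
  using h_eq I1_special g_0 g_1 by auto

text \<open>The left copy of \<open>x\<close> has no mass, and a cut to its left lies strictly below
  \<open>x\<close>. For \<open>h_right\<close> the right copy is used in the same way.\<close>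

lemma h_left:
  assumes "0 < x" "x \<le> 1" "0 < \<epsilon>"
  shows "\<exists>u. 0 \<le> u \<and> u < x \<and> h x - h u < \<epsilon>"
proof -
  have p: "(x, False) \<in> X" using assms by (simp add: mem_X)
  then obtain u v where uv: "u \<in> I\<^sub>1 \<tau>" "v \<in> I\<^sub>1 \<tau>" "(x, False) \<in> E v" "(x, False) \<notin> E u" "g v - g u < \<epsilon>"
    using small_interval[OF p assms(3)] by auto
  then have "x \<le> v" "u < x"
    using assms p by (auto simp: mem_E)
  then show ?thesis
    using uv assms h_least[of x v] h_eq[of u] I1_bounds[of u] by (intro exI[of _ u]) auto
qed

lemma h_right:
  assumes "0 \<le> x" "x < 1" "0 < \<epsilon>"
  shows "\<exists>v. x < v \<and> v \<le> 1 \<and> h v - h x < \<epsilon>"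
proof -
  have p: "side x True \<in> X" using assms by (intro side_in_X) auto
  then obtain u v where uv: "u \<in> I\<^sub>1 \<tau>" "v \<in> I\<^sub>1 \<tau>" "side x True \<in> E v" "side x True \<notin> E u" "g v - g u < \<epsilon>"
    using small_interval[OF p assms(3)] by auto
  then have "x < v" "u \<le> x"
    using assms p by (auto simp: mem_E side_def)
  then show ?thesis
    using uv assms h_upper[of u x] h_eq[of v] I1_bounds[of v] by (intro exI[of _ v]) auto
qed

lemma continuous_h: "continuous_on {0..1} h"
  unfolding continuous_on_iff
proof (intro ballI allI impI)
  fix x \<epsilon> :: real assume x: "x \<in> {0..1}" and \<epsilon>: "0 < \<epsilon>"
  obtain d1 where d1: "0 < d1" "\<And>y. 0 \<le> y \<Longrightarrow> y \<le> x \<Longrightarrow> x - y < d1 \<Longrightarrow> h x - h y < \<epsilon>"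
  proof (cases "x = 0")
    case True
    then show ?thesis using that[of 1] \<epsilon> by auto
  next
    case False
    then obtain u where u: "0 \<le> u" "u < x" "h x - h u < \<epsilon>"
      using h_left[of x \<epsilon>] x \<epsilon> by auto
    show ?thesis
    proof (rule that[of "x - u"])
      fix y assume "0 \<le> y" "y \<le> x" "x - y < x - u"
      then show "h x - h y < \<epsilon>" using u h_mono[of u y] by auto
    qed (use u in auto)
  qed
  obtain d2 where d2: "0 < d2" "\<And>y. y \<le> 1 \<Longrightarrow> x \<le> y \<Longrightarrow> y - x < d2 \<Longrightarrow> h y - h x < \<epsilon>"
  proof (cases "x = 1")
    case True
    then show ?thesis using that[of 1] \<epsilon> by auto
  next
    case False
    then obtain v where v: "x < v" "v \<le> 1" "h v - h x < \<epsilon>"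
      using h_right[of x \<epsilon>] x \<epsilon> by auto
    show ?thesis
    proof (rule that[of "v - x"])
      fix y assume "y \<le> 1" "x \<le> y" "y - x < v - x"
      then show "h y - h x < \<epsilon>" using v h_mono[of y v] x by auto
    qed (use v in auto)
  qed
  have "dist (h y) (h x) < \<epsilon>" if y: "y \<in> {0..1}" "dist y x < min d1 d2" for y
  proof (cases "y \<le> x")
    case True
    then show ?thesis using y d1(2)[of y] h_mono[of y x] by (auto simp: dist_real_def)
  next
    case False
    then show ?thesis using y x d2(2)[of y] h_mono[of x y] by (auto simp: dist_real_def)
  qed
  then show "\<exists>d>0. \<forall>y\<in>{0..1}. dist y x < d \<longrightarrow> dist (h y) (h x) < \<epsilon>"
    using d1 d2 by (intro exI[of _ "min d1 d2"]) auto
qed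

text \<open>\<open>x\<close> is enclosed between cuts of nearly equal measure. After one end is
  moved to \<open>c\<close> if necessary, both lie on one branch, where \<open>g (\<tau> q)\<close>
  is affine in \<open>g q\<close> with slope \<open>r\<close> or \<open>-r\<close>; monotonicity
  squeezes \<open>h (\<tau> x)\<close>.\<close>

lemma h_tau:
  assumes x: "0 \<le> x" "x \<le> 1"
  shows "h (\<tau> x) = tent r (h x)"
proof -
  have p: "(x, False) \<in> X" using x by (simp add: mem_X)
  have "\<bar>h (\<tau> x) - tent r (h x)\<bar> \<le> 0 + \<epsilon>" if "0 < \<epsilon>" for \<epsilon>
  proof -
    have "0 < \<epsilon> / r" using that r_pos by simp
    from small_interval[OF p this]
    obtain u v where uv: "u \<in> I\<^sub>1 \<tau>" "v \<in> I\<^sub>1 \<tau>" "(x, False) \<in> E v" "(x, False) \<notin> E u" "g v - g u < \<epsilon> / r"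
      by auto
    have vx: "u \<le> x" "x \<le> v"
      using uv x p by (auto simp: mem_E)
    show ?thesis
    proof (cases "x \<le> c")
      case True
      \<comment> \<open>Moving the end to \<open>c\<close> keeps \<open>x\<close> enclosed. As
        \<open>h x <= g c\<close>, the left formula is the smaller one in
        \<open>tent\<close>.\<close>
      define w where "w = min v c"
      have w: "w \<in> I\<^sub>1 \<tau>" "x \<le> w" "w \<le> c" "g w \<le> g v"
        using uv vx True I1_special g_mono by (auto simp: w_def min_def)
      have "\<tau> u \<le> \<tau> x" "\<tau> x \<le> \<tau> w"
        using increasing[of u x] increasing[of x w] vx w True I1_bounds[OF uv(1)] x by (auto simp: order.order_iff_strict)
      then have "g (\<tau> u) \<le> h (\<tau> x)" "h (\<tau> x) \<le> g (\<tau> w)"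
        using h_upper[OF tau_I1[OF uv(1)]] h_least[OF _ tau_I1[OF w(1)]] tau_bounds[OF x] by auto
      moreover have "g u \<le> h x" "h x \<le> g w" "h x \<le> g c"
        using h_upper[OF uv(1) vx(1)] h_least[OF x(1) w(1,2)] h_least[OF x(1) I1_special(2) True] by auto
      moreover have "g (\<tau> u) = r * g u + 2 - r" "g (\<tau> w) = r * g w + 2 - r"
        using g_left[OF uv(1)] g_left[OF w(1,3)] vx True by (auto simp: g_tau0)
      moreover have "r * g u \<le> r * h x" "r * h x \<le> r * g w" "r * h x \<le> r * g c"
        using calculation r_pos by auto
      moreover have "r * g w \<le> r * g v" "r * g v - r * g u < \<epsilon>"
        using uv(5) w(4) r_pos by (simp_all add: field_simps)
      ultimately show ?thesis
        using g_c unfolding tent_def by linarith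
    next
      case False
      define w where "w = max u c"
      have w: "w \<in> I\<^sub>1 \<tau>" "w \<le> x" "c \<le> w" "g u \<le> g w"
        using uv vx False I1_special g_mono by (auto simp: w_def max_def)
      have "\<tau> v \<le> \<tau> x" "\<tau> x \<le> \<tau> w"
        using decreasing[of x v] decreasing[of w x] vx w False I1_bounds[OF uv(2)] x by (auto simp: order.order_iff_strict)
      then have "g (\<tau> v) \<le> h (\<tau> x)" "h (\<tau> x) \<le> g (\<tau> w)"
        using h_upper[OF tau_I1[OF uv(2)]] h_least[OF _ tau_I1[OF w(1)]] tau_bounds[OF x] by auto
      moreover have "g w \<le> h x" "h x \<le> g v" "g c \<le> h x"
        using h_upper[OF w(1,2)] h_least[OF x(1) uv(2) vx(2)] h_upper[OF I1_special(2), of x] False by auto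
      moreover have "g (\<tau> v) = r - r * g v" "g (\<tau> w) = r - r * g w"
        using g_right[OF uv(2)] g_right[OF w(1,3)] vx False by auto
      moreover have "r * g w \<le> r * h x" "r * h x \<le> r * g v" "r * g c \<le> r * h x"
        using calculation r_pos by auto
      moreover have "r * g u \<le> r * g w" "r * g v - r * g u < \<epsilon>"
        using uv(5) w(4) r_pos by (simp_all add: field_simps)
      ultimately show ?thesis
        using g_c unfolding tent_def by linarith
    qed
  qed
  then have "\<bar>h (\<tau> x) - tent r (h x)\<bar> \<le> 0"
    by (rule field_le_epsilon)
  then show ?thesis by simp
qed

lemma tau_iter_bounds: "0 \<le> x \<Longrightarrow> x \<le> 1 \<Longrightarrow> 0 \<le> (\<tau> ^^ n) x \<and> (\<tau> ^^ n) x \<le> 1"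
  by (induction n) (auto simp: tau_bounds)

lemma h_tau_iter: "0 \<le> x \<Longrightarrow> x \<le> 1 \<Longrightarrow> h ((\<tau> ^^ n) x) = (tent r ^^ n) (h x)"
  by (induction n) (auto simp: h_tau tau_iter_bounds)

text \<open>If \<open>h\<close> were constant on an interval, then by transitivity its value there would be periodic
  under the tent map, and \<open>h\<close> would take only finitely many values.\<close>

lemma h_strict_mono:
  assumes xy: "0 \<le> x" "x < y" "y \<le> 1"
  shows "h x < h y"
proof (rule ccontr)
  assume "\<not> h x < h y"
  then have const: "h z = h x" if "x \<le> z" "z \<le> y" for z
    using h_mono[of x z] h_mono[of z y] that xy by auto
  \<comment> \<open>The flat interval is halved so that an orbit returns from the left half to the
    right half; as the halves are disjoint, the return time \<open>k\<close> is positive.\<close>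
  define m where "m = (x + y) / 2"
  have m: "x < m" "m < y" using xy by (auto simp: m_def)
  define K where "K = (\<Union>k. (\<tau> ^^ k) ` {x<..<m})"
  have "\<exists>w\<in>K. m < w \<and> w < y"
  proof (rule invariant_meets[of x m])
    fix z assume "x < z" "z < m"
    then show "z \<in> K" by (auto simp: K_def intro!: exI[of _ 0])
  next
    fix z assume "z \<in> K"
    then obtain k z' where "z = (\<tau> ^^ k) z'" "z' \<in> {x<..<m}" by (auto simp: K_def)
    then have "\<tau> z = (\<tau> ^^ Suc k) z'" "z' \<in> {x<..<m}" by auto
    then show "\<tau> z \<in> K" unfolding K_def by blast
  qed (use xy m in auto)
  then obtain k z where z: "x < z" "z < m" "m < (\<tau> ^^ k) z" "(\<tau> ^^ k) z < y"
    by (auto simp: K_def)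
  have "k \<noteq> 0" using z by (cases k) auto
  have per: "(tent r ^^ k) (h x) = h x"
    using h_tau_iter[of z k] const[of z] const[of "(\<tau> ^^ k) z"] z xy m by auto
  define S where "S = (\<lambda>j. (tent r ^^ j) (h x)) ` {..<k}"
  have finS: "finite S" by (simp add: S_def)
  have "h x \<in> S"
    unfolding S_def using \<open>k \<noteq> 0\<close> by (intro image_eqI[of _ _ 0]) auto
  have tentS: "tent r w \<in> S" if "w \<in> S" for w
  proof -
    obtain j where j: "j < k" "w = (tent r ^^ j) (h x)"
      using \<open>w \<in> S\<close> by (auto simp: S_def)
    then have w: "tent r w = (tent r ^^ Suc j) (h x)" by simp
    show ?thesis
    proof (cases "Suc j = k")
      case True
      then show ?thesis using w per \<open>h x \<in> S\<close> by metis
    next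
      case False
      then show ?thesis using w j by (auto simp: S_def simp del: funpow.simps intro!: imageI)
    qed
  qed
  have "infinite ({0<..<1} - S)"
    using finS by (simp add: infinite_Ioo Diff_infinite_finite)
  then obtain w where w: "0 < w" "w < 1" "w \<notin> S"
    by (metis DiffD1 DiffD2 finite.emptyI ex_in_conv greaterThanLessThan_iff)
  obtain z0 where z0: "0 \<le> z0" "z0 \<le> 1" "h z0 = w"
    using IVT'[of h 0 w 1] continuous_h h_0 h_1 w by auto
  have z01: "0 < z0" "z0 < 1"
    using z0 w h_0 h_1 by (auto simp: order.order_iff_strict)
  have "open (- S)"
    using finS by (simp add: finite_imp_closed open_Compl)
  then obtain e where e: "0 < e" "\<And>w'. dist w' w < e \<Longrightarrow> w' \<notin> S"
    using w(3) unfolding open_dist by (metis ComplD ComplI)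
  obtain d where d: "0 < d" "\<And>z. z \<in> {0..1} \<Longrightarrow> dist z z0 < d \<Longrightarrow> dist (h z) (h z0) < e"
    using continuous_h e(1) z0 unfolding continuous_on_iff by (metis atLeastAtMost_iff)
  \<comment> \<open>Points with \<open>h\<close> in the finite periodic orbit \<open>S\<close> form
    an invariant set containing the flat interval, so they come arbitrarily close to
    \<open>z0\<close>; but near \<open>z0\<close> the values of \<open>h\<close> stay away from
    \<open>S\<close>.\<close>
  have "\<exists>z\<in>{z. 0 \<le> z \<and> z \<le> 1 \<and> h z \<in> S}. z0 < z \<and> z < min 1 (z0 + d)"
  proof (rule invariant_meets[of x y])
    fix z assume "x < z" "z < y"
    then show "z \<in> {z. 0 \<le> z \<and> z \<le> 1 \<and> h z \<in> S}"
      using const[of z] xy \<open>h x \<in> S\<close> by auto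
  next
    fix z assume "z \<in> {z. 0 \<le> z \<and> z \<le> 1 \<and> h z \<in> S}"
    then show "\<tau> z \<in> {z. 0 \<le> z \<and> z \<le> 1 \<and> h z \<in> S}"
      using tau_bounds h_tau tentS by auto
  qed (use xy z01 d in auto)
  then obtain z where "0 \<le> z" "z \<le> 1" "h z \<in> S" "z0 < z" "z < z0 + d" by auto
  then show False
    using d(2)[of z] e(2)[of "h z"] z0 by (auto simp: dist_real_def)
qed

theorem conjugate_to_tent:
  "\<exists>k. homeomorphism {0..1} {0..1} h k \<and> (\<forall>x\<in>{0..1}. h (\<tau> x) = tent r (h x))"
proof -
  have "h ` {0..1} = {0..1}"
  proof
    show "h ` {0..1} \<subseteq> {0..1}"
      using h_mono[of 0] h_mono[of _ 1] h_0 h_1 by auto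
    show "{0..1} \<subseteq> h ` {0..1}"
    proof
      fix w :: real assume "w \<in> {0..1}"
      then obtain z where "0 \<le> z" "z \<le> 1" "h z = w"
        using IVT'[of h 0 w 1] continuous_h h_0 h_1 by auto
      then show "w \<in> h ` {0..1}" by auto
    qed
  qed
  moreover have "inj_on h {0..1}"
    by (rule linorder_inj_onI) (use h_strict_mono in force)+
  ultimately obtain k where "homeomorphism {0..1} {0..1} h k"
    using homeomorphism_compact[OF compact_Icc continuous_h] by blast
  then show ?thesis
    using h_tau by auto
qed

end

section \<open>The dimension triple\<close>

context transitive_unimodal
begin

abbreviation "L \<equiv> transfer_op \<tau>"
abbreviation "dg_class f \<equiv> DG_rel \<tau> `` {f}"
abbreviation "padd f f' \<equiv> (\<lambda>x\<in>X. f x + f' x :: int)"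

lemma L_iter_CXZ: "f \<in> CXZ \<tau> \<Longrightarrow> (L ^^ n) f \<in> CXZ \<tau>"
  by (induction n) (auto intro: transfer_op_CXZ)

lemma padd_CXZ: "f \<in> CXZ \<tau> \<Longrightarrow> f' \<in> CXZ \<tau> \<Longrightarrow> padd f f' \<in> CXZ \<tau>"
  by (rule CXZ_combine)

lemma L_plus: "L (padd f f') = padd (L f) (L f')"
proof -
  have "(\<Sum>y\<in>preimages x. padd f f' y) = (\<Sum>y\<in>preimages x. f y) + (\<Sum>y\<in>preimages x. f' y)" for x
    unfolding sum.distrib[symmetric] by (intro sum.cong) (auto simp: preimages_def)
  then show ?thesis
    unfolding transfer_op_sum by (auto simp: fun_eq_iff restrict_def)
qed

lemma L_iter_plus: "(L ^^ n) (padd f f') = padd ((L ^^ n) f) ((L ^^ n) f')"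
  by (induction n) (simp_all only: funpow.simps o_apply id_apply L_plus)

lemma L_iter_eq_mono:
  assumes "(L ^^ n) f = (L ^^ n) f'" "n \<le> m"
  shows "(L ^^ m) f = (L ^^ m) f'"
proof -
  have "(L ^^ (m - n)) ((L ^^ n) f) = (L ^^ (m - n)) ((L ^^ n) f')"
    using assms by simp
  then show ?thesis
    using assms(2) by (simp flip: funpow_add[unfolded fun_eq_iff o_def, rule_format])
qed

lemma mem_DG_rel: "(f, f') \<in> DG_rel \<tau> \<longleftrightarrow> f \<in> CXZ \<tau> \<and> f' \<in> CXZ \<tau> \<and> (\<exists>n. (L ^^ n) f = (L ^^ n) f')"
  by (simp add: DG_rel_def)

lemma equiv_DG_rel: "equiv (CXZ \<tau>) (DG_rel \<tau>)"
proof (rule equivI)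
  show "DG_rel \<tau> \<subseteq> CXZ \<tau> \<times> CXZ \<tau>"
    by (auto simp: mem_DG_rel)
  show "refl_on (CXZ \<tau>) (DG_rel \<tau>)"
    by (auto simp: refl_on_def mem_DG_rel)
  show "sym (DG_rel \<tau>)"
    by (rule symI) (auto simp: mem_DG_rel eq_commute)
  show "trans (DG_rel \<tau>)"
  proof (rule transI)
    fix f1 f2 f3 assume "(f1, f2) \<in> DG_rel \<tau>" "(f2, f3) \<in> DG_rel \<tau>"
    then obtain n m where *: "f1 \<in> CXZ \<tau>" "f3 \<in> CXZ \<tau>" "(L ^^ n) f1 = (L ^^ n) f2" "(L ^^ m) f2 = (L ^^ m) f3"
      by (auto simp: mem_DG_rel)
    have "(L ^^ max n m) f1 = (L ^^ max n m) f3"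
      using L_iter_eq_mono[OF *(3), of "max n m"] L_iter_eq_mono[OF *(4), of "max n m"] by simp
    then show "(f1, f3) \<in> DG_rel \<tau>"
      using * by (auto simp: mem_DG_rel)
  qed
qed

lemma dg_class_eq_iff: "f \<in> CXZ \<tau> \<Longrightarrow> f' \<in> CXZ \<tau> \<Longrightarrow> dg_class f = dg_class f' \<longleftrightarrow> (f, f') \<in> DG_rel \<tau>"
  by (rule eq_equiv_class_iff[OF equiv_DG_rel])

lemma carrier_DG: "carrier (DG \<tau>) = {dg_class f |f. f \<in> CXZ \<tau>}"
  by (auto simp: DG_def quotient_def)

lemma mult_DG:
  assumes f: "f \<in> CXZ \<tau>" and f': "f' \<in> CXZ \<tau>"
  shows "dg_class f \<otimes>\<^bsub>DG \<tau>\<^esub> dg_class f' = dg_class (padd f f')"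
proof -
  have *: "dg_class (padd f1 f1') = dg_class (padd f f')" if "f1 \<in> dg_class f" "f1' \<in> dg_class f'" for f1 f1'
  proof -
    obtain n m where *: "f1 \<in> CXZ \<tau>" "f1' \<in> CXZ \<tau>" "(L ^^ n) f = (L ^^ n) f1" "(L ^^ m) f' = (L ^^ m) f1'"
      using \<open>f1 \<in> dg_class f\<close> \<open>f1' \<in> dg_class f'\<close> by (auto simp: mem_DG_rel)
    have "(L ^^ max n m) (padd f1 f1') = (L ^^ max n m) (padd f f')"
      unfolding L_iter_plus
      using L_iter_eq_mono[OF *(3), of "max n m"] L_iter_eq_mono[OF *(4), of "max n m"] by simp
    then show ?thesis
      using * f f' by (subst dg_class_eq_iff) (auto simp: mem_DG_rel padd_CXZ)
  qed
  have "f \<in> dg_class f" "f' \<in> dg_class f'"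
    using f f' by (auto simp: mem_DG_rel)
  have "(\<Union>f1\<in>dg_class f. \<Union>f1'\<in>dg_class f'. dg_class (padd f1 f1')) =
      (\<Union>f1\<in>dg_class f. \<Union>f1'\<in>dg_class f'. dg_class (padd f f'))"
    by (intro SUP_cong refl) (rule *)
  also have "\<dots> = dg_class (padd f f')"
    using \<open>f \<in> dg_class f\<close> \<open>f' \<in> dg_class f'\<close> by blast
  finally show ?thesis
    by (simp add: DG_def)
qed

lemma L_star_class:
  assumes f: "f \<in> CXZ \<tau>"
  shows "L_star \<tau> (dg_class f) = dg_class (L f)"
proof -
  have *: "dg_class (L f1) = dg_class (L f)" if f1: "f1 \<in> dg_class f" for f1
  proof -
    obtain n where *: "f1 \<in> CXZ \<tau>" "(L ^^ n) f = (L ^^ n) f1"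
      using f1 by (auto simp: mem_DG_rel)
    have "(L ^^ n) (L f1) = (L ^^ n) (L f)"
      using L_iter_eq_mono[OF *(2), of "Suc n"] by (simp add: funpow_swap1)
    then show ?thesis
      using * f by (subst dg_class_eq_iff) (auto simp: mem_DG_rel transfer_op_CXZ)
  qed
  have "f \<in> dg_class f"
    using f by (auto simp: mem_DG_rel)
  have "L_star \<tau> (dg_class f) = (\<Union>f1\<in>dg_class f. dg_class (L f))"
    unfolding L_star_def by (intro SUP_cong refl) (rule *)
  also have "\<dots> = dg_class (L f)"
    using \<open>f \<in> dg_class f\<close> by blast
  finally show ?thesis .
qed

lemma DG_pos: "DG_pos \<tau> = {dg_class f |f. f \<in> CXZ \<tau> \<and> (\<exists>n. \<forall>x\<in>X. 0 \<le> (L ^^ n) f x)}"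
  by (simp add: DG_pos_def)

end

context scaled_unimodal
begin

lemma \<omega>_iter: "f \<in> CXZ \<tau> \<Longrightarrow> \<omega> ((L ^^ n) f) = r ^ n * \<omega> f"
  by (induction n) (simp_all add: \<omega>_transfer L_iter_CXZ)

text \<open>\<open>\<omega>\<close> multiplies by the positive number \<open>r ^ n\<close> under
  \<open>n\<close> transfers, so it is determined by any iterate of \<open>f\<close>. The same
  cancellation makes it positive on the cone of the dimension group.\<close>

lemma \<omega>_cong: "(f, f') \<in> DG_rel \<tau> \<Longrightarrow> \<omega> f = \<omega> f'"
  using \<omega>_iter r_pos unfolding mem_DG_rel by (metis less_irrefl mult_cancel_left zero_less_power)

lemma \<omega>_nonneg': "\<lbrakk>f \<in> CXZ \<tau>; \<And>x. x \<in> X \<Longrightarrow> 0 \<le> (L ^^ n) f x\<rbrakk> \<Longrightarrow> 0 \<le> \<omega> f"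
  using \<omega>_nonneg[OF L_iter_CXZ, of f n] \<omega>_iter[of f n] zero_less_power[OF r_pos, of n]
  by (auto simp: zero_le_mult_iff)

end

text \<open>The state is composed with the inverse of \<open>\<phi>\<close> through chosen
  representatives \<open>F f\<close>, then divided by its value \<open>Z\<close> on the constant 1,
  which \<open>\<phi>\<close> need not preserve.\<close>

lemma scaled_state_transport:
  assumes T1: "scaled_unimodal \<tau>\<^sub>1 c\<^sub>1 r \<omega>" and T2: "transitive_unimodal \<tau>\<^sub>2 c\<^sub>2"
    and \<phi>: "\<phi> \<in> iso (DG \<tau>\<^sub>1) (DG \<tau>\<^sub>2)" "\<phi> ` DG_pos \<tau>\<^sub>1 = DG_pos \<tau>\<^sub>2"
      "\<And>a. a \<in> carrier (DG \<tau>\<^sub>1) \<Longrightarrow> \<phi> (L_star \<tau>\<^sub>1 a) = L_star \<tau>\<^sub>2 (\<phi> a)"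
  shows "\<exists>\<omega>'. scaled_state \<tau>\<^sub>2 r \<omega>'"
proof -
  interpret T1: scaled_unimodal \<tau>\<^sub>1 c\<^sub>1 r \<omega> by (fact T1)
  interpret T2: transitive_unimodal \<tau>\<^sub>2 c\<^sub>2 by (fact T2)
  have bij: "bij_betw \<phi> (carrier (DG \<tau>\<^sub>1)) (carrier (DG \<tau>\<^sub>2))" and hom: "\<phi> \<in> hom (DG \<tau>\<^sub>1) (DG \<tau>\<^sub>2)"
    using \<phi>(1) by (auto simp: iso_def)
  have "\<forall>f\<in>CXZ \<tau>\<^sub>2. \<exists>f'\<in>CXZ \<tau>\<^sub>1. \<phi> (T1.dg_class f') = T2.dg_class f"
  proof
    fix f assume "f \<in> CXZ \<tau>\<^sub>2"
    then have "T2.dg_class f \<in> \<phi> ` carrier (DG \<tau>\<^sub>1)"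
      unfolding bij_betw_imp_surj_on[OF bij] T2.carrier_DG by blast
    then show "\<exists>f'\<in>CXZ \<tau>\<^sub>1. \<phi> (T1.dg_class f') = T2.dg_class f"
      unfolding T1.carrier_DG by force
  qed
  then obtain F where F: "\<And>f. f \<in> CXZ \<tau>\<^sub>2 \<Longrightarrow> F f \<in> CXZ \<tau>\<^sub>1"
    "\<And>f. f \<in> CXZ \<tau>\<^sub>2 \<Longrightarrow> \<phi> (T1.dg_class (F f)) = T2.dg_class f"
    by metis
  \<comment> \<open>The value does not depend on the representative chosen for
    \<open>F f\<close>.\<close>
  have key: "\<omega> (F f) = \<omega> f'" if "f \<in> CXZ \<tau>\<^sub>2" "f' \<in> CXZ \<tau>\<^sub>1" "\<phi> (T1.dg_class f') = T2.dg_class f" for f f'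
  proof -
    have "T1.dg_class f' \<in> carrier (DG \<tau>\<^sub>1)" "T1.dg_class (F f) \<in> carrier (DG \<tau>\<^sub>1)"
      unfolding T1.carrier_DG using that F by blast+
    moreover have "\<phi> (T1.dg_class f') = \<phi> (T1.dg_class (F f))"
      using that F by simp
    ultimately have "T1.dg_class f' = T1.dg_class (F f)"
      using bij_betw_imp_inj_on[OF bij] by (metis inj_onD)
    then have "(f', F f) \<in> DG_rel \<tau>\<^sub>1"
      using T1.dg_class_eq_iff that F by blast
    then show ?thesis
      using T1.\<omega>_cong by metis
  qed
  define \<omega>' where "\<omega>' f = \<omega> (F f)" for f
  have add: "\<omega>' (T2.padd f f') = \<omega>' f + \<omega>' f'" if f: "f \<in> CXZ \<tau>\<^sub>2" "f' \<in> CXZ \<tau>\<^sub>2" for f f'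
  proof -
    have "\<phi> (T1.dg_class (T1.padd (F f) (F f'))) = \<phi> (T1.dg_class (F f) \<otimes>\<^bsub>DG \<tau>\<^sub>1\<^esub> T1.dg_class (F f'))"
      using F f T1.mult_DG by simp
    also have "\<dots> = T2.dg_class f \<otimes>\<^bsub>DG \<tau>\<^sub>2\<^esub> T2.dg_class f'"
      using hom_mult[OF hom, of "T1.dg_class (F f)" "T1.dg_class (F f')"] F f
      unfolding T1.carrier_DG by force
    also have "\<dots> = T2.dg_class (T2.padd f f')"
      using T2.mult_DG f by simp
    finally have "\<omega> (F (T2.padd f f')) = \<omega> (T1.padd (F f) (F f'))"
      using f F by (intro key T1.padd_CXZ T2.padd_CXZ) auto
    then show ?thesis
      using T1.\<omega>_add F f by (simp add: \<omega>'_def)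
  qed
  have nonneg: "0 \<le> \<omega>' f" if f: "f \<in> CXZ \<tau>\<^sub>2" "\<forall>x\<in>T2.X. 0 \<le> f x" for f
  proof -
    have "T2.dg_class f \<in> DG_pos \<tau>\<^sub>2"
      unfolding T2.DG_pos using f by (auto intro!: exI[of _ f] exI[of _ 0])
    then obtain f' n where f': "f' \<in> CXZ \<tau>\<^sub>1" "\<phi> (T1.dg_class f') = T2.dg_class f" "\<forall>x\<in>T1.X. 0 \<le> (T1.L ^^ n) f' x"
      unfolding \<phi>(2)[symmetric] T1.DG_pos by auto
    then show ?thesis
      using key[OF f(1) f'(1,2)] T1.\<omega>_nonneg'[of f' n] by (simp add: \<omega>'_def)
  qed
  have scale: "\<omega>' (T2.L f) = r * \<omega>' f" if f: "f \<in> CXZ \<tau>\<^sub>2" for f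
  proof -
    have "T1.dg_class (F f) \<in> carrier (DG \<tau>\<^sub>1)"
      unfolding T1.carrier_DG using F f by blast
    then have "\<phi> (T1.dg_class (T1.L (F f))) = T2.dg_class (T2.L f)"
      using \<phi>(3)[of "T1.dg_class (F f)"] F f T1.L_star_class T2.L_star_class by simp
    then have "\<omega> (F (T2.L f)) = \<omega> (T1.L (F f))"
      using f F by (intro key T1.transfer_op_CXZ T2.transfer_op_CXZ) auto
    then show ?thesis
      using T1.\<omega>_transfer F f by (simp add: \<omega>'_def)
  qed
  define Z where "Z = \<omega>' (\<lambda>x\<in>T2.X. 1)"
  have const: "\<omega>' (\<lambda>x\<in>T2.X. int n) = real n * Z" for n
  proof (induction n)
    case 0
    have "T2.padd (\<lambda>x\<in>T2.X. 0) (\<lambda>x\<in>T2.X. 0) = (\<lambda>x\<in>T2.X. 0)" by auto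
    then have "\<omega>' (\<lambda>x\<in>T2.X. 0) = \<omega>' (\<lambda>x\<in>T2.X. 0) + \<omega>' (\<lambda>x\<in>T2.X. 0)"
      using add[OF CXZ_const CXZ_const, of 0 0] by metis
    then show ?case
      by (simp only: of_nat_0 mult_zero_left)
  next
    case (Suc n)
    have "T2.padd (\<lambda>x\<in>T2.X. int n) (\<lambda>x\<in>T2.X. 1) = (\<lambda>x\<in>T2.X. int (Suc n))" by auto
    then have "\<omega>' (\<lambda>x\<in>T2.X. int (Suc n)) = \<omega>' (\<lambda>x\<in>T2.X. int n) + Z"
      unfolding Z_def using add[OF CXZ_const CXZ_const, of "int n" 1] by metis
    also have "\<dots> = real (Suc n) * Z"
      unfolding Suc.IH by (simp add: algebra_simps)
    finally show ?case .
  qed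
  \<comment> \<open>To see \<open>Z > 0\<close>: the image of the class of 1 has a representative
    \<open>e\<close> of value 1, and \<open>e\<close> is dominated by a constant \<open>C\<close>,
    so \<open>1 <= C * Z\<close>.\<close>
  have "T1.dg_class (\<lambda>x\<in>T1.X. 1) \<in> carrier (DG \<tau>\<^sub>1)"
    unfolding T1.carrier_DG using CXZ_const by blast
  then have "\<phi> (T1.dg_class (\<lambda>x\<in>T1.X. 1)) \<in> carrier (DG \<tau>\<^sub>2)"
    using hom hom_carrier by blast
  then obtain e where e: "e \<in> CXZ \<tau>\<^sub>2" "\<phi> (T1.dg_class (\<lambda>x\<in>T1.X. 1)) = T2.dg_class e"
    unfolding T2.carrier_DG by auto
  have e1: "\<omega>' e = 1"
    unfolding \<omega>'_def using key[OF e(1) CXZ_const e(2)] T1.\<omega>_1 by simp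
  obtain C :: nat where C: "\<And>x. x \<in> T2.X \<Longrightarrow> \<bar>e x\<bar> \<le> int C"
    using T2.CXZ_bounded[OF e(1)] by auto
  define d where "d = (\<lambda>x\<in>T2.X. (\<lambda>x\<in>T2.X. int C) x - e x)"
  have d: "d \<in> CXZ \<tau>\<^sub>2"
    unfolding d_def by (rule CXZ_combine[OF CXZ_const e(1)])
  have "0 \<le> \<omega>' d"
    using C by (intro nonneg[OF d]) (force simp: d_def abs_le_iff)
  moreover have "T2.padd e d = (\<lambda>x\<in>T2.X. int C)"
    by (auto simp: d_def)
  ultimately have "1 \<le> real C * Z"
    using add[OF e(1) d] const[of C] e1 by simp
  then have Z: "0 < Z"
    by (metis less_le_trans linorder_not_less mult_nonneg_nonpos of_nat_0_le_iff zero_less_one)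
  have "scaled_state \<tau>\<^sub>2 r (\<lambda>f. \<omega>' f / Z)"
    unfolding scaled_state_def
    using T1.r_pos add nonneg scale Z by (auto simp: add_divide_distrib Z_def[symmetric])
  then show ?thesis by blast
qed

section \<open>Conjugate maps have isomorphic dimension triples\<close>

locale conjugate_pair = T1: transitive_unimodal \<tau>\<^sub>1 c\<^sub>1 + T2: transitive_unimodal \<tau>\<^sub>2 c\<^sub>2
  for \<tau>\<^sub>1 c\<^sub>1 \<tau>\<^sub>2 c\<^sub>2 +
  fixes h k :: "real \<Rightarrow> real"
  assumes homeo: "homeomorphism {0..1} {0..1} h k"
    and conj: "\<And>x. x \<in> {0..1} \<Longrightarrow> h (\<tau>\<^sub>1 x) = \<tau>\<^sub>2 (h x)"
begin

section \<open>The conjugacy respects order and split points\<close>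

lemma k_h: "0 \<le> x \<Longrightarrow> x \<le> 1 \<Longrightarrow> k (h x) = x" and h_k: "0 \<le> x \<Longrightarrow> x \<le> 1 \<Longrightarrow> h (k x) = x"
  using homeo by (auto simp: homeomorphism_def)

lemma h_bounds: "0 \<le> x \<Longrightarrow> x \<le> 1 \<Longrightarrow> 0 \<le> h x \<and> h x \<le> 1" and
  k_bounds: "0 \<le> x \<Longrightarrow> x \<le> 1 \<Longrightarrow> 0 \<le> k x \<and> k x \<le> 1"
  using homeo unfolding homeomorphism_def by (metis atLeastAtMost_iff imageI)+

text \<open>By this symmetry, facts about \<open>h\<close> are reused for \<open>k\<close>.\<close>

lemma inverse: "conjugate_pair \<tau>\<^sub>2 c\<^sub>2 \<tau>\<^sub>1 c\<^sub>1 k h"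
proof
  show "homeomorphism {0..1} {0..1} k h"
    using homeo by (rule homeomorphism_symD)
  fix x :: real assume x: "x \<in> {0..1}"
  have "h (\<tau>\<^sub>1 (k x)) = \<tau>\<^sub>2 x"
    using conj[of "k x"] k_bounds[of x] h_k[of x] x by auto
  then show "k (\<tau>\<^sub>2 x) = \<tau>\<^sub>1 (k x)"
    using k_h[of "\<tau>\<^sub>1 (k x)"] T1.tau_bounds[of "k x"] k_bounds[of x] x by auto
qed

text \<open>An injective continuous map of an interval is monotone. A decreasing \<open>h\<close>
  would exchange 0 and 1, and conjugating \<open>\<tau>\<^sub>1 1 = 0\<close> would give
  \<open>\<tau>\<^sub>2 0 = 1\<close>, a value taken only at the interior point
  \<open>c\<^sub>2\<close>.\<close>

lemma h_strict_mono:
  assumes "0 \<le> x" "x < y" "y \<le> 1" shows "h x < h y"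
proof -
  have "strict_mono_on {0..1} h \<or> strict_antimono_on {0..1} h"
    using injective_eq_monotone_map[of "{0..1}" h] homeo k_h
    unfolding homeomorphism_def by (metis atLeastAtMost_iff inj_on_def is_interval_cc)
  moreover have "\<not> strict_antimono_on {0..1} h"
  proof
    assume anti: "strict_antimono_on {0..1} h"
    have "h (k 1) \<ge> h 1" "h (k 0) \<ge> h 1" "h 0 \<ge> h (k 1)"
      using anti k_bounds[of 1] k_bounds[of 0] unfolding monotone_on_def
      by (metis atLeastAtMost_iff order.order_iff_strict order_refl zero_le_one)+
    then have "h 1 = 0" "h 0 = 1"
      using h_k[of 1] h_k[of 0] h_bounds[of 0] h_bounds[of 1] by auto
    then have "\<tau>\<^sub>2 0 = 1"
      using conj[of 1] T1.tau_1 by simp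
    then show False
      using T2.tau_eq_1_iff[of 0] T2.c_bounds by simp
  qed
  ultimately show ?thesis
    using assms by (auto simp: strict_mono_on_def)
qed

lemma h_less_iff: "\<lbrakk>0 \<le> x; x \<le> 1; 0 \<le> y; y \<le> 1\<rbrakk> \<Longrightarrow> h x < h y \<longleftrightarrow> x < y"
  by (metis h_strict_mono less_asym less_linear)

lemma h_eq_iff: "\<lbrakk>0 \<le> x; x \<le> 1; 0 \<le> y; y \<le> 1\<rbrakk> \<Longrightarrow> h x = h y \<longleftrightarrow> x = y"
  by (metis k_h)

lemma h_0: "h 0 = 0"
  using h_less_iff[of "k 0" 0] h_k[of 0] k_bounds[of 0] h_bounds[of 0] by force

lemma h_1: "h 1 = 1"
  using h_less_iff[of 1 "k 1"] h_k[of 1] k_bounds[of 1] h_bounds[of 1] by force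

lemma h_c: "h c\<^sub>1 = c\<^sub>2"
  using conj[of c\<^sub>1] T1.tau_c T1.c_bounds h_1 T2.tau_eq_1_iff[of "h c\<^sub>1"] h_bounds[of c\<^sub>1] by auto

text \<open>The preimage under \<open>h\<close> of the orbit of \<open>h a\<close> is fully
  invariant and contains \<open>a\<close>.\<close>

lemma h_generalized_orbit:
  assumes a: "a \<in> {0..1}" and x: "x \<in> generalized_orbit \<tau>\<^sub>1 a"
  shows "h x \<in> generalized_orbit \<tau>\<^sub>2 (h a)"
proof -
  define S where "S = {x \<in> {0..1}. h x \<in> generalized_orbit \<tau>\<^sub>2 (h a)}"
  have ha: "h a \<in> {0..1}" using h_bounds a by auto
  have "\<tau>\<^sub>1 x \<in> S \<longleftrightarrow> x \<in> S" if "x \<in> {0..1}" for x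
    using that T2.generalized_orbit_props(3)[OF ha, of "h x"] conj[of x] h_bounds[of x] T1.tau_bounds[of x]
    by (auto simp: S_def)
  moreover have "S \<subseteq> {0..1}" "a \<in> S"
    using a T2.generalized_orbit_props(2)[OF ha] by (auto simp: S_def)
  ultimately have "S \<in> {A. A \<subseteq> {0..1} \<and> a \<in> A \<and> \<tau>\<^sub>1 ` A \<subseteq> A \<and> \<tau>\<^sub>1 -` A \<inter> {0..1} \<subseteq> A}"
    by blast
  then have "x \<in> S"
    using x unfolding generalized_orbit_def by (rule InterD[rotated])
  then show ?thesis by (simp add: S_def)
qed

lemma h_I1: "x \<in> I\<^sub>1 \<tau>\<^sub>1 \<Longrightarrow> h x \<in> I\<^sub>1 \<tau>\<^sub>2"
  unfolding I\<^sub>1_def T1.turning_point T2.turning_point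
  using h_generalized_orbit[of 0 x] h_generalized_orbit[of c\<^sub>1 x] h_generalized_orbit[of 1 x] T1.c_bounds
  by (auto simp: h_0 h_1 h_c)

text \<open>Sides are kept because \<open>h\<close> and \<open>k\<close> are increasing.\<close>

definition \<beta> :: "real \<times> bool \<Rightarrow> real \<times> bool" where "\<beta> p = (h (fst p), snd p)"
definition \<gamma> :: "real \<times> bool \<Rightarrow> real \<times> bool" where "\<gamma> p = (k (fst p), snd p)"

lemma k_I1: "y \<in> I\<^sub>1 \<tau>\<^sub>2 \<Longrightarrow> k y \<in> I\<^sub>1 \<tau>\<^sub>1"
  by (rule conjugate_pair.h_I1[OF inverse])

lemma h_I1_iff: "0 \<le> x \<Longrightarrow> x \<le> 1 \<Longrightarrow> h x \<in> I\<^sub>1 \<tau>\<^sub>2 \<longleftrightarrow> x \<in> I\<^sub>1 \<tau>\<^sub>1"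
  using h_I1[of x] k_I1[of "h x"] k_h[of x] by auto

lemma \<beta>_X: "p \<in> T1.X \<Longrightarrow> \<beta> p \<in> T2.X"
  using h_bounds h_I1 h_eq_iff[of "fst p" 0] h_eq_iff[of "fst p" 1]
  by (cases p) (auto simp: \<beta>_def T1.mem_X T2.mem_X h_0 h_1)

lemma \<gamma>_\<beta>: "p \<in> T1.X \<Longrightarrow> \<gamma> (\<beta> p) = p" and \<beta>_\<gamma>: "q \<in> T2.X \<Longrightarrow> \<beta> (\<gamma> q) = q"
  by (cases p; auto simp: \<beta>_def \<gamma>_def T1.mem_X k_h) (cases q; auto simp: \<beta>_def \<gamma>_def T2.mem_X h_k)

lemma \<beta>_less: "p \<in> T1.X \<Longrightarrow> q \<in> T1.X \<Longrightarrow> split_less (\<beta> p) (\<beta> q) \<longleftrightarrow> split_less p q"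
  by (cases p; cases q) (auto simp: \<beta>_def split_less_def T1.mem_X h_less_iff h_eq_iff)

lemma \<gamma>_X: "q \<in> T2.X \<Longrightarrow> \<gamma> q \<in> T1.X"
  using conjugate_pair.\<beta>_X[OF inverse] by (simp add: \<gamma>_def conjugate_pair.\<beta>_def[OF inverse])

lemma sigma_\<beta>:
  assumes "p \<in> T1.X" shows "T2.sigma (\<beta> p) = \<beta> (T1.sigma p)"
proof -
  obtain x b where p: "p = (x, b)" by (cases p)
  have x: "0 \<le> x" "x \<le> 1" using assms by (auto simp: p T1.mem_X)
  have t: "0 \<le> \<tau>\<^sub>1 x" "\<tau>\<^sub>1 x \<le> 1" using T1.tau_bounds x by auto
  have side: "T2.side (h y) s = \<beta> (T1.side y s)" if "0 \<le> y" "y \<le> 1" for y s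
    using that h_I1_iff[of y] h_eq_iff[of y 0] h_eq_iff[of y 1]
    by (simp add: T1.side_def T2.side_def \<beta>_def h_0 h_1)
  have "split_less (h x, b) (c\<^sub>2, True) \<longleftrightarrow> split_less (x, b) (c\<^sub>1, True)"
    using h_less_iff[of x c\<^sub>1] h_eq_iff[of x c\<^sub>1] x T1.c_bounds by (simp add: split_less_def h_c)
  moreover have "h x = 0 \<longleftrightarrow> x = 0"
    using h_eq_iff[of x 0] x by (simp add: h_0)
  moreover have "\<tau>\<^sub>2 (h x) = h (\<tau>\<^sub>1 x)"
    using conj[of x] x by simp
  ultimately show ?thesis
    using side[OF t] by (simp add: p T1.sigma_def T2.sigma_def \<beta>_def)
qed

lemma continuous_\<gamma>: "continuous_map (split_topology \<tau>\<^sub>2) (split_topology \<tau>\<^sub>1) \<gamma>"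
proof (rule continuous_map_into_split_topology)
  show "\<gamma> \<in> topspace (split_topology \<tau>\<^sub>2) \<rightarrow> T1.X"
    using \<gamma>_X by simp
  fix a assume a: "a \<in> T1.X"
  have "split_less (\<gamma> p) a \<longleftrightarrow> split_less p (\<beta> a)" "split_less a (\<gamma> p) \<longleftrightarrow> split_less (\<beta> a) p"
    if "p \<in> T2.X" for p
    using \<beta>_less[OF \<gamma>_X[OF that] a] \<beta>_less[OF a \<gamma>_X[OF that]] \<beta>_\<gamma>[OF that] by simp_all
  then have "{p \<in> topspace (split_topology \<tau>\<^sub>2). split_less (\<gamma> p) a} = {p \<in> T2.X. split_less p (\<beta> a)}"
    "{p \<in> topspace (split_topology \<tau>\<^sub>2). split_less a (\<gamma> p)} = {p \<in> T2.X. split_less (\<beta> a) p}"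
    by auto
  then show "openin (split_topology \<tau>\<^sub>2) {p \<in> topspace (split_topology \<tau>\<^sub>2). split_less (\<gamma> p) a}"
    "openin (split_topology \<tau>\<^sub>2) {p \<in> topspace (split_topology \<tau>\<^sub>2). split_less a (\<gamma> p)}"
    using openin_less_ray[OF \<beta>_X[OF a]] openin_greater_ray[OF \<beta>_X[OF a]] by simp_all
qed

section \<open>Transport of functions and classes\<close>

definition push :: "(real \<times> bool \<Rightarrow> int) \<Rightarrow> real \<times> bool \<Rightarrow> int" where
  "push f = (\<lambda>x\<in>T2.X. f (\<gamma> x))"

definition pull :: "(real \<times> bool \<Rightarrow> int) \<Rightarrow> real \<times> bool \<Rightarrow> int" where
  "pull f = (\<lambda>x\<in>T1.X. f (\<beta> x))"

lemma push_CXZ: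
  assumes "f \<in> CXZ \<tau>\<^sub>1" shows "push f \<in> CXZ \<tau>\<^sub>2"
  using restrict_mem_CXZ[OF continuous_map_compose[OF continuous_\<gamma> CXZ_continuous[OF assms]]]
  by (simp add: push_def o_def)

lemma pull_CXZ: "f \<in> CXZ \<tau>\<^sub>2 \<Longrightarrow> pull f \<in> CXZ \<tau>\<^sub>1"
  using conjugate_pair.push_CXZ[OF inverse, of f]
  by (simp add: pull_def conjugate_pair.push_def[OF inverse] \<beta>_def conjugate_pair.\<gamma>_def[OF inverse])

lemma pull_push: "f \<in> CXZ \<tau>\<^sub>1 \<Longrightarrow> pull (push f) = f"
  by (rule extensionalityI[of _ T1.X]) (auto simp: pull_def push_def CXZ_def \<beta>_X \<gamma>_\<beta>)

lemma push_pull: "f \<in> CXZ \<tau>\<^sub>2 \<Longrightarrow> push (pull f) = f"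
  by (rule extensionalityI[of _ T2.X]) (auto simp: pull_def push_def CXZ_def \<gamma>_X \<beta>_\<gamma>)

lemma preimages_\<beta>: "q \<in> T2.X \<Longrightarrow> T2.preimages q = \<beta> ` T1.preimages (\<gamma> q)"
proof (intro equalityI subsetI)
  fix y assume q: "q \<in> T2.X" and "y \<in> T2.preimages q"
  then have y: "y \<in> T2.X" "T2.sigma y = q" by (auto simp: T2.preimages_def)
  have "T1.sigma (\<gamma> y) = \<gamma> (T2.sigma (\<beta> (\<gamma> y)))"
    using sigma_\<beta>[OF \<gamma>_X[OF y(1)]] \<gamma>_\<beta>[OF T1.sigma_in_X[OF \<gamma>_X[OF y(1)]]] by simp
  then have "\<gamma> y \<in> T1.preimages (\<gamma> q)"
    using y \<beta>_\<gamma> \<gamma>_X by (simp add: T1.preimages_def)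
  then show "y \<in> \<beta> ` T1.preimages (\<gamma> q)"
    using \<beta>_\<gamma>[OF y(1)] by (metis imageI)
next
  fix y assume q: "q \<in> T2.X" and "y \<in> \<beta> ` T1.preimages (\<gamma> q)"
  then show "y \<in> T2.preimages q"
    using sigma_\<beta> \<beta>_X \<beta>_\<gamma>[OF q] by (auto simp: T1.preimages_def T2.preimages_def)
qed

lemma L_push: "T2.L (push f) = push (T1.L f)"
proof -
  have "(\<Sum>y\<in>T2.preimages x. push f y) = T1.L f (\<gamma> x)" if x: "x \<in> T2.X" for x
  proof -
    have "inj_on \<beta> (T1.preimages (\<gamma> x))"
      by (rule inj_on_inverseI[of _ \<gamma>]) (auto simp: T1.preimages_def \<gamma>_\<beta>)
    then have "(\<Sum>y\<in>T2.preimages x. push f y) = (\<Sum>y\<in>T1.preimages (\<gamma> x). push f (\<beta> y))"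
      unfolding preimages_\<beta>[OF x] by (simp add: sum.reindex)
    also have "\<dots> = (\<Sum>y\<in>T1.preimages (\<gamma> x). f y)"
      by (intro sum.cong) (auto simp: T1.preimages_def push_def \<beta>_X \<gamma>_\<beta>)
    finally show ?thesis
      using \<gamma>_X[OF x] by (simp add: T1.transfer_op_sum)
  qed
  then show ?thesis
    unfolding T2.transfer_op_sum push_def[of "T1.L f"] by (intro restrict_ext) auto
qed

lemma L_iter_push: "(T2.L ^^ n) (push f) = push ((T1.L ^^ n) f)"
  by (induction n) (simp_all add: L_push)

lemma push_padd: "push (T1.padd f f') = T2.padd (push f) (push f')"
  by (auto simp: push_def fun_eq_iff restrict_def \<gamma>_X)

lemma push_DG_rel_iff:
  assumes "f \<in> CXZ \<tau>\<^sub>1" "f' \<in> CXZ \<tau>\<^sub>1"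
  shows "(push f, push f') \<in> DG_rel \<tau>\<^sub>2 \<longleftrightarrow> (f, f') \<in> DG_rel \<tau>\<^sub>1"
proof -
  have "(T2.L ^^ n) (push f) = (T2.L ^^ n) (push f') \<longleftrightarrow> (T1.L ^^ n) f = (T1.L ^^ n) f'" for n
    unfolding L_iter_push using pull_push T1.L_iter_CXZ assms by metis
  then show ?thesis
    using assms by (simp add: T1.mem_DG_rel T2.mem_DG_rel push_CXZ)
qed

text \<open>\<open>push\<close> is a bijection that preserves and reflects the relation, so the
  isomorphism can be defined as direct image of classes, with no choice of representatives.\<close>

lemma image_push_class:
  assumes f: "f \<in> CXZ \<tau>\<^sub>1" shows "push ` T1.dg_class f = T2.dg_class (push f)"
proof (intro equalityI subsetI)
  fix f' assume "f' \<in> push ` T1.dg_class f"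
  then obtain f1 where f1: "(f, f1) \<in> DG_rel \<tau>\<^sub>1" "f' = push f1" by auto
  then have "f1 \<in> CXZ \<tau>\<^sub>1" by (simp add: T1.mem_DG_rel)
  then show "f' \<in> T2.dg_class (push f)"
    using push_DG_rel_iff[OF f] f1 by simp
next
  fix f' assume "f' \<in> T2.dg_class (push f)"
  then have f': "(push f, f') \<in> DG_rel \<tau>\<^sub>2" by simp
  then have "f' \<in> CXZ \<tau>\<^sub>2" by (simp add: T2.mem_DG_rel)
  then have "push (pull f') = f'" "pull f' \<in> CXZ \<tau>\<^sub>1"
    by (auto simp: push_pull pull_CXZ)
  then have "(f, pull f') \<in> DG_rel \<tau>\<^sub>1"
    using push_DG_rel_iff[OF f, of "pull f'"] f' by simp
  then show "f' \<in> push ` T1.dg_class f"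
    using \<open>push (pull f') = f'\<close> by (metis Image_singleton_iff imageI)
qed

theorem triple_isomorphic_dimension_triples:
  "triple_isomorphic (dimension_triple \<tau>\<^sub>1) (dimension_triple \<tau>\<^sub>2)"
proof -
  define \<phi> where "\<phi> A = push ` A" for A
  have \<phi>: "\<phi> (T1.dg_class f) = T2.dg_class (push f)" if "f \<in> CXZ \<tau>\<^sub>1" for f
    unfolding \<phi>_def by (rule image_push_class[OF that])
  have surj: "\<exists>f'\<in>CXZ \<tau>\<^sub>1. f = push f'" if "f \<in> CXZ \<tau>\<^sub>2" for f
    using push_pull[OF that] pull_CXZ[OF that] by metis
  have "\<phi> \<in> hom (DG \<tau>\<^sub>1) (DG \<tau>\<^sub>2)"
  proof (rule homI)
    fix a assume "a \<in> carrier (DG \<tau>\<^sub>1)"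
    then show "\<phi> a \<in> carrier (DG \<tau>\<^sub>2)"
      using \<phi> push_CXZ unfolding T1.carrier_DG T2.carrier_DG by blast
  next
    fix a b assume "a \<in> carrier (DG \<tau>\<^sub>1)" "b \<in> carrier (DG \<tau>\<^sub>1)"
    then obtain f f' where f: "f \<in> CXZ \<tau>\<^sub>1" "a = T1.dg_class f" "f' \<in> CXZ \<tau>\<^sub>1" "b = T1.dg_class f'"
      unfolding T1.carrier_DG by blast
    then show "\<phi> (a \<otimes>\<^bsub>DG \<tau>\<^sub>1\<^esub> b) = \<phi> a \<otimes>\<^bsub>DG \<tau>\<^sub>2\<^esub> \<phi> b"
      by (simp add: T1.mult_DG T2.mult_DG \<phi> T1.padd_CXZ push_CXZ push_padd)
  qed
  moreover have "inj_on \<phi> (carrier (DG \<tau>\<^sub>1))"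
  proof (rule inj_onI)
    fix a b assume "a \<in> carrier (DG \<tau>\<^sub>1)" "b \<in> carrier (DG \<tau>\<^sub>1)" and eq: "\<phi> a = \<phi> b"
    then obtain f f' where f: "f \<in> CXZ \<tau>\<^sub>1" "a = T1.dg_class f" "f' \<in> CXZ \<tau>\<^sub>1" "b = T1.dg_class f'"
      unfolding T1.carrier_DG by blast
    then show "a = b"
      using eq by (simp add: \<phi> T1.dg_class_eq_iff T2.dg_class_eq_iff push_CXZ push_DG_rel_iff)
  qed
  moreover have "\<phi> ` carrier (DG \<tau>\<^sub>1) = carrier (DG \<tau>\<^sub>2)"
  proof (intro equalityI subsetI)
    fix b assume "b \<in> \<phi> ` carrier (DG \<tau>\<^sub>1)"
    then show "b \<in> carrier (DG \<tau>\<^sub>2)"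
      using \<phi> push_CXZ unfolding T1.carrier_DG T2.carrier_DG by auto
  next
    fix b assume "b \<in> carrier (DG \<tau>\<^sub>2)"
    then obtain f where f: "f \<in> CXZ \<tau>\<^sub>1" "b = T2.dg_class (push f)"
      unfolding T2.carrier_DG using surj by blast
    then show "b \<in> \<phi> ` carrier (DG \<tau>\<^sub>1)"
      unfolding T1.carrier_DG using \<phi>[OF f(1)] by (intro image_eqI[of _ _ "T1.dg_class f"]) auto
  qed
  ultimately have iso: "\<phi> \<in> iso (DG \<tau>\<^sub>1) (DG \<tau>\<^sub>2)"
    by (simp add: iso_def bij_betw_def)
  have pos: "(\<forall>x\<in>T2.X. 0 \<le> (T2.L ^^ n) (push f) x) \<longleftrightarrow> (\<forall>x\<in>T1.X. 0 \<le> (T1.L ^^ n) f x)" for n f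
  proof -
    have "\<gamma> ` T2.X = T1.X"
      using \<gamma>_X \<gamma>_\<beta> \<beta>_X by (metis image_eqI subsetI equalityI image_subsetI)
    from this[symmetric] show ?thesis
      unfolding L_iter_push by (simp add: push_def)
  qed
  have "\<phi> ` DG_pos \<tau>\<^sub>1 = DG_pos \<tau>\<^sub>2"
  proof (intro equalityI subsetI)
    fix b assume "b \<in> \<phi> ` DG_pos \<tau>\<^sub>1"
    then obtain f n where "f \<in> CXZ \<tau>\<^sub>1" "b = \<phi> (T1.dg_class f)" "\<forall>x\<in>T1.X. 0 \<le> (T1.L ^^ n) f x"
      unfolding T1.DG_pos by blast
    then show "b \<in> DG_pos \<tau>\<^sub>2"
      unfolding T2.DG_pos using \<phi> push_CXZ pos by blast
  next
    fix b assume "b \<in> DG_pos \<tau>\<^sub>2"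
    then obtain f n where f: "f \<in> CXZ \<tau>\<^sub>1" "b = T2.dg_class (push f)" "\<forall>x\<in>T2.X. 0 \<le> (T2.L ^^ n) (push f) x"
      unfolding T2.DG_pos using surj by blast
    then have "T1.dg_class f \<in> DG_pos \<tau>\<^sub>1"
      unfolding T1.DG_pos using pos by blast
    then show "b \<in> \<phi> ` DG_pos \<tau>\<^sub>1"
      using \<phi>[OF f(1)] f(2) by (metis imageI)
  qed
  moreover have "\<phi> (L_star \<tau>\<^sub>1 a) = L_star \<tau>\<^sub>2 (\<phi> a)" if a: "a \<in> carrier (DG \<tau>\<^sub>1)" for a
  proof -
    obtain f where f: "f \<in> CXZ \<tau>\<^sub>1" "a = T1.dg_class f"
      using a unfolding T1.carrier_DG by blast
    then show ?thesis
      by (simp add: T1.L_star_class T2.L_star_class \<phi> T1.transfer_op_CXZ push_CXZ L_push)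
  qed
  ultimately show ?thesis
    unfolding dimension_triple_def triple_isomorphic.simps using iso by blast
qed

end

theorem corollary8p3:
  fixes \<tau>\<^sub>1 \<tau>\<^sub>2 :: "real \<Rightarrow> real"
  assumes "unimodal \<tau>\<^sub>1" and "transitive_map \<tau>\<^sub>1"
    and "unimodal \<tau>\<^sub>2" and "transitive_map \<tau>\<^sub>2"
  shows "conjugate_maps \<tau>\<^sub>1 \<tau>\<^sub>2 \<longleftrightarrow>
    triple_isomorphic (dimension_triple \<tau>\<^sub>1) (dimension_triple \<tau>\<^sub>2)"
proof -
  obtain c\<^sub>1 c\<^sub>2 where c: "unimodal_at \<tau>\<^sub>1 c\<^sub>1" "unimodal_at \<tau>\<^sub>2 c\<^sub>2"
    using assms by (auto simp: unimodal_def)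
  have T1: "transitive_unimodal \<tau>\<^sub>1 c\<^sub>1" and T2: "transitive_unimodal \<tau>\<^sub>2 c\<^sub>2"
    using c assms by (auto intro: transitive_unimodal.intro)
  show ?thesis
  proof
    assume "conjugate_maps \<tau>\<^sub>1 \<tau>\<^sub>2"
    then obtain h k where hk: "homeomorphism {0..1} {0..1} h k" "\<forall>x\<in>{0..1}. h (\<tau>\<^sub>1 x) = \<tau>\<^sub>2 (h x)"
      by (auto simp: conjugate_maps_def)
    then have "conjugate_pair \<tau>\<^sub>1 c\<^sub>1 \<tau>\<^sub>2 c\<^sub>2 h k"
      using T1 T2 by (intro conjugate_pair.intro conjugate_pair_axioms.intro) auto
    then show "triple_isomorphic (dimension_triple \<tau>\<^sub>1) (dimension_triple \<tau>\<^sub>2)"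
      by (rule conjugate_pair.triple_isomorphic_dimension_triples)
  next
    assume "triple_isomorphic (dimension_triple \<tau>\<^sub>1) (dimension_triple \<tau>\<^sub>2)"
    then obtain \<phi> where \<phi>: "\<phi> \<in> iso (DG \<tau>\<^sub>1) (DG \<tau>\<^sub>2)" "\<phi> ` DG_pos \<tau>\<^sub>1 = DG_pos \<tau>\<^sub>2"
      "\<And>a. a \<in> carrier (DG \<tau>\<^sub>1) \<Longrightarrow> \<phi> (L_star \<tau>\<^sub>1 a) = L_star \<tau>\<^sub>2 (\<phi> a)"
      by (auto simp: dimension_triple_def)
    obtain r \<omega> where "scaled_state \<tau>\<^sub>1 r \<omega>"
      using transitive_unimodal.exists_scaled_state[OF T1] by auto
    with T1 have S1: "scaled_unimodal \<tau>\<^sub>1 c\<^sub>1 r \<omega>"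
      by (intro scaled_unimodal.intro scaled_unimodal_axioms.intro)
    obtain \<omega>' where "scaled_state \<tau>\<^sub>2 r \<omega>'"
      using scaled_state_transport[OF S1 T2 \<phi>] by blast
    with T2 have S2: "scaled_unimodal \<tau>\<^sub>2 c\<^sub>2 r \<omega>'"
      by (intro scaled_unimodal.intro scaled_unimodal_axioms.intro)
    obtain h1 k1 where h1: "homeomorphism {0..1} {0..1} h1 k1" "\<forall>x\<in>{0..1}. h1 (\<tau>\<^sub>1 x) = tent r (h1 x)"
      using scaled_unimodal.conjugate_to_tent[OF S1] by blast
    obtain h2 k2 where h2: "homeomorphism {0..1} {0..1} h2 k2" "\<forall>x\<in>{0..1}. h2 (\<tau>\<^sub>2 x) = tent r (h2 x)"
      using scaled_unimodal.conjugate_to_tent[OF S2] by blast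
    have "homeomorphism {0..1} {0..1} (k2 \<circ> h1) (k1 \<circ> h2)"
      using homeomorphism_compose[OF h1(1) homeomorphism_symD[OF h2(1)]] .
    moreover have "(k2 \<circ> h1) (\<tau>\<^sub>1 x) = \<tau>\<^sub>2 ((k2 \<circ> h1) x)" if x: "x \<in> {0..1}" for x
    proof -
      have h1x: "h1 x \<in> {0..1}" and k2x: "k2 (h1 x) \<in> {0..1}" and inv: "h2 (k2 (h1 x)) = h1 x"
        using h1(1) h2(1) x unfolding homeomorphism_def by blast+
      have "h2 (\<tau>\<^sub>2 (k2 (h1 x))) = h1 (\<tau>\<^sub>1 x)"
        using h1(2) h2(2) x k2x inv by simp
      moreover have "k2 (h2 (\<tau>\<^sub>2 (k2 (h1 x)))) = \<tau>\<^sub>2 (k2 (h1 x))"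
        using h2(1) transitive_unimodal.maps_into[OF T2 k2x] unfolding homeomorphism_def by blast
      ultimately show ?thesis by simp
    qed
    ultimately show "conjugate_maps \<tau>\<^sub>1 \<tau>\<^sub>2"
      unfolding conjugate_maps_def by blast
  qed
qed

end
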